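(* Let $V=\bigoplus_{i\in\mathbb Z}V_i$ be a finite-dimensional $\mathbb Z$-graded real vector space. Let $A$ be the $\mathbb Z$-graded supercommutative algebra generated over $C^\infty(V_0)$ by $\bigoplus_{i\neq 0}V_i$, and let $F$ and $F_{pol}$ be the two filtrations of $A$ by graded ideals (all as defined in the context). Then the two degreewise graded completions $$\widehat A=\bigoplus_{r\in\mathbb Z}\varprojlim_p (A/F^pA)_r,\qquad \widehat B=\bigoplus_{r\in\mathbb Z}\varprojlim_p (A/F_{pol}^pA)_r$$ are isomorphic as $\mathbb Z$-graded supercommutative algebras.
   Context: Let $C=C^\infty(V_0)$ be the algebra of smooth real functions on the weight-$0$ component, and for $i\in\mathbb Z\setminus\{0\}$ let $\mathcal E_i=C\otimes_{\mathbb R}V_i$, placed in weight $i$. Define $$A=\mathrm{Sym}_{C}\Big(\bigoplus_{i\ne0}\mathcal E_i\Big)=T_{C}\Big(\bigoplus_{i\neq 0}\mathcal E_i\Big)\Big/\big\langle v_1\otimes v_2-(-1)^{p(v_1)p(v_2)}v_2\otimes v_1\big\rangle,$$ where $p(v)\in\mathbb Z_2$ is the weight of the homogeneous element $v$ modulo $2$. Elements of $C$ have weight $0$. Then $A=\bigoplus_{r\in\mathbb Z}A_r$ is a supercommutative $\mathbb Z$-graded algebra, where $A_r$ is the component of total weight $r$ (so $A_0$ contains $C$ but is in general larger, since it also contains weight-$0$ products of elements of nonzero weight). Filtrations, indexed by $p\in\mathbb N_0$: - $F^pA$ is the graded ideal generated by all homogeneous elements of weight $\ge p$ for $p\ge1$,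 and $F^0A=A$. - $F_{pol}^pA=\mathcal I^p$ is the $p$-th power of the ideal $\mathcal I$ generated by $\bigoplus_{i\ne0}A_i$ (with $F_{pol}^0A=A$). Both are decreasing filtrations by graded ideals. The notation $(A/F^pA)_r$ means the weight-$r$ component of the quotient, i.e. $A_r/(F^pA\cap A_r)$, and similarly for $F_{pol}$. The products on $\widehat A$ and $\widehat B$ are the ones induced from $A$ on the limits, $\widehat A_r\times\widehat A_s\to\widehat A_{r+s}$ and $\widehat B_r\times\widehat B_s\to\widehat B_{r+s}$. *)

theory Defs
  imports Complex_Main "HOL-Algebra.Module" "HOL-Algebra.QuotRing" "HOL-Algebra.Ideal_Product"
begin

section \<open>Graded vector spaces and smooth functions\<close>

text \<open>Internal direct sums: \<open>V\<close> stands for the space \<open>span (\<Union>i. V i)\<close>.  The norm of the ambient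
  type is only used through its topology, which on a finite-dimensional subspace is the
  canonical one.\<close>

definition graded_vector_space :: "(int \<Rightarrow> 'v::real_vector set) \<Rightarrow> bool" where
  "graded_vector_space V \<longleftrightarrow>
     (\<forall>i. subspace (V i)) \<and>
     (\<forall>x. (\<forall>i. x i \<in> V i) \<and> finite {i. x i \<noteq> 0} \<and> (\<Sum>i\<in>{i. x i \<noteq> 0}. x i) = 0
        \<longrightarrow> (\<forall>i. x i = 0))"

text \<open>\<open>C\<^sup>k\<close> functions on a finite-dimensional subspace \<open>S\<close>: for \<open>v \<in> S\<close> the number \<open>f' x v\<close> is the
  derivative of \<open>f\<close> at \<open>x\<close> in direction \<open>v\<close>, and it does not depend on the choice of \<open>f' x\<close>,
  which is determined on \<open>S\<close> only.\<close>

primrec Ck_on :: "nat \<Rightarrow> 'v::real_normed_vector set \<Rightarrow> ('v \<Rightarrow> real) \<Rightarrow> bool" where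
  "Ck_on 0 S f = continuous_on S f"
| "Ck_on (Suc k) S f =
     (\<exists>f'. (\<forall>x\<in>S. (f has_derivative f' x) (at x within S)) \<and> (\<forall>v\<in>S. Ck_on k S (\<lambda>x. f' x v)))"

definition real_ring :: "real ring" where
  "real_ring = \<lparr>carrier = UNIV, mult = (*), one = 1, zero = 0, add = (+)\<rparr>"

text \<open>The real algebra of smooth functions on \<open>S\<close>; functions on \<open>S\<close> are represented by their
  extensional representatives.\<close>

definition smooth_algebra :: "'v::real_normed_vector set \<Rightarrow> (real, 'v \<Rightarrow> real) module" where
  "smooth_algebra S =
     \<lparr>carrier = {f \<in> extensional S. \<forall>k. Ck_on k S f},
      mult = (\<lambda>f g. \<lambda>x\<in>S. f x * g x), one = (\<lambda>x\<in>S. 1),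
      zero = (\<lambda>x\<in>S. 0), add = (\<lambda>f g. \<lambda>x\<in>S. f x + g x),
      smult = (\<lambda>r f. \<lambda>x\<in>S. r * f x)\<rparr>"


section \<open>Modules and tensor products\<close>

text \<open>The type \<open>module\<close> is used both for algebras and for modules; for the latter the fields \<open>mult\<close>
  and \<open>one\<close> carry no meaning.\<close>

definition subspace_module :: "'v::real_vector set \<Rightarrow> (real, 'v) module" where
  "subspace_module S =
     \<lparr>carrier = S, mult = undefined, one = undefined, zero = 0, add = (+), smult = (*\<^sub>R)\<rparr>"

definition with_smult :: "('a, 'm) module \<Rightarrow> ('b \<Rightarrow> 'm \<Rightarrow> 'm) \<Rightarrow> ('b, 'm) module" where
  "with_smult M s =
     \<lparr>carrier = carrier M, mult = mult M, one = one M, zero = zero M, add = add M, smult = s\<rparr>"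

definition restrict_scalars :: "('k \<Rightarrow> 'c) \<Rightarrow> ('c, 'm) module \<Rightarrow> ('k, 'm) module" where
  "restrict_scalars \<phi> M = with_smult M (\<lambda>k x. \<phi> k \<odot>\<^bsub>M\<^esub> x)"

text \<open>The quotient of a module by a submodule, or of an algebra by a two-sided ideal.\<close>

definition quot :: "('c, 'm) module \<Rightarrow> 'm set \<Rightarrow> ('c, 'm set) module" where
  "quot M N =
     \<lparr>carrier = carrier (M Quot N), mult = mult (M Quot N), one = one (M Quot N),
      zero = zero (M Quot N), add = add (M Quot N),
      smult = (\<lambda>c X. \<Union>x\<in>X. N +>\<^bsub>M\<^esub> (c \<odot>\<^bsub>M\<^esub> x))\<rparr>"

definition submodule_span :: "('c, 'd) ring_scheme \<Rightarrow> ('c, 'm) module \<Rightarrow> 'm set \<Rightarrow> 'm set" where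
  "submodule_span R M S = \<Inter>{N. submodule N R M \<and> S \<subseteq> N}"

definition single :: "('c, 'd) ring_scheme \<Rightarrow> 'x \<Rightarrow> 'x \<Rightarrow> 'c" where
  "single R x = (\<lambda>y. if y = x then \<one>\<^bsub>R\<^esub> else \<zero>\<^bsub>R\<^esub>)"

definition free_module :: "('c, 'd) ring_scheme \<Rightarrow> 'x set \<Rightarrow> ('c, 'x \<Rightarrow> 'c) module" where
  "free_module R X =
     \<lparr>carrier = {a. (\<forall>x. a x \<in> carrier R) \<and> (\<forall>x. x \<notin> X \<longrightarrow> a x = \<zero>\<^bsub>R\<^esub>) \<and> finite {x. a x \<noteq> \<zero>\<^bsub>R\<^esub>}},
      mult = undefined, one = undefined,
      zero = (\<lambda>x. \<zero>\<^bsub>R\<^esub>), add = (\<lambda>a b x. a x \<oplus>\<^bsub>R\<^esub> b x), smult = (\<lambda>r a x. r \<otimes>\<^bsub>R\<^esub> a x)\<rparr>"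

definition bilinear_rels ::
  "('k, 'd) ring_scheme \<Rightarrow> ('k, 'm) module \<Rightarrow> ('k, 'n) module \<Rightarrow> ('m \<times> 'n \<Rightarrow> 'k) set" where
  "bilinear_rels R M N =
    (let L = free_module R (carrier M \<times> carrier N); \<delta> = single R in
      {\<delta> (m \<oplus>\<^bsub>M\<^esub> m', n) \<ominus>\<^bsub>L\<^esub> (\<delta> (m, n) \<oplus>\<^bsub>L\<^esub> \<delta> (m', n)) | m m' n.
         m \<in> carrier M \<and> m' \<in> carrier M \<and> n \<in> carrier N} \<union>
      {\<delta> (m, n \<oplus>\<^bsub>N\<^esub> n') \<ominus>\<^bsub>L\<^esub> (\<delta> (m, n) \<oplus>\<^bsub>L\<^esub> \<delta> (m, n')) | m n n'.
         m \<in> carrier M \<and> n \<in> carrier N \<and> n' \<in> carrier N} \<union>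
      {\<delta> (r \<odot>\<^bsub>M\<^esub> m, n) \<ominus>\<^bsub>L\<^esub> (r \<odot>\<^bsub>L\<^esub> \<delta> (m, n)) | r m n.
         r \<in> carrier R \<and> m \<in> carrier M \<and> n \<in> carrier N} \<union>
      {\<delta> (m, r \<odot>\<^bsub>N\<^esub> n) \<ominus>\<^bsub>L\<^esub> (r \<odot>\<^bsub>L\<^esub> \<delta> (m, n)) | r m n.
         r \<in> carrier R \<and> m \<in> carrier M \<and> n \<in> carrier N})"

definition tensor_kernel ::
  "('k, 'd) ring_scheme \<Rightarrow> ('k, 'm) module \<Rightarrow> ('k, 'n) module \<Rightarrow> ('m \<times> 'n \<Rightarrow> 'k) set" where
  "tensor_kernel R M N =
     submodule_span R (free_module R (carrier M \<times> carrier N)) (bilinear_rels R M N)"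

definition tensor ::
  "('k, 'd) ring_scheme \<Rightarrow> ('k, 'm) module \<Rightarrow> ('k, 'n) module \<Rightarrow> ('k, ('m \<times> 'n \<Rightarrow> 'k) set) module" where
  "tensor R M N = quot (free_module R (carrier M \<times> carrier N)) (tensor_kernel R M N)"

text \<open>For an algebra \<open>C\<close> over \<open>R\<close>, the tensor product of \<open>C\<close> and \<open>N\<close> over \<open>R\<close> is a module over \<open>C\<close>,
  with \<open>c\<close> sending the class of \<open>(f, n)\<close> to that of \<open>(c f, n)\<close>; \<open>left_mult\<close> is this action on
  representatives.\<close>

definition left_mult ::
  "('k, 'd) ring_scheme \<Rightarrow> ('k, 'c) module \<Rightarrow> 'c \<Rightarrow> ('c \<times> 'n \<Rightarrow> 'k) \<Rightarrow> 'c \<times> 'n \<Rightarrow> 'k" where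
  "left_mult R C c a =
     (\<lambda>(g, n). \<Oplus>\<^bsub>R\<^esub>f\<in>{f \<in> carrier C. a (f, n) \<noteq> \<zero>\<^bsub>R\<^esub> \<and> c \<otimes>\<^bsub>C\<^esub> f = g}. a (f, n))"

definition extend_scalars ::
  "('k, 'd) ring_scheme \<Rightarrow> ('k, 'c) module \<Rightarrow> ('k, 'n) module \<Rightarrow> ('c, ('c \<times> 'n \<Rightarrow> 'k) set) module" where
  "extend_scalars R C N =
     with_smult (tensor R C N)
       (\<lambda>c X. \<Union>a\<in>X. tensor_kernel R C N
                 +>\<^bsub>free_module R (carrier C \<times> carrier N)\<^esub> left_mult R C c a)"

definition direct_sum :: "'i set \<Rightarrow> ('i \<Rightarrow> ('c, 'e) module) \<Rightarrow> ('c, 'i \<Rightarrow> 'e) module" where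
  "direct_sum I E =
     \<lparr>carrier = {x \<in> (\<Pi>\<^sub>E i\<in>I. carrier (E i)). finite {i\<in>I. x i \<noteq> \<zero>\<^bsub>E i\<^esub>}},
      mult = undefined, one = undefined,
      zero = (\<lambda>i\<in>I. \<zero>\<^bsub>E i\<^esub>),
      add = (\<lambda>x y. \<lambda>i\<in>I. x i \<oplus>\<^bsub>E i\<^esub> y i),
      smult = (\<lambda>c x. \<lambda>i\<in>I. c \<odot>\<^bsub>E i\<^esub> x i)\<rparr>"


section \<open>The supersymmetric algebra of a graded module\<close>

text \<open>The tensor algebra of \<open>M\<close> is the free associative algebra on the set \<open>carrier M\<close> (finitely
  supported combinations of words, multiplied by concatenation) modulo linearity in each letter.\<close>

definition free_algebra :: "('c, 'd) ring_scheme \<Rightarrow> 'x set \<Rightarrow> ('c, 'x list \<Rightarrow> 'c) module" where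
  "free_algebra C X =
     (free_module C (lists X))
       \<lparr>mult := (\<lambda>a b w. \<Oplus>\<^bsub>C\<^esub>k\<in>{..length w}. a (take k w) \<otimes>\<^bsub>C\<^esub> b (drop k w)),
        one := single C []\<rparr>"

definition linear_rels :: "('c, 'd) ring_scheme \<Rightarrow> ('c, 'm) module \<Rightarrow> ('m list \<Rightarrow> 'c) set" where
  "linear_rels C M =
    (let L = free_algebra C (carrier M); \<delta> = single C in
      {\<delta> [m \<oplus>\<^bsub>M\<^esub> m'] \<ominus>\<^bsub>L\<^esub> (\<delta> [m] \<oplus>\<^bsub>L\<^esub> \<delta> [m']) | m m'. m \<in> carrier M \<and> m' \<in> carrier M} \<union>
      {\<delta> [c \<odot>\<^bsub>M\<^esub> m] \<ominus>\<^bsub>L\<^esub> (c \<odot>\<^bsub>L\<^esub> \<delta> [m]) | c m. c \<in> carrier C \<and> m \<in> carrier M})"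

definition tensor_kernel_alg :: "('c, 'd) ring_scheme \<Rightarrow> ('c, 'm) module \<Rightarrow> ('m list \<Rightarrow> 'c) set" where
  "tensor_kernel_alg C M = Idl\<^bsub>free_algebra C (carrier M)\<^esub> (linear_rels C M)"

definition tensor_algebra ::
  "('c, 'd) ring_scheme \<Rightarrow> ('c, 'm) module \<Rightarrow> ('c, ('m list \<Rightarrow> 'c) set) module" where
  "tensor_algebra C M = quot (free_algebra C (carrier M)) (tensor_kernel_alg C M)"

definition letter :: "('c, 'd) ring_scheme \<Rightarrow> ('c, 'm) module \<Rightarrow> 'm \<Rightarrow> ('m list \<Rightarrow> 'c) set" where
  "letter C M m = tensor_kernel_alg C M +>\<^bsub>free_algebra C (carrier M)\<^esub> single C [m]"

text \<open>Multiplication by the sign \<open>(-1)\<close> to the power \<open>i * j\<close>.\<close>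

definition koszul :: "('a, 'd) ring_scheme \<Rightarrow> int \<Rightarrow> int \<Rightarrow> 'a \<Rightarrow> 'a" where
  "koszul A i j x = (if odd (i * j) then \<ominus>\<^bsub>A\<^esub> x else x)"

definition homogeneous :: "int set \<Rightarrow> (int \<Rightarrow> ('c, 'e) module) \<Rightarrow> int \<Rightarrow> (int \<Rightarrow> 'e) set" where
  "homogeneous I E i = {x \<in> carrier (direct_sum I E). \<forall>j\<in>I. j \<noteq> i \<longrightarrow> x j = \<zero>\<^bsub>E j\<^esub>}"

definition supercomm_rels ::
  "('c, 'd) ring_scheme \<Rightarrow> int set \<Rightarrow> (int \<Rightarrow> ('c, 'e) module) \<Rightarrow> ((int \<Rightarrow> 'e) list \<Rightarrow> 'c) set set" where
  "supercomm_rels C I E =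
    (let M = direct_sum I E; T = tensor_algebra C M; \<iota> = letter C M in
      {\<iota> v \<otimes>\<^bsub>T\<^esub> \<iota> w \<ominus>\<^bsub>T\<^esub> koszul T i j (\<iota> w \<otimes>\<^bsub>T\<^esub> \<iota> v) | v w i j.
         i \<in> I \<and> j \<in> I \<and> v \<in> homogeneous I E i \<and> w \<in> homogeneous I E j})"

definition supercomm_kernel ::
  "('c, 'd) ring_scheme \<Rightarrow> int set \<Rightarrow> (int \<Rightarrow> ('c, 'e) module) \<Rightarrow> ((int \<Rightarrow> 'e) list \<Rightarrow> 'c) set set" where
  "supercomm_kernel C I E = Idl\<^bsub>tensor_algebra C (direct_sum I E)\<^esub> (supercomm_rels C I E)"

definition super_sym ::
  "('c, 'd) ring_scheme \<Rightarrow> int set \<Rightarrow> (int \<Rightarrow> ('c, 'e) module) \<Rightarrow>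
     ('c, ((int \<Rightarrow> 'e) list \<Rightarrow> 'c) set set) module" where
  "super_sym C I E = quot (tensor_algebra C (direct_sum I E)) (supercomm_kernel C I E)"

text \<open>The component of total weight \<open>r\<close>: classes of \<open>C\<close>-combinations of words in homogeneous letters
  whose weights add up to \<open>r\<close> (elements of \<open>C\<close> correspond to the empty word, of weight \<open>0\<close>).\<close>

definition has_weight :: "int set \<Rightarrow> (int \<Rightarrow> ('c, 'e) module) \<Rightarrow> int \<Rightarrow> (int \<Rightarrow> 'e) list \<Rightarrow> bool" where
  "has_weight I E r w \<longleftrightarrow>
     (\<exists>is. list_all2 (\<lambda>v i. i \<in> I \<and> v \<in> homogeneous I E i) w is \<and> sum_list is = r)"

definition super_sym_component ::
  "('c, 'd) ring_scheme \<Rightarrow> int set \<Rightarrow> (int \<Rightarrow> ('c, 'e) module) \<Rightarrow> int \<Rightarrow>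
     ((int \<Rightarrow> 'e) list \<Rightarrow> 'c) set set set" where
  "super_sym_component C I E r =
    (let M = direct_sum I E; L = free_algebra C (carrier M); T = tensor_algebra C M in
      (\<lambda>a. supercomm_kernel C I E +>\<^bsub>T\<^esub> (tensor_kernel_alg C M +>\<^bsub>L\<^esub> a)) `
        {a \<in> carrier L. \<forall>w. a w \<noteq> \<zero>\<^bsub>C\<^esub> \<longrightarrow> has_weight I E r w})"


section \<open>Filtrations and degreewise graded completions\<close>

definition weight_filtration :: "('k, 'a) module \<Rightarrow> (int \<Rightarrow> 'a set) \<Rightarrow> nat \<Rightarrow> 'a set" where
  "weight_filtration A G p =
     (if p = 0 then carrier A else Idl\<^bsub>A\<^esub> (\<Union>i\<in>{i. i \<ge> int p}. G i))"

primrec ideal_power :: "('k, 'a) module \<Rightarrow> 'a set \<Rightarrow> nat \<Rightarrow> 'a set" where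
  "ideal_power A J 0 = carrier A"
| "ideal_power A J (Suc p) = ideal_prod A J (ideal_power A J p)"

definition polynomial_filtration :: "('k, 'a) module \<Rightarrow> (int \<Rightarrow> 'a set) \<Rightarrow> nat \<Rightarrow> 'a set" where
  "polynomial_filtration A G p = ideal_power A (Idl\<^bsub>A\<^esub> (\<Union>i\<in>{i. i \<noteq> 0}. G i)) p"

text \<open>The limit over \<open>p\<close> of the weight-\<open>r\<close> components of \<open>A / F p\<close>.  The weight-\<open>r\<close> component of \<open>A / F p\<close>
  is the image of \<open>G r\<close>, and the transition map from \<open>A / F q\<close> to \<open>A / F p\<close>, for \<open>p \<le> q\<close>, sends a
  coset \<open>X\<close> to the coset \<open>F p + X\<close>.\<close>

definition limit_component ::
  "('k, 'a) module \<Rightarrow> (int \<Rightarrow> 'a set) \<Rightarrow> (nat \<Rightarrow> 'a set) \<Rightarrow> int \<Rightarrow> (nat \<Rightarrow> 'a set) set" where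
  "limit_component A G F r =
     {x. (\<forall>p. x p \<in> (\<lambda>a. F p +>\<^bsub>A\<^esub> a) ` G r) \<and> (\<forall>p q. p \<le> q \<longrightarrow> F p <+>\<^bsub>A\<^esub> x q = x p)}"

definition limit_zero :: "('k, 'a) module \<Rightarrow> (nat \<Rightarrow> 'a set) \<Rightarrow> nat \<Rightarrow> 'a set" where
  "limit_zero A F = (\<lambda>p. \<zero>\<^bsub>quot A (F p)\<^esub>)"

definition completion ::
  "('k, 'a) module \<Rightarrow> (int \<Rightarrow> 'a set) \<Rightarrow> (nat \<Rightarrow> 'a set) \<Rightarrow> ('k, int \<Rightarrow> nat \<Rightarrow> 'a set) module" where
  "completion A G F =
     \<lparr>carrier = {x. (\<forall>r. x r \<in> limit_component A G F r) \<and> finite {r. x r \<noteq> limit_zero A F}},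
      mult = (\<lambda>x y t p. \<Oplus>\<^bsub>quot A (F p)\<^esub>r\<in>{r. x r \<noteq> limit_zero A F}.
                x r p \<otimes>\<^bsub>quot A (F p)\<^esub> y (t - r) p),
      one = (\<lambda>r. if r = 0 then (\<lambda>p. \<one>\<^bsub>quot A (F p)\<^esub>) else limit_zero A F),
      zero = (\<lambda>r. limit_zero A F),
      add = (\<lambda>x y r p. x r p \<oplus>\<^bsub>quot A (F p)\<^esub> y r p),
      smult = (\<lambda>k x r p. k \<odot>\<^bsub>quot A (F p)\<^esub> x r p)\<rparr>"

definition completion_component ::
  "('k, 'a) module \<Rightarrow> (int \<Rightarrow> 'a set) \<Rightarrow> (nat \<Rightarrow> 'a set) \<Rightarrow> int \<Rightarrow> (int \<Rightarrow> nat \<Rightarrow> 'a set) set" where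
  "completion_component A G F r =
     {x \<in> carrier (completion A G F). \<forall>s. s \<noteq> r \<longrightarrow> x s = limit_zero A F}"


section \<open>Graded supercommutative algebras\<close>

text \<open>The library locale \<open>algebra\<close> is restricted to commutative algebras.\<close>

definition graded_supercomm_algebra ::
  "('k, 'd) ring_scheme \<Rightarrow> ('k, 'a) module \<Rightarrow> (int \<Rightarrow> 'a set) \<Rightarrow> bool" where
  "graded_supercomm_algebra R A G \<longleftrightarrow>
     ring A \<and> Module.module R A \<and>
     (\<forall>k\<in>carrier R. \<forall>x\<in>carrier A. \<forall>y\<in>carrier A.
        (k \<odot>\<^bsub>A\<^esub> x) \<otimes>\<^bsub>A\<^esub> y = k \<odot>\<^bsub>A\<^esub> (x \<otimes>\<^bsub>A\<^esub> y) \<and> x \<otimes>\<^bsub>A\<^esub> (k \<odot>\<^bsub>A\<^esub> y) = k \<odot>\<^bsub>A\<^esub> (x \<otimes>\<^bsub>A\<^esub> y)) \<and>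
     (\<forall>r. submodule (G r) R A) \<and>
     (\<forall>x\<in>carrier A. \<exists>!a. (\<forall>r. a r \<in> G r) \<and> finite {r. a r \<noteq> \<zero>\<^bsub>A\<^esub>} \<and>
                          x = (\<Oplus>\<^bsub>A\<^esub>r\<in>{r. a r \<noteq> \<zero>\<^bsub>A\<^esub>}. a r)) \<and>
     \<one>\<^bsub>A\<^esub> \<in> G 0 \<and>
     (\<forall>r s. \<forall>x\<in>G r. \<forall>y\<in>G s.
        x \<otimes>\<^bsub>A\<^esub> y \<in> G (r + s) \<and> x \<otimes>\<^bsub>A\<^esub> y = koszul A r s (y \<otimes>\<^bsub>A\<^esub> x))"

definition isomorphic_graded_supercomm_algebras ::
  "('k, 'd) ring_scheme \<Rightarrow> ('k, 'a) module \<Rightarrow> (int \<Rightarrow> 'a set) \<Rightarrow>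
     ('k, 'b) module \<Rightarrow> (int \<Rightarrow> 'b set) \<Rightarrow> bool" where
  "isomorphic_graded_supercomm_algebras R A G B H \<longleftrightarrow>
     graded_supercomm_algebra R A G \<and> graded_supercomm_algebra R B H \<and>
     (\<exists>h \<in> ring_iso A B.
        (\<forall>k\<in>carrier R. \<forall>x\<in>carrier A. h (k \<odot>\<^bsub>A\<^esub> x) = k \<odot>\<^bsub>B\<^esub> h x) \<and> (\<forall>r. h ` G r = H r))"


section \<open>The algebra attached to a graded vector space\<close>

definition coefficient_module ::
  "(int \<Rightarrow> 'v::real_normed_vector set) \<Rightarrow> int \<Rightarrow>
     ('v \<Rightarrow> real, (('v \<Rightarrow> real) \<times> 'v \<Rightarrow> real) set) module" where
  "coefficient_module V i =
     extend_scalars real_ring (smooth_algebra (V 0)) (subspace_module (V i))"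

type_synonym 'v graded_alg =
  "((int \<Rightarrow> (('v \<Rightarrow> real) \<times> 'v \<Rightarrow> real) set) list \<Rightarrow> 'v \<Rightarrow> real) set set"

definition alg :: "(int \<Rightarrow> 'v::real_normed_vector set) \<Rightarrow> (real, 'v graded_alg) module" where
  "alg V = restrict_scalars (\<lambda>r. \<lambda>x\<in>V 0. r)
     (super_sym (smooth_algebra (V 0)) (- {0}) (coefficient_module V))"

definition alg_component :: "(int \<Rightarrow> 'v::real_normed_vector set) \<Rightarrow> int \<Rightarrow> 'v graded_alg set" where
  "alg_component V = super_sym_component (smooth_algebra (V 0)) (- {0}) (coefficient_module V)"

abbreviation F_weight :: "(int \<Rightarrow> 'v::real_normed_vector set) \<Rightarrow> nat \<Rightarrow> 'v graded_alg set" where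
  "F_weight V \<equiv> weight_filtration (alg V) (alg_component V)"

abbreviation F_pol :: "(int \<Rightarrow> 'v::real_normed_vector set) \<Rightarrow> nat \<Rightarrow> 'v graded_alg set" where
  "F_pol V \<equiv> polynomial_filtration (alg V) (alg_component V)"

end

theory Submission
  imports Defs
begin

text \<open>Both filtrations are cofinal in every weight \<open>r\<close>.  Only finitely many \<open>V i\<close> are nonzero, so the
  weights of the letters are bounded by some \<open>N\<close>.  A word of weight at least \<open>N p\<close> then has at least
  \<open>p\<close> letters, hence \<open>F (N p)\<close> lies in the \<open>p\<close>-th power of the polynomial ideal.  Conversely, in a word
  of weight \<open>r\<close> with \<open>k\<close> letters the letters of positive weight have total weight at least
  \<open>(k + r) / 2\<close>, and supercommutativity moves them to the front; so an element of weight \<open>r\<close> in the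
  \<open>p\<close>-th power lies in \<open>F q\<close> as soon as \<open>2 q \<le> p + r\<close>.  The last step needs that the weight components
  of the algebra are independent: scaling every letter of weight \<open>i\<close> by \<open>2^i\<close> induces an endomorphism
  of the algebra of which they are eigenspaces for different eigenvalues.\<close>

section \<open>Algebras and their quotients\<close>

text \<open>The two inclusions differ in strength. The first is uniform in the weight, so cosets can
  be projected and a map of completions is defined at once. The converse holds only inside a fixed
  weight: if all letters have negative weight, then \<open>F 1\<close> is zero, while the powers of
  a nonzero letter of even weight lie in ever higher powers of the ideal. Hence the completions are
  degreewise, and bijectivity is checked on each limit separately.

  The constant in \<open>2 q \<le> p + r\<close> comes from counting: weights of letters are nonzero
  integers, so if the positive ones in a word of \<open>k\<close> letters add up to \<open>P\<close>
  and the negative ones to \<open>- M\<close>, then \<open>P + M \<ge> k\<close> and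
  \<open>P - M = r\<close>, whence \<open>2 P \<ge> k + r\<close>.

  Independence of the weights is not visible in a quotient by relations. A power of the ideal
  consists of sums of long words of mixed weights; to see that an element of weight \<open>r\<close>
  in it is a sum of long words of weight \<open>r\<close>, the other weights must be separated. The
  eigenvalues \<open>2^r\<close> do this without a normal form for the supersymmetric
  algebra.\<close>

locale assoc_algebra = module + A?: ring M +
  assumes smult_mult_l:
      "\<lbrakk>k \<in> carrier R; x \<in> carrier M; y \<in> carrier M\<rbrakk> \<Longrightarrow>
        (k \<odot>\<^bsub>M\<^esub> x) \<otimes>\<^bsub>M\<^esub> y = k \<odot>\<^bsub>M\<^esub> (x \<otimes>\<^bsub>M\<^esub> y)"
    and smult_mult_r:
      "\<lbrakk>k \<in> carrier R; x \<in> carrier M; y \<in> carrier M\<rbrakk> \<Longrightarrow>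
        x \<otimes>\<^bsub>M\<^esub> (k \<odot>\<^bsub>M\<^esub> y) = k \<odot>\<^bsub>M\<^esub> (x \<otimes>\<^bsub>M\<^esub> y)"
begin

lemma module: "module R M" ..

lemma ring_M: "ring M" ..

end

text \<open>The operations of \<open>B\<close> are prescribed on the image of \<open>\<pi>\<close>
  only. With \<open>\<pi>\<close> a coset map this yields the laws of quotients; with
  \<open>\<pi>\<close> the identity it carries laws between records that differ in other
  fields.\<close>

lemma abelian_group_image:
  fixes M (structure) and B (structure)
  assumes "abelian_group M"
    and car: "carrier B = \<pi> ` carrier M"
    and zero: "\<zero>\<^bsub>B\<^esub> = \<pi> \<zero>\<^bsub>M\<^esub>"
    and add: "\<And>x y. \<lbrakk>x \<in> carrier M; y \<in> carrier M\<rbrakk> \<Longrightarrow> \<pi> x \<oplus>\<^bsub>B\<^esub> \<pi> y = \<pi> (x \<oplus>\<^bsub>M\<^esub> y)"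
  shows "abelian_group B"
proof -
  interpret abelian_group M by fact
  show ?thesis
  proof (rule abelian_groupI)
    fix x assume "x \<in> carrier B"
    then obtain a where "a \<in> carrier M" "x = \<pi> a" using car by auto
    then show "\<exists>y\<in>carrier B. y \<oplus>\<^bsub>B\<^esub> x = \<zero>\<^bsub>B\<^esub>"
      by (intro bexI[of _ "\<pi> (\<ominus>\<^bsub>M\<^esub> a)"]) (auto simp: car zero add l_neg)
  qed (auto simp: car zero add a_ac)
qed

lemma module_image:
  fixes R (structure) and M (structure) and B (structure)
  assumes "module R M"
    and car: "carrier B = \<pi> ` carrier M"
    and zero: "\<zero>\<^bsub>B\<^esub> = \<pi> \<zero>\<^bsub>M\<^esub>"
    and add: "\<And>x y. \<lbrakk>x \<in> carrier M; y \<in> carrier M\<rbrakk> \<Longrightarrow> \<pi> x \<oplus>\<^bsub>B\<^esub> \<pi> y = \<pi> (x \<oplus>\<^bsub>M\<^esub> y)"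
    and smult: "\<And>k x. \<lbrakk>k \<in> carrier R; x \<in> carrier M\<rbrakk> \<Longrightarrow> k \<odot>\<^bsub>B\<^esub> \<pi> x = \<pi> (k \<odot>\<^bsub>M\<^esub> x)"
  shows "module R B"
proof -
  interpret module R M by fact
  show ?thesis
  proof (rule moduleI)
    show "cring R" ..
    show "abelian_group B"
      by (rule abelian_group_image[OF _ car zero add]) unfold_locales
  qed (auto simp: car add smult smult_l_distr smult_r_distr smult_assoc1)
qed

lemma assoc_algebra_image:
  fixes R (structure) and M (structure) and B (structure)
  assumes "assoc_algebra R M"
    and car: "carrier B = \<pi> ` carrier M"
    and zero: "\<zero>\<^bsub>B\<^esub> = \<pi> \<zero>\<^bsub>M\<^esub>"
    and one: "\<one>\<^bsub>B\<^esub> = \<pi> \<one>\<^bsub>M\<^esub>"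
    and add: "\<And>x y. \<lbrakk>x \<in> carrier M; y \<in> carrier M\<rbrakk> \<Longrightarrow> \<pi> x \<oplus>\<^bsub>B\<^esub> \<pi> y = \<pi> (x \<oplus>\<^bsub>M\<^esub> y)"
    and mult: "\<And>x y. \<lbrakk>x \<in> carrier M; y \<in> carrier M\<rbrakk> \<Longrightarrow> \<pi> x \<otimes>\<^bsub>B\<^esub> \<pi> y = \<pi> (x \<otimes>\<^bsub>M\<^esub> y)"
    and smult: "\<And>k x. \<lbrakk>k \<in> carrier R; x \<in> carrier M\<rbrakk> \<Longrightarrow> k \<odot>\<^bsub>B\<^esub> \<pi> x = \<pi> (k \<odot>\<^bsub>M\<^esub> x)"
  shows "assoc_algebra R B"
proof -
  interpret assoc_algebra R M by fact
  have B: "module R B"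
    by (rule module_image[OF module car zero add smult])
  show ?thesis
  proof (intro assoc_algebra.intro assoc_algebra_axioms.intro B)
    show "ring B"
    proof (rule ringI)
      show "abelian_group B" using B by (simp add: module_def)
      show "Group.monoid B"
        by (rule monoidI) (auto simp: car one mult A.m_assoc)
    qed (auto simp: car mult add A.l_distr A.r_distr)
  qed (auto simp: car mult smult smult_mult_l smult_mult_r)
qed


section \<open>Quotients by submodules and two-sided ideals\<close>

lemma set_add_rcos:
  "X <+>\<^bsub>M\<^esub> Y = (\<Union>y\<in>Y. X +>\<^bsub>M\<^esub> y)"
  unfolding set_add_def' a_r_coset_def' by auto

lemma quot_simps [simp]:
  "carrier (quot M N) = (\<lambda>x. N +>\<^bsub>M\<^esub> x) ` carrier M"
  "one (quot M N) = N +>\<^bsub>M\<^esub> \<one>\<^bsub>M\<^esub>"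
  "zero (quot M N) = N"
  "add (quot M N) = set_add M"
  by (auto simp: quot_def FactRing_def A_RCOSETS_def')


lemma (in abelian_subgroup) rcos_eq_iff:
  assumes "x \<in> carrier G" "y \<in> carrier G"
  shows "H +> x = H +> y \<longleftrightarrow> x \<ominus> y \<in> H"
proof -
  have "H +> x = H +> y \<longleftrightarrow> x \<in> H +> y"
    using assms a_rcos_self a_repr_independence'[of x y] by auto
  then show ?thesis
    using assms by (simp add: a_rcos_module a_minus_def)
qed

text \<open>The scalar actions on \<open>quot\<close> and \<open>extend_scalars\<close> are unions
  over all representatives. When the operation respects congruence modulo \<open>H\<close>, all
  members of the union coincide and it collapses to one coset.\<close>

lemma (in abelian_subgroup) UN_rcos:
  assumes a: "a \<in> carrier G" and f: "\<And>x. x \<in> carrier G \<Longrightarrow> f x \<in> carrier G"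
    and cong: "\<And>x y. \<lbrakk>x \<in> carrier G; y \<in> carrier G; x \<ominus> y \<in> H\<rbrakk> \<Longrightarrow> f x \<ominus> f y \<in> H"
  shows "(\<Union>x\<in>H +> a. H +> f x) = H +> f a"
proof -
  have "H +> f x = H +> f a" if "x \<in> H +> a" for x
  proof -
    have x: "x \<in> carrier G"
      using that a by (rule a_elemrcos_carrier[rotated])
    moreover have "x \<ominus> a \<in> H"
      using that a x by (simp add: a_rcos_module a_minus_def)
    ultimately show ?thesis
      using a f cong rcos_eq_iff by simp
  qed
  then show ?thesis
    by (intro UN_constant_eq[OF a_rcos_self[OF a]]) simp
qed

lemma (in module) submodule_abelian_subgroup:
  assumes "submodule N R M"
  shows "abelian_subgroup N M"
proof -
  interpret submodule N R M by fact
  show ?thesis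
    by (intro abelian_subgroupI3 additive_subgroup.intro subgroup_axioms M.abelian_group_axioms)
qed

lemma quot_smult:
  fixes M :: "('k, 'a) module"
  assumes "module R M"
    and N: "submodule N R M" and k: "k \<in> carrier R" and x: "x \<in> carrier M"
  shows "k \<odot>\<^bsub>quot M N\<^esub> (N +>\<^bsub>M\<^esub> x) = N +>\<^bsub>M\<^esub> (k \<odot>\<^bsub>M\<^esub> x)"
proof -
  interpret module R M by fact
  interpret N: submodule N R M by fact
  interpret abelian_subgroup N M by (rule submodule_abelian_subgroup) fact
  have "k \<odot>\<^bsub>M\<^esub> u \<ominus>\<^bsub>M\<^esub> k \<odot>\<^bsub>M\<^esub> v \<in> N"
    if "u \<in> carrier M" "v \<in> carrier M" "u \<ominus>\<^bsub>M\<^esub> v \<in> N" for u v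
  proof -
    have "k \<odot>\<^bsub>M\<^esub> (u \<ominus>\<^bsub>M\<^esub> v) \<in> N" using k that by auto
    then show ?thesis using that k by (simp add: a_minus_def smult_r_distr smult_r_minus)
  qed
  then show ?thesis
    using k x by (simp add: quot_def UN_rcos)
qed

lemma quot_module:
  fixes M :: "('k, 'a) module"
  assumes M: "module R M" and N: "submodule N R M"
  shows "module R (quot M N)"
proof -
  interpret module R M by fact
  interpret abelian_subgroup N M by (rule submodule_abelian_subgroup) fact
  show ?thesis
    by (rule module_image[OF M, where \<pi> = "\<lambda>x. N +>\<^bsub>M\<^esub> x"])
      (simp_all add: a_rcos_sum quot_smult[OF M N] a_subset)
qed

text \<open>Since \<open>k x = (k 1) x\<close>, absorption of products already gives stability under
  scalars.\<close>

lemma (in assoc_algebra) ideal_submodule: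
  assumes "ideal N M"
  shows "submodule N R M"
proof -
  interpret ideal N M by fact
  show ?thesis
  proof (rule submoduleI)
    fix k x assume k: "k \<in> carrier R" and x: "x \<in> N"
    have "(k \<odot>\<^bsub>M\<^esub> \<one>\<^bsub>M\<^esub>) \<otimes>\<^bsub>M\<^esub> x \<in> N"
      using k x by (simp add: I_l_closed)
    then show "k \<odot>\<^bsub>M\<^esub> x \<in> N"
      using k x by (simp add: smult_mult_l Icarr)
  qed (use a_subset in auto)
qed

lemma quot_mult:
  fixes M :: "('k, 'a) module"
  assumes "ideal N M" "x \<in> carrier M" "y \<in> carrier M"
  shows "(N +>\<^bsub>M\<^esub> x) \<otimes>\<^bsub>quot M N\<^esub> (N +>\<^bsub>M\<^esub> y) = N +>\<^bsub>M\<^esub> (x \<otimes>\<^bsub>M\<^esub> y)"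
  using ideal.rcoset_mult_add[OF assms] by (simp add: quot_def FactRing_def)

lemma quot_algebra:
  fixes M :: "('k, 'a) module"
  assumes M: "assoc_algebra R M" and N: "ideal N M"
  shows "assoc_algebra R (quot M N)"
proof -
  interpret assoc_algebra R M by fact
  interpret ideal N M by fact
  show ?thesis
    by (rule assoc_algebra_image[OF M, where \<pi> = "\<lambda>x. N +>\<^bsub>M\<^esub> x"])
      (simp_all add: a_rcos_sum quot_mult N quot_smult[OF module] ideal_submodule a_subset)
qed

lemma quot_ring_hom:
  assumes "ideal N M"
  shows "(\<lambda>x. N +>\<^bsub>M\<^esub> x) \<in> ring_hom M (quot M N)"
proof -
  interpret ideal N M by fact
  show ?thesis
    by (rule ring_hom_memI) (auto simp: a_rcos_sum quot_mult assms)
qed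

text \<open>The universal property of a quotient given by generators: the kernel of \<open>g\<close>
  is an ideal containing \<open>S\<close>, hence contains the ideal generated by
  \<open>S\<close>.\<close>

lemma quot_lift:
  fixes M :: "('k, 'a) module" and B :: "('b, 'c) ring_scheme"
  assumes M: "ring M" and B: "ring B" and g: "g \<in> ring_hom M B" and S: "S \<subseteq> carrier M"
    and zero: "\<And>s. s \<in> S \<Longrightarrow> g s = \<zero>\<^bsub>B\<^esub>"
  obtains h where "h \<in> ring_hom (quot M (Idl\<^bsub>M\<^esub> S)) B"
    and "\<And>x. x \<in> carrier M \<Longrightarrow> h (Idl\<^bsub>M\<^esub> S +>\<^bsub>M\<^esub> x) = g x"
proof -
  let ?N = "Idl\<^bsub>M\<^esub> S"
  have N: "ideal ?N M" using S by (rule ring.genideal_ideal[OF M])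
  interpret N: ideal ?N M by (rule N)
  interpret B: ring B by (rule B)
  have "a_kernel M B g = {x \<in> carrier M. g x = \<zero>\<^bsub>B\<^esub>}"
    by (rule a_kernel_def')
  then have "?N \<subseteq> {x \<in> carrier M. g x = \<zero>\<^bsub>B\<^esub>}"
    using S zero ring_hom_ring.kernel_is_ideal[OF ring_hom_ringI2[OF M B g]]
    by (intro ring.genideal_minimal[OF M]) auto
  then have sub: "n \<in> carrier M" "g n = \<zero>\<^bsub>B\<^esub>" if "n \<in> ?N" for n
    using that by auto
  \<comment> \<open>A representative is chosen arbitrarily; all of them have the same value under
    \<open>g\<close>, because they differ by elements of the kernel.\<close>
  define h where "h X = g (SOME x. x \<in> X)" for X
  have h: "h (?N +>\<^bsub>M\<^esub> x) = g x" if x: "x \<in> carrier M" for x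
  proof -
    have "(SOME y. y \<in> ?N +>\<^bsub>M\<^esub> x) \<in> ?N +>\<^bsub>M\<^esub> x"
      using N.a_rcos_self[OF x] by (rule someI)
    then obtain n where n: "n \<in> ?N" and eq: "(SOME y. y \<in> ?N +>\<^bsub>M\<^esub> x) = n \<oplus>\<^bsub>M\<^esub> x"
      unfolding a_r_coset_def' by blast
    have "g (n \<oplus>\<^bsub>M\<^esub> x) = g x"
      using ring_hom_add[OF g sub(1)[OF n] x] sub(2)[OF n] ring_hom_closed[OF g x] by simp
    then show ?thesis
      unfolding h_def eq .
  qed
  show thesis
  proof (rule that)
    show "h \<in> ring_hom (quot M ?N) B"
      by (rule ring_hom_memI) (auto simp: h quot_mult N N.a_rcos_sum ring_hom_closed[OF g]
          ring_hom_add[OF g] ring_hom_mult[OF g] ring_hom_one[OF g])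
  qed (rule h)
qed


section \<open>Free modules and free algebras\<close>

text \<open>Both sides sum over the pairs \<open>j \<le> k \<le> n\<close>, on the right with
  \<open>k = j + i\<close>. This is the regrouping behind associativity of a product that sums over
  all cuts of a word.\<close>

lemma (in abelian_monoid) finsum_triangle:
  fixes n :: nat
  assumes "\<And>j k. f j k \<in> carrier G"
  shows "(\<Oplus>k\<in>{..n}. \<Oplus>j\<in>{..k}. f j k) = (\<Oplus>j\<in>{..n}. \<Oplus>i\<in>{..n - j}. f j (j + i))"
proof (induction n)
  case 0
  then show ?case using assms by simp
next
  case (Suc n)
  have "(\<Oplus>j\<in>{..n}. \<Oplus>i\<in>{..Suc n - j}. f j (j + i)) =
        (\<Oplus>j\<in>{..n}. f j (Suc n) \<oplus> (\<Oplus>i\<in>{..n - j}. f j (j + i)))"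
    using assms by (intro finsum_cong') (auto simp: Suc_diff_le)
  also have "\<dots> = (\<Oplus>j\<in>{..n}. f j (Suc n)) \<oplus> (\<Oplus>j\<in>{..n}. \<Oplus>i\<in>{..n - j}. f j (j + i))"
    using assms by (intro finsum_addf) auto
  finally show ?case
    using assms Suc by (simp add: a_ac)
qed

lemma (in cring) single_closed: "single R x y \<in> carrier R"
  by (simp add: single_def)

lemma free_module_simps [simp]:
  "zero (free_module R X) = (\<lambda>x. \<zero>\<^bsub>R\<^esub>)"
  "add (free_module R X) = (\<lambda>a b x. a x \<oplus>\<^bsub>R\<^esub> b x)"
  "smult (free_module R X) = (\<lambda>r a x. r \<otimes>\<^bsub>R\<^esub> a x)"
  by (simp_all add: free_module_def)

lemma free_module_carrier:
  "a \<in> carrier (free_module R X) \<longleftrightarrow>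
    (\<forall>x. a x \<in> carrier R) \<and> (\<forall>x. x \<notin> X \<longrightarrow> a x = \<zero>\<^bsub>R\<^esub>) \<and> finite {x. a x \<noteq> \<zero>\<^bsub>R\<^esub>}"
  by (simp add: free_module_def)

context cring
begin

lemma free_module_add_closed:
  assumes "a \<in> carrier (free_module R X)" "b \<in> carrier (free_module R X)"
  shows "(\<lambda>x. a x \<oplus> b x) \<in> carrier (free_module R X)"
proof -
  have "{x. a x \<oplus> b x \<noteq> \<zero>} \<subseteq> {x. a x \<noteq> \<zero>} \<union> {x. b x \<noteq> \<zero>}" by auto
  then show ?thesis
    using assms by (auto simp: free_module_carrier intro: finite_subset)
qed

lemma free_module_smult_closed:
  assumes "r \<in> carrier R" "a \<in> carrier (free_module R X)"
  shows "(\<lambda>x. r \<otimes> a x) \<in> carrier (free_module R X)"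
proof -
  have "{x. r \<otimes> a x \<noteq> \<zero>} \<subseteq> {x. a x \<noteq> \<zero>}" using assms by auto
  then show ?thesis
    using assms by (auto simp: free_module_carrier intro: finite_subset)
qed

lemma free_module_uminus_closed:
  assumes "a \<in> carrier (free_module R X)"
  shows "(\<lambda>x. \<ominus> a x) \<in> carrier (free_module R X)"
proof -
  have "{x. \<ominus> a x \<noteq> \<zero>} \<subseteq> {x. a x \<noteq> \<zero>}" by auto
  then show ?thesis
    using assms by (auto simp: free_module_carrier intro: finite_subset)
qed

lemma free_module: "module R (free_module R X)"
proof (rule moduleI)
  show "abelian_group (free_module R X)"
  proof (rule abelian_groupI)
    fix x assume "x \<in> carrier (free_module R X)"
    then show "\<exists>y\<in>carrier (free_module R X). y \<oplus>\<^bsub>free_module R X\<^esub> x = \<zero>\<^bsub>free_module R X\<^esub>"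
      by (intro bexI[of _ "\<lambda>y. \<ominus> x y"]) (auto simp: free_module_uminus_closed free_module_carrier l_neg)
  qed (auto simp: free_module_add_closed, auto simp: free_module_carrier a_ac)
qed (auto simp: free_module_smult_closed is_cring, auto simp: free_module_carrier l_distr r_distr m_assoc)

lemma single_in_free_module: "x \<in> X \<Longrightarrow> single R x \<in> carrier (free_module R X)"
  by (auto simp: free_module_carrier single_def)

text \<open>Besides \<open>b x = 0\<close>, the step guarantees that no coordinate outside the
  support of \<open>a\<close> becomes nonzero. This is what keeps a combination of words of one
  weight inside that weight in \<open>component_eq\<close>.\<close>

lemma free_module_induct [consumes 1, case_names zero add]:
  assumes a: "a \<in> carrier (free_module R X)"
    and zero: "P (\<lambda>x. \<zero>)"
    and add: "\<And>r x b. \<lbrakk>r \<in> carrier R; x \<in> X; b \<in> carrier (free_module R X); P b; b x = \<zero>;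
        \<And>y. r \<otimes> single R x y \<oplus> b y \<noteq> \<zero> \<Longrightarrow> a y \<noteq> \<zero>\<rbrakk>
      \<Longrightarrow> P (\<lambda>y. r \<otimes> single R x y \<oplus> b y)"
  shows "P a"
proof -
  \<comment> \<open>The claim is generalised to all restrictions \<open>b\<close> of
    \<open>a\<close>, with induction on the support \<open>S\<close> of \<open>b\<close>.\<close>
  have "P b" if "finite S" "b \<in> carrier (free_module R X)" "{x. b x \<noteq> \<zero>} = S"
    "\<And>y. b y \<noteq> \<zero> \<Longrightarrow> b y = a y" for S b
    using that
  proof (induction S arbitrary: b)
    case empty
    then have "b = (\<lambda>x. \<zero>)" by auto
    then show ?case using zero by simp
  next
    case (insert x S)
    define c where "c = b(x := \<zero>)"
    have supp: "{y. c y \<noteq> \<zero>} = S" using insert by (auto simp: c_def)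
    have c: "c \<in> carrier (free_module R X)"
      using insert supp by (auto simp: free_module_carrier c_def)
    have "c y = a y" if "c y \<noteq> \<zero>" for y
      using that insert.prems(3)[of y] by (auto simp: c_def split: if_splits)
    then have "P c" by (rule insert.IH[OF c supp])
    moreover have b_eq: "b = (\<lambda>y. b x \<otimes> single R x y \<oplus> c y)"
      using insert.prems by (auto simp: single_def c_def free_module_carrier)
    moreover have "x \<in> X" using insert.prems by (auto simp: free_module_carrier)
    moreover have "a y \<noteq> \<zero>" if "b x \<otimes> single R x y \<oplus> c y \<noteq> \<zero>" for y
      using that insert.prems(3)[of y] fun_cong[OF b_eq, of y] by auto
    ultimately show ?case
      using add[of "b x" x c] insert.prems(1) c by (auto simp: free_module_carrier c_def)
  qed
  then show ?thesis using a by (auto simp: free_module_carrier)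
qed

end

section \<open>The free associative algebra and its product by cutting words\<close>

lemma free_algebra_simps [simp]:
  "carrier (free_algebra R X) = carrier (free_module R (lists X))"
  "zero (free_algebra R X) = (\<lambda>x. \<zero>\<^bsub>R\<^esub>)"
  "add (free_algebra R X) = (\<lambda>a b x. a x \<oplus>\<^bsub>R\<^esub> b x)"
  "smult (free_algebra R X) = (\<lambda>r a x. r \<otimes>\<^bsub>R\<^esub> a x)"
  "one (free_algebra R X) = single R []"
  "mult (free_algebra R X) = (\<lambda>a b w. \<Oplus>\<^bsub>R\<^esub>k\<in>{..length w}. a (take k w) \<otimes>\<^bsub>R\<^esub> b (drop k w))"
  by (simp_all add: free_algebra_def free_module_def)

context cring
begin

lemma free_algebra_mult_closed:
  assumes "a \<in> carrier (free_algebra R X)" "b \<in> carrier (free_algebra R X)"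
  shows "a \<otimes>\<^bsub>free_algebra R X\<^esub> b \<in> carrier (free_algebra R X)"
proof -
  have car: "\<And>w. a w \<in> carrier R" "\<And>w. b w \<in> carrier R"
    using assms by (auto simp: free_module_carrier)
  \<comment> \<open>A nonzero coefficient at \<open>w\<close> forces a cut of \<open>w\<close> into
    a word from the support of \<open>a\<close> and one from that of \<open>b\<close>. This bounds
    the support of the product and puts its words into \<open>lists X\<close>.\<close>
  have *: "w \<in> (\<lambda>(u, v). u @ v) ` ({u. a u \<noteq> \<zero>} \<times> {v. b v \<noteq> \<zero>})"
    if w: "(a \<otimes>\<^bsub>free_algebra R X\<^esub> b) w \<noteq> \<zero>" for w
  proof -
    obtain k where "a (take k w) \<otimes> b (drop k w) \<noteq> \<zero>"
      using w add.finprod_one_eqI[of "{..length w}" "\<lambda>k. a (take k w) \<otimes> b (drop k w)"]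
      unfolding free_algebra_simps by blast
    then have "a (take k w) \<noteq> \<zero>" "b (drop k w) \<noteq> \<zero>" using car by auto
    then show ?thesis by (intro image_eqI[of _ _ "(take k w, drop k w)"]) auto
  qed
  have "{w. (a \<otimes>\<^bsub>free_algebra R X\<^esub> b) w \<noteq> \<zero>} \<subseteq> (\<lambda>(u, v). u @ v) ` ({u. a u \<noteq> \<zero>} \<times> {v. b v \<noteq> \<zero>})"
    using * by blast
  moreover have "finite ((\<lambda>(u, v). u @ v) ` ({u. a u \<noteq> \<zero>} \<times> {v. b v \<noteq> \<zero>}))"
    using assms by (intro finite_imageI finite_cartesian_product) (auto simp: free_module_carrier)
  ultimately have "finite {w. (a \<otimes>\<^bsub>free_algebra R X\<^esub> b) w \<noteq> \<zero>}"
    by (rule finite_subset)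
  moreover have "w \<in> lists X" if w: "(a \<otimes>\<^bsub>free_algebra R X\<^esub> b) w \<noteq> \<zero>" for w
  proof -
    obtain u v where "a u \<noteq> \<zero>" "b v \<noteq> \<zero>" "w = u @ v" using *[OF w] by auto
    moreover from this have "u \<in> lists X" "v \<in> lists X"
      using assms by (auto simp: free_module_carrier)
    ultimately show ?thesis by simp
  qed
  ultimately show ?thesis
    using car by (auto simp: free_module_carrier)
qed

lemma free_algebra_mult_assoc:
  assumes a: "\<And>w. a w \<in> carrier R" and b: "\<And>w. b w \<in> carrier R" and c: "\<And>w. c w \<in> carrier R"
  shows "(a \<otimes>\<^bsub>free_algebra R X\<^esub> b) \<otimes>\<^bsub>free_algebra R X\<^esub> c =
    a \<otimes>\<^bsub>free_algebra R X\<^esub> (b \<otimes>\<^bsub>free_algebra R X\<^esub> c)"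
proof
  fix w
  \<comment> \<open>The term belonging to the cut of \<open>w\<close> into three pieces at the
    positions \<open>j\<close> and \<open>k\<close>; the two bracketings sum these terms in the two
    orders of \<open>finsum_triangle\<close>.\<close>
  define f where "f j k = a (take j w) \<otimes> (b (take (k - j) (drop j w)) \<otimes> c (drop k w))" for j k
  have f: "f j k \<in> carrier R" for j k using assms by (simp add: f_def)
  have "((a \<otimes>\<^bsub>free_algebra R X\<^esub> b) \<otimes>\<^bsub>free_algebra R X\<^esub> c) w =
        (\<Oplus>k\<in>{..length w}. \<Oplus>j\<in>{..k}. f j k)"
    unfolding free_algebra_simps
  proof (intro finsum_cong' refl)
    fix k assume k: "k \<in> {..length w}"
    have "(\<Oplus>j\<in>{..length (take k w)}. a (take j (take k w)) \<otimes> b (drop j (take k w))) \<otimes> c (drop k w)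
        = (\<Oplus>j\<in>{..k}. a (take j (take k w)) \<otimes> b (drop j (take k w)) \<otimes> c (drop k w))"
      using k a b c by (subst finsum_ldistr) (auto simp: min_absorb2)
    also have "\<dots> = (\<Oplus>j\<in>{..k}. f j k)"
      using a b c by (intro finsum_cong' refl)
        (auto simp: f_def m_assoc min_absorb1 drop_take)
    finally show "(\<Oplus>j\<in>{..length (take k w)}. a (take j (take k w)) \<otimes> b (drop j (take k w))) \<otimes> c (drop k w)
        = (\<Oplus>j\<in>{..k}. f j k)" .
  qed (use f in auto)
  also have "\<dots> = (\<Oplus>j\<in>{..length w}. \<Oplus>i\<in>{..length w - j}. f j (j + i))"
    using f by (rule finsum_triangle)
  also have "\<dots> = (a \<otimes>\<^bsub>free_algebra R X\<^esub> (b \<otimes>\<^bsub>free_algebra R X\<^esub> c)) w"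
    unfolding free_algebra_simps
  proof (intro finsum_cong' refl)
    fix j assume "j \<in> {..length w}"
    have "a (take j w) \<otimes> (\<Oplus>i\<in>{..length (drop j w)}. b (take i (drop j w)) \<otimes> c (drop i (drop j w)))
        = (\<Oplus>i\<in>{..length w - j}. a (take j w) \<otimes> (b (take i (drop j w)) \<otimes> c (drop i (drop j w))))"
      using a b c by (subst finsum_rdistr) auto
    also have "\<dots> = (\<Oplus>i\<in>{..length w - j}. f j (j + i))"
      using a b c by (intro finsum_cong' refl) (auto simp: f_def add.commute)
    finally show "(\<Oplus>i\<in>{..length w - j}. f j (j + i)) =
        a (take j w) \<otimes> (\<Oplus>i\<in>{..length (drop j w)}. b (take i (drop j w)) \<otimes> c (drop i (drop j w)))" ..
  qed (use a b c in auto)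
  finally show "((a \<otimes>\<^bsub>free_algebra R X\<^esub> b) \<otimes>\<^bsub>free_algebra R X\<^esub> c) w =
    (a \<otimes>\<^bsub>free_algebra R X\<^esub> (b \<otimes>\<^bsub>free_algebra R X\<^esub> c)) w" .
qed

text \<open>Among all cuts of a word \<open>w\<close> only the one after \<open>length u\<close>
  letters can contribute, and only if \<open>w = u @ v\<close>; a word shorter than \<open>u\<close>
  has no such cut.\<close>

lemma single_append:
  "single R u \<otimes>\<^bsub>free_algebra R X\<^esub> single R v = single R (u @ v)"
proof
  fix w
  have "(single R u \<otimes>\<^bsub>free_algebra R X\<^esub> single R v) w =
      (\<Oplus>k\<in>{..length w}. if length u = k then single R (u @ v) w else \<zero>)"
    unfolding free_algebra_simps
  proof (intro finsum_cong' refl)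
    fix k assume "k \<in> {..length w}"
    then have "take k w = u \<and> drop k w = v \<longleftrightarrow> length u = k \<and> w = u @ v"
      by (auto simp: append_eq_conv_conj)
    then show "single R u (take k w) \<otimes> single R v (drop k w) =
        (if length u = k then single R (u @ v) w else \<zero>)"
      by (auto simp: single_def)
  qed (auto simp: single_closed)
  also have "\<dots> = single R (u @ v) w"
  proof (cases "length u \<le> length w")
    case True
    then show ?thesis by (subst add.finprod_singleton) (auto simp: single_closed)
  next
    case False
    then have "single R (u @ v) w = \<zero>" by (auto simp: single_def)
    then show ?thesis by (simp cong: if_cong)
  qed
  finally show "(single R u \<otimes>\<^bsub>free_algebra R X\<^esub> single R v) w = single R (u @ v) w" .
qed

lemma free_algebra_one_mult:
  assumes "\<And>w. a w \<in> carrier R"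
  shows "single R [] \<otimes>\<^bsub>free_algebra R X\<^esub> a = a" "a \<otimes>\<^bsub>free_algebra R X\<^esub> single R [] = a"
proof -
  have "(single R [] \<otimes>\<^bsub>free_algebra R X\<^esub> a) w = a w" for w
  proof -
    have "(single R [] \<otimes>\<^bsub>free_algebra R X\<^esub> a) w = (\<Oplus>k\<in>{..length w}. if 0 = k then a w else \<zero>)"
      unfolding free_algebra_simps using assms by (intro finsum_cong') (auto simp: single_def)
    then show ?thesis using assms by (subst (asm) add.finprod_singleton) auto
  qed
  moreover have "(a \<otimes>\<^bsub>free_algebra R X\<^esub> single R []) w = a w" for w
  proof -
    have "(a \<otimes>\<^bsub>free_algebra R X\<^esub> single R []) w = (\<Oplus>k\<in>{..length w}. if length w = k then a w else \<zero>)"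
      unfolding free_algebra_simps using assms by (intro finsum_cong') (auto simp: single_def)
    then show ?thesis using assms by (subst (asm) add.finprod_singleton) auto
  qed
  ultimately show "single R [] \<otimes>\<^bsub>free_algebra R X\<^esub> a = a" "a \<otimes>\<^bsub>free_algebra R X\<^esub> single R [] = a"
    by auto
qed

lemma free_algebra: "assoc_algebra R (free_algebra R X)"
proof (intro assoc_algebra.intro assoc_algebra_axioms.intro)
  show "module R (free_algebra R X)"
    by (rule module_image[OF free_module, where \<pi> = "\<lambda>x. x"]) auto
  then have "abelian_group (free_algebra R X)" by (simp add: module_def)
  moreover have "Group.monoid (free_algebra R X)"
  proof (rule monoidI)
    show "\<one>\<^bsub>free_algebra R X\<^esub> \<in> carrier (free_algebra R X)"
      by (simp add: single_in_free_module)
    fix x y z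
    assume x: "x \<in> carrier (free_algebra R X)"
    then show "\<one>\<^bsub>free_algebra R X\<^esub> \<otimes>\<^bsub>free_algebra R X\<^esub> x = x"
      "x \<otimes>\<^bsub>free_algebra R X\<^esub> \<one>\<^bsub>free_algebra R X\<^esub> = x"
      unfolding free_algebra_simps(5)
      by (intro free_algebra_one_mult; simp add: free_module_carrier)+
    assume y: "y \<in> carrier (free_algebra R X)"
    show "x \<otimes>\<^bsub>free_algebra R X\<^esub> y \<in> carrier (free_algebra R X)"
      using x y by (rule free_algebra_mult_closed)
    assume z: "z \<in> carrier (free_algebra R X)"
    show "x \<otimes>\<^bsub>free_algebra R X\<^esub> y \<otimes>\<^bsub>free_algebra R X\<^esub> z =
        x \<otimes>\<^bsub>free_algebra R X\<^esub> (y \<otimes>\<^bsub>free_algebra R X\<^esub> z)"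
      using x y z by (intro free_algebra_mult_assoc) (auto simp: free_module_carrier)
  qed
  moreover have mult_l_distr: "(\<Oplus>k\<in>{..length w}. (a (take k w) \<oplus> b (take k w)) \<otimes> c (drop k w)) =
      (\<Oplus>k\<in>{..length w}. a (take k w) \<otimes> c (drop k w)) \<oplus> (\<Oplus>k\<in>{..length w}. b (take k w) \<otimes> c (drop k w))"
    and mult_r_distr: "(\<Oplus>k\<in>{..length w}. c (take k w) \<otimes> (a (drop k w) \<oplus> b (drop k w))) =
      (\<Oplus>k\<in>{..length w}. c (take k w) \<otimes> a (drop k w)) \<oplus> (\<Oplus>k\<in>{..length w}. c (take k w) \<otimes> b (drop k w))"
    if "\<And>w. a w \<in> carrier R" "\<And>w. b w \<in> carrier R" "\<And>w. c w \<in> carrier R" for a b c w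
    using that by (subst finsum_addf[symmetric]; auto simp: l_distr r_distr intro!: finsum_cong')+
  ultimately show "ring (free_algebra R X)"
    by (intro ringI) (auto simp: mult_l_distr mult_r_distr free_module_carrier)
  fix k x y
  assume k: "k \<in> carrier R" and "x \<in> carrier (free_algebra R X)" "y \<in> carrier (free_algebra R X)"
  then have x: "\<And>w. x w \<in> carrier R" and y: "\<And>w. y w \<in> carrier R"
    by (auto simp: free_module_carrier)
  have "(\<Oplus>i\<in>{..length w}. k \<otimes> x (take i w) \<otimes> y (drop i w)) =
      k \<otimes> (\<Oplus>i\<in>{..length w}. x (take i w) \<otimes> y (drop i w))"
    "(\<Oplus>i\<in>{..length w}. x (take i w) \<otimes> (k \<otimes> y (drop i w))) =
      k \<otimes> (\<Oplus>i\<in>{..length w}. x (take i w) \<otimes> y (drop i w))" for w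
    using k x y by (subst finsum_rdistr; auto intro!: finsum_cong' simp: m_assoc m_lcomm)+
  then show "k \<odot>\<^bsub>free_algebra R X\<^esub> x \<otimes>\<^bsub>free_algebra R X\<^esub> y = k \<odot>\<^bsub>free_algebra R X\<^esub> (x \<otimes>\<^bsub>free_algebra R X\<^esub> y)"
    "x \<otimes>\<^bsub>free_algebra R X\<^esub> (k \<odot>\<^bsub>free_algebra R X\<^esub> y) = k \<odot>\<^bsub>free_algebra R X\<^esub> (x \<otimes>\<^bsub>free_algebra R X\<^esub> y)"
    unfolding free_algebra_simps by simp_all
qed

end


section \<open>Extension of scalars and direct sums\<close>

lemma free_module_app: "a \<in> carrier (free_module R X) \<Longrightarrow> a x \<in> carrier R"
  by (simp add: free_module_def)

lemma free_module_support: "\<lbrakk>a \<in> carrier (free_module R X); a x \<noteq> \<zero>\<^bsub>R\<^esub>\<rbrakk> \<Longrightarrow> x \<in> X"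
  by (auto simp: free_module_def)

context module
begin

lemma submodule_Inter:
  assumes "\<And>N. N \<in> S \<Longrightarrow> submodule N R M" "S \<noteq> {}"
  shows "submodule (\<Inter>S) R M"
proof (rule submoduleI)
  obtain N where "N \<in> S" using assms(2) by auto
  then show "\<Inter>S \<subseteq> carrier M"
    using submoduleE(1)[OF assms(1)] by blast
  show "\<zero>\<^bsub>M\<^esub> \<in> \<Inter>S"
    using assms(1) submodule.axioms(1) subgroup.one_closed by fastforce
qed (use submoduleE[OF assms(1)] in auto)

end

lemma submodule_span_submodule:
  fixes M :: "('k, 'm) module"
  assumes M: "module R M" and "S \<subseteq> carrier M"
  shows "submodule (submodule_span R M S) R M"
  unfolding submodule_span_def using assms module.carrier_is_submodule[OF M]
  by (intro module.submodule_Inter[OF M]) auto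

lemma submodule_span_superset: "S \<subseteq> submodule_span R M S"
  unfolding submodule_span_def by blast

lemma submodule_span_minimal: "\<lbrakk>submodule N R M; S \<subseteq> N\<rbrakk> \<Longrightarrow> submodule_span R M S \<subseteq> N"
  unfolding submodule_span_def by blast


locale tensor_modules = M: module R M + N: module R N
  for R :: "('k, 'd) ring_scheme" (structure) and M :: "('k, 'm) module" and N :: "('k, 'n) module"
begin

abbreviation "L \<equiv> free_module R (carrier M \<times> carrier N)"
abbreviation "K \<equiv> tensor_kernel R M N"
abbreviation "T \<equiv> tensor R M N"

sublocale L: module R L
  by (rule M.free_module)

lemma bilinear_rels_closed: "bilinear_rels R M N \<subseteq> carrier L"
proof -
  note [intro!] = M.single_in_free_module
  show ?thesis
    unfolding bilinear_rels_def Let_def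
    by (intro Un_least subsetI; elim CollectE exE conjE; hypsubst;
        intro L.M.minus_closed L.M.a_closed L.smult_closed; auto)
qed

lemma K_submodule: "submodule K R L"
  unfolding tensor_kernel_def by (intro submodule_span_submodule L.module_axioms bilinear_rels_closed)

sublocale K: abelian_subgroup K L
  by (intro L.submodule_abelian_subgroup K_submodule)

sublocale T: module R T
  unfolding tensor_def by (intro quot_module L.module_axioms K_submodule)

definition cls :: "('m \<times> 'n \<Rightarrow> 'k) \<Rightarrow> ('m \<times> 'n \<Rightarrow> 'k) set" where
  "cls a = K +>\<^bsub>L\<^esub> a"

definition pure :: "'m \<Rightarrow> 'n \<Rightarrow> ('m \<times> 'n \<Rightarrow> 'k) set" where
  "pure m n = cls (single R (m, n))"

lemma T_carrier: "carrier T = cls ` carrier L"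
  by (simp add: tensor_def cls_def)

lemma cls_closed [simp]: "a \<in> carrier L \<Longrightarrow> cls a \<in> carrier T"
  by (simp add: T_carrier)

lemma cls_zero: "cls \<zero>\<^bsub>L\<^esub> = \<zero>\<^bsub>T\<^esub>"
  using L.M.a_coset_add_zero[OF K.a_subset] by (simp add: cls_def tensor_def)

lemma cls_add: "\<lbrakk>a \<in> carrier L; b \<in> carrier L\<rbrakk> \<Longrightarrow> cls a \<oplus>\<^bsub>T\<^esub> cls b = cls (a \<oplus>\<^bsub>L\<^esub> b)"
  unfolding cls_def tensor_def quot_simps by (rule K.a_rcos_sum)

lemma cls_smult: "\<lbrakk>k \<in> carrier R; a \<in> carrier L\<rbrakk> \<Longrightarrow> k \<odot>\<^bsub>T\<^esub> cls a = cls (k \<odot>\<^bsub>L\<^esub> a)"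
  unfolding cls_def tensor_def by (intro quot_smult[OF L.module_axioms] K_submodule)

lemma cls_eqI:
  assumes "a \<in> carrier L" "b \<in> carrier L" and ab: "a \<ominus>\<^bsub>L\<^esub> b \<in> bilinear_rels R M N"
  shows "cls a = cls b"
proof -
  have "a \<ominus>\<^bsub>L\<^esub> b \<in> K"
    unfolding tensor_kernel_def using submodule_span_superset ab by (rule subsetD)
  then show ?thesis
    using assms by (simp add: cls_def K.rcos_eq_iff)
qed

lemma single_closed: "\<lbrakk>m \<in> carrier M; n \<in> carrier N\<rbrakk> \<Longrightarrow> single R (m, n) \<in> carrier L"
  by (simp add: M.single_in_free_module)

lemma pure_closed [simp]: "\<lbrakk>m \<in> carrier M; n \<in> carrier N\<rbrakk> \<Longrightarrow> pure m n \<in> carrier T"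
  by (simp add: pure_def single_closed)

lemma pure_add_l:
  assumes "m \<in> carrier M" "m' \<in> carrier M" "n \<in> carrier N"
  shows "pure (m \<oplus>\<^bsub>M\<^esub> m') n = pure m n \<oplus>\<^bsub>T\<^esub> pure m' n"
proof -
  have "cls (single R (m \<oplus>\<^bsub>M\<^esub> m', n)) = cls (single R (m, n) \<oplus>\<^bsub>L\<^esub> single R (m', n))"
  proof (rule cls_eqI)
    show "single R (m \<oplus>\<^bsub>M\<^esub> m', n) \<ominus>\<^bsub>L\<^esub> (single R (m, n) \<oplus>\<^bsub>L\<^esub> single R (m', n)) \<in> bilinear_rels R M N"
      unfolding bilinear_rels_def Let_def using assms by blast
  qed (use assms in \<open>intro L.M.a_closed single_closed; simp\<close>)+
  then show ?thesis
    using assms by (simp only: pure_def cls_add single_closed)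
qed

lemma pure_smult_r:
  assumes "r \<in> carrier R" "m \<in> carrier M" "n \<in> carrier N"
  shows "pure m (r \<odot>\<^bsub>N\<^esub> n) = r \<odot>\<^bsub>T\<^esub> pure m n"
proof -
  have "cls (single R (m, r \<odot>\<^bsub>N\<^esub> n)) = cls (r \<odot>\<^bsub>L\<^esub> single R (m, n))"
  proof (rule cls_eqI)
    show "single R (m, r \<odot>\<^bsub>N\<^esub> n) \<ominus>\<^bsub>L\<^esub> (r \<odot>\<^bsub>L\<^esub> single R (m, n)) \<in> bilinear_rels R M N"
      unfolding bilinear_rels_def Let_def using assms by blast
  qed (use assms in \<open>intro L.smult_closed single_closed; simp\<close>)+
  then show ?thesis
    using assms by (simp only: pure_def cls_smult single_closed)
qed

lemma tensor_induct [consumes 1, case_names zero add]: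
  assumes X: "X \<in> carrier T"
    and zero: "P \<zero>\<^bsub>T\<^esub>"
    and add: "\<And>r m n Y. \<lbrakk>r \<in> carrier R; m \<in> carrier M; n \<in> carrier N; Y \<in> carrier T; P Y\<rbrakk>
      \<Longrightarrow> P (r \<odot>\<^bsub>T\<^esub> pure m n \<oplus>\<^bsub>T\<^esub> Y)"
  shows "P X"
proof -
  obtain a where a: "a \<in> carrier L" and X_eq: "X = cls a"
    using X by (auto simp: T_carrier)
  from a have "P (cls a)"
  proof (induction rule: M.free_module_induct)
    case zero
    then show ?case using assms(2) cls_zero by simp
  next
    case (add r x b)
    obtain m n where x: "x = (m, n)" "m \<in> carrier M" "n \<in> carrier N"
      using add by auto
    have "cls (\<lambda>y. r \<otimes> single R x y \<oplus> b y) = cls (r \<odot>\<^bsub>L\<^esub> single R x \<oplus>\<^bsub>L\<^esub> b)"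
      by simp
    also have "\<dots> = r \<odot>\<^bsub>T\<^esub> pure m n \<oplus>\<^bsub>T\<^esub> cls b"
      unfolding x pure_def using add(1,3) x L.smult_closed
      by (simp only: cls_add cls_smult single_closed)
    finally show ?case
      using assms(3) add x by simp
  qed
  then show ?thesis using X_eq by simp
qed

text \<open>A pure tensor with \<open>n = 0\<close> vanishes, as \<open>0 = 0 \<cdot> n\<close>.\<close>

lemma tensor_trivial:
  assumes "carrier N = {\<zero>\<^bsub>N\<^esub>}"
  shows "carrier T = {\<zero>\<^bsub>T\<^esub>}"
proof -
  have "X = \<zero>\<^bsub>T\<^esub>" if "X \<in> carrier T" for X
    using that
  proof (induction rule: tensor_induct)
    case (add r m n Y)
    then have "n = \<zero> \<odot>\<^bsub>N\<^esub> n" using assms by simp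
    then have "pure m n = \<zero>\<^bsub>T\<^esub>"
      using add pure_smult_r[of \<zero> m n] by simp
    then show ?case using add by simp
  qed simp
  then show ?thesis by auto
qed

end


locale tensor_scalars = tensor_modules R C N + C: assoc_algebra R C + C: cring C
  for R :: "('k, 'd) ring_scheme" (structure) and C :: "('k, 'c) module" and N :: "('k, 'n) module"
begin

abbreviation "E \<equiv> extend_scalars R C N"

text \<open>The defining sum runs over a set that depends on \<open>a\<close>, \<open>c\<close> and
  \<open>g\<close>. Rewritten over one finite set \<open>S\<close> of first components, the sums for
  \<open>a\<close>, \<open>b\<close> and their sum can be compared term by term.\<close>

lemma left_mult_eq:
  assumes "a \<in> carrier L" "finite S" "S \<subseteq> carrier C" "\<And>f. a (f, n) \<noteq> \<zero> \<Longrightarrow> f \<in> S"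
  shows "left_mult R C c a (g, n) = (\<Oplus>f\<in>S. if c \<otimes>\<^bsub>C\<^esub> f = g then a (f, n) else \<zero>)"
proof -
  have "left_mult R C c a (g, n) = (\<Oplus>f\<in>{f \<in> carrier C. a (f, n) \<noteq> \<zero> \<and> c \<otimes>\<^bsub>C\<^esub> f = g}. a (f, n))"
    by (simp add: left_mult_def)
  also have "\<dots> = (\<Oplus>f\<in>S. if c \<otimes>\<^bsub>C\<^esub> f = g then a (f, n) else \<zero>)"
  proof (rule M.R.add.finprod_mono_neutral_cong_left)
    show "(\<lambda>f. if c \<otimes>\<^bsub>C\<^esub> f = g then a (f, n) else \<zero>) \<in> S \<rightarrow> carrier R"
      using free_module_app[OF assms(1)] by simp
    show "(if c \<otimes>\<^bsub>C\<^esub> f = g then a (f, n) else \<zero>) = \<zero>"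
      if "f \<in> S - {f \<in> carrier C. a (f, n) \<noteq> \<zero> \<and> c \<otimes>\<^bsub>C\<^esub> f = g}" for f
      using that assms(3) by auto
  qed (use assms(2,4) in \<open>simp_all add: subset_iff\<close>)
  finally show ?thesis .
qed

lemma left_mult_support:
  assumes "a \<in> carrier L"
  obtains S where "finite S" "S \<subseteq> carrier C" "\<And>f n. a (f, n) \<noteq> \<zero> \<Longrightarrow> f \<in> S"
proof
  show "finite (fst ` {x. a x \<noteq> \<zero>})"
    using assms by (simp add: free_module_carrier)
  show "fst ` {x. a x \<noteq> \<zero>} \<subseteq> carrier C"
  proof
    fix f assume "f \<in> fst ` {x. a x \<noteq> \<zero>}"
    then obtain x where "f = fst x" "a x \<noteq> \<zero>" by blast
    then show "f \<in> carrier C"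
      using free_module_support[OF assms, of x] by auto
  qed
  show "f \<in> fst ` {x. a x \<noteq> \<zero>}" if "a (f, n) \<noteq> \<zero>" for f n
    using that by (intro image_eqI[of _ _ "(f, n)"]) simp_all
qed

lemma left_mult_zero: "left_mult R C c (\<lambda>x :: 'c \<times> 'n. \<zero>) = (\<lambda>x. \<zero>)"
  by (auto simp: left_mult_def)

lemma left_mult_add:
  assumes a: "a \<in> carrier L" and b: "b \<in> carrier L"
  shows "left_mult R C c (a \<oplus>\<^bsub>L\<^esub> b) = left_mult R C c a \<oplus>\<^bsub>L\<^esub> left_mult R C c b"
proof
  fix x :: "'c \<times> 'n"
  obtain g n where x: "x = (g, n)" by force
  obtain S where S: "finite S" "S \<subseteq> carrier C" "\<And>f n. a (f, n) \<noteq> \<zero> \<Longrightarrow> f \<in> S"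
    using left_mult_support[OF a] by blast
  obtain S' where S': "finite S'" "S' \<subseteq> carrier C" "\<And>f n. b (f, n) \<noteq> \<zero> \<Longrightarrow> f \<in> S'"
    using left_mult_support[OF b] by blast
  have ab: "a y \<in> carrier R" "b y \<in> carrier R" for y
    using free_module_app[OF a] free_module_app[OF b] by simp_all
  have supp: "f \<in> S \<union> S'" if "(a \<oplus>\<^bsub>L\<^esub> b) (f, n) \<noteq> \<zero>" for f n
    using that S(3)[of f n] S'(3)[of f n] by fastforce
  have "left_mult R C c (a \<oplus>\<^bsub>L\<^esub> b) x =
      (\<Oplus>f\<in>S \<union> S'. if c \<otimes>\<^bsub>C\<^esub> f = g then (a \<oplus>\<^bsub>L\<^esub> b) (f, n) else \<zero>)"
    unfolding x using S S' supp a b by (intro left_mult_eq L.M.a_closed) auto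
  also have "\<dots> = (\<Oplus>f\<in>S \<union> S'. (if c \<otimes>\<^bsub>C\<^esub> f = g then a (f, n) else \<zero>) \<oplus>
      (if c \<otimes>\<^bsub>C\<^esub> f = g then b (f, n) else \<zero>))"
    using ab by (intro M.R.finsum_cong') auto
  also have "\<dots> = (\<Oplus>f\<in>S \<union> S'. if c \<otimes>\<^bsub>C\<^esub> f = g then a (f, n) else \<zero>) \<oplus>
      (\<Oplus>f\<in>S \<union> S'. if c \<otimes>\<^bsub>C\<^esub> f = g then b (f, n) else \<zero>)"
    using ab by (intro M.R.finsum_addf) auto
  also have "\<dots> = left_mult R C c a x \<oplus> left_mult R C c b x"
    unfolding x using S S' a b by (subst (1 2) left_mult_eq[of _ "S \<union> S'"]) auto
  finally show "left_mult R C c (a \<oplus>\<^bsub>L\<^esub> b) x = (left_mult R C c a \<oplus>\<^bsub>L\<^esub> left_mult R C c b) x"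
    by simp
qed

lemma left_mult_smult:
  assumes r: "r \<in> carrier R" and a: "a \<in> carrier L"
  shows "left_mult R C c (r \<odot>\<^bsub>L\<^esub> a) = r \<odot>\<^bsub>L\<^esub> left_mult R C c a"
proof
  fix x :: "'c \<times> 'n"
  obtain g n where x: "x = (g, n)" by force
  obtain S where S: "finite S" "S \<subseteq> carrier C" "\<And>f n. a (f, n) \<noteq> \<zero> \<Longrightarrow> f \<in> S"
    using left_mult_support[OF a] by blast
  have a': "a y \<in> carrier R" for y
    using a by (rule free_module_app)
  have supp: "f \<in> S" if "(r \<odot>\<^bsub>L\<^esub> a) (f, n) \<noteq> \<zero>" for f n
    using that S(3)[of f n] r by fastforce
  have "left_mult R C c (r \<odot>\<^bsub>L\<^esub> a) x = (\<Oplus>f\<in>S. if c \<otimes>\<^bsub>C\<^esub> f = g then (r \<odot>\<^bsub>L\<^esub> a) (f, n) else \<zero>)"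
    unfolding x using S supp a r by (intro left_mult_eq L.smult_closed) auto
  also have "\<dots> = (\<Oplus>f\<in>S. r \<otimes> (if c \<otimes>\<^bsub>C\<^esub> f = g then a (f, n) else \<zero>))"
    using a' r by (intro M.R.finsum_cong') auto
  also have "\<dots> = r \<otimes> (\<Oplus>f\<in>S. if c \<otimes>\<^bsub>C\<^esub> f = g then a (f, n) else \<zero>)"
    using a' r S by (subst M.R.finsum_rdistr) auto
  also have "\<dots> = r \<otimes> left_mult R C c a x"
    unfolding x using S a by (subst left_mult_eq[of _ S]) auto
  finally show "left_mult R C c (r \<odot>\<^bsub>L\<^esub> a) x = (r \<odot>\<^bsub>L\<^esub> left_mult R C c a) x"
    by simp
qed

lemma left_mult_single:
  assumes "c \<in> carrier C" "f \<in> carrier C" "n \<in> carrier N"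
  shows "left_mult R C c (single R (f, n)) = single R (c \<otimes>\<^bsub>C\<^esub> f, n)"
proof
  fix x :: "'c \<times> 'n"
  obtain g m where x: "x = (g, m)" by force
  have "left_mult R C c (single R (f, n)) x =
      (\<Oplus>f'\<in>{f}. if c \<otimes>\<^bsub>C\<^esub> f' = g then single R (f, n) (f', m) else \<zero>)"
    unfolding x using assms single_closed
    by (intro left_mult_eq) (auto simp: single_def split: if_splits)
  then show "left_mult R C c (single R (f, n)) x = single R (c \<otimes>\<^bsub>C\<^esub> f, n) x"
    unfolding x by (auto simp: single_def)
qed

lemma left_mult_closed:
  assumes c: "c \<in> carrier C" and a: "a \<in> carrier L"
  shows "left_mult R C c a \<in> carrier L"
  using a
proof (induction rule: M.free_module_induct)
  case zero
  then show ?case using left_mult_zero L.M.zero_closed by simp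
next
  case (add r x b)
  obtain f n where x: "x = (f, n)" "f \<in> carrier C" "n \<in> carrier N"
    using add by auto
  have "left_mult R C c (\<lambda>y. r \<otimes> single R x y \<oplus> b y) = left_mult R C c (r \<odot>\<^bsub>L\<^esub> single R x \<oplus>\<^bsub>L\<^esub> b)"
    by simp
  also have "\<dots> = r \<odot>\<^bsub>L\<^esub> single R (c \<otimes>\<^bsub>C\<^esub> f, n) \<oplus>\<^bsub>L\<^esub> left_mult R C c b"
    unfolding x using add(1,3) x c L.smult_closed
    by (simp only: left_mult_add left_mult_smult left_mult_single single_closed)
  also have "\<dots> \<in> carrier L"
    using add x c by (intro L.M.a_closed L.smult_closed single_closed) auto
  finally show ?case .
qed

lemma left_mult_minus:
  assumes c: "c \<in> carrier C" and a: "a \<in> carrier L" and b: "b \<in> carrier L"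
  shows "left_mult R C c (a \<ominus>\<^bsub>L\<^esub> b) = left_mult R C c a \<ominus>\<^bsub>L\<^esub> left_mult R C c b"
proof -
  have "\<ominus>\<^bsub>L\<^esub> d = (\<ominus> \<one>) \<odot>\<^bsub>L\<^esub> d" if "d \<in> carrier L" for d
    using that L.smult_l_minus[of \<one> d] by (simp only: L.smult_one M.R.one_closed)
  then show ?thesis
    using assms left_mult_closed[OF c b]
    by (simp only: a_minus_def left_mult_add left_mult_smult L.smult_closed M.R.a_inv_closed M.R.one_closed)
qed

text \<open>Multiplying the first components by \<open>c\<close> turns each bilinear relation into a
  relation of the same kind. Hence the action on representatives descends to the tensor
  product.\<close>

lemma left_mult_kernel:
  assumes c: "c \<in> carrier C" and a: "a \<in> K"
  shows "left_mult R C c a \<in> K"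
proof -
  \<comment> \<open>The elements sent into \<open>K\<close> form a submodule; as it contains the
    relations, it contains their span \<open>K\<close>.\<close>
  have "submodule {a \<in> carrier L. left_mult R C c a \<in> K} R L"
  proof (rule L.submoduleI)
    fix x assume x: "x \<in> {a \<in> carrier L. left_mult R C c a \<in> K}"
    have "\<ominus>\<^bsub>L\<^esub> x = \<zero>\<^bsub>L\<^esub> \<ominus>\<^bsub>L\<^esub> x"
      using x L.M.l_zero[of "\<ominus>\<^bsub>L\<^esub> x"] L.M.a_inv_closed by (simp only: a_minus_def mem_Collect_eq)
    moreover have "left_mult R C c (\<zero>\<^bsub>L\<^esub> \<ominus>\<^bsub>L\<^esub> x) = \<zero>\<^bsub>L\<^esub> \<ominus>\<^bsub>L\<^esub> left_mult R C c x"
      using c x left_mult_minus[of c "\<zero>\<^bsub>L\<^esub>" x] left_mult_zero L.M.zero_closed by simp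
    moreover have "\<zero>\<^bsub>L\<^esub> \<ominus>\<^bsub>L\<^esub> left_mult R C c x \<in> K"
      using x K.zero_closed unfolding a_minus_def by (intro K.a_closed K.a_inv_closed) auto
    ultimately show "\<ominus>\<^bsub>L\<^esub> x \<in> {a \<in> carrier L. left_mult R C c a \<in> K}"
      using x L.M.a_inv_closed[of x] by (simp only: mem_Collect_eq)
  next
    show "\<zero>\<^bsub>L\<^esub> \<in> {a \<in> carrier L. left_mult R C c a \<in> K}"
      using K.zero_closed L.M.zero_closed left_mult_zero by simp
  qed (use left_mult_add left_mult_smult K.a_closed submodule.smult_closed[OF K_submodule]
      L.M.a_closed L.smult_closed in auto)
  moreover note lin = left_mult_minus left_mult_add left_mult_smult left_mult_single single_closed
    L.M.a_closed L.smult_closed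
  have "bilinear_rels R C N \<subseteq> {a \<in> carrier L. left_mult R C c a \<in> K}"
  proof
    fix s assume s: "s \<in> bilinear_rels R C N"
    have "left_mult R C c s \<in> bilinear_rels R C N"
      using s[unfolded bilinear_rels_def Let_def]
    proof (elim UnE CollectE exE conjE)
      fix m m' n
      assume s: "s = single R (m \<oplus>\<^bsub>C\<^esub> m', n) \<ominus>\<^bsub>L\<^esub> (single R (m, n) \<oplus>\<^bsub>L\<^esub> single R (m', n))"
        and car: "m \<in> carrier C" "m' \<in> carrier C" "n \<in> carrier N"
      have "left_mult R C c s = single R ((c \<otimes>\<^bsub>C\<^esub> m) \<oplus>\<^bsub>C\<^esub> (c \<otimes>\<^bsub>C\<^esub> m'), n) \<ominus>\<^bsub>L\<^esub>
          (single R (c \<otimes>\<^bsub>C\<^esub> m, n) \<oplus>\<^bsub>L\<^esub> single R (c \<otimes>\<^bsub>C\<^esub> m', n))"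
        unfolding s using car c by (simp only: lin C.A.r_distr M.M.a_closed)
      moreover have "c \<otimes>\<^bsub>C\<^esub> m \<in> carrier C" "c \<otimes>\<^bsub>C\<^esub> m' \<in> carrier C" using car c by simp_all
      ultimately show ?thesis unfolding bilinear_rels_def Let_def using car by blast
    next
      fix m n n'
      assume s: "s = single R (m, n \<oplus>\<^bsub>N\<^esub> n') \<ominus>\<^bsub>L\<^esub> (single R (m, n) \<oplus>\<^bsub>L\<^esub> single R (m, n'))"
        and car: "m \<in> carrier C" "n \<in> carrier N" "n' \<in> carrier N"
      have "left_mult R C c s = single R (c \<otimes>\<^bsub>C\<^esub> m, n \<oplus>\<^bsub>N\<^esub> n') \<ominus>\<^bsub>L\<^esub>
          (single R (c \<otimes>\<^bsub>C\<^esub> m, n) \<oplus>\<^bsub>L\<^esub> single R (c \<otimes>\<^bsub>C\<^esub> m, n'))"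
        unfolding s using car c by (simp only: lin N.M.a_closed)
      moreover have "c \<otimes>\<^bsub>C\<^esub> m \<in> carrier C" using car c by simp
      ultimately show ?thesis unfolding bilinear_rels_def Let_def using car by blast
    next
      fix r m n
      assume s: "s = single R (r \<odot>\<^bsub>C\<^esub> m, n) \<ominus>\<^bsub>L\<^esub> (r \<odot>\<^bsub>L\<^esub> single R (m, n))"
        and car: "r \<in> carrier R" "m \<in> carrier C" "n \<in> carrier N"
      have "left_mult R C c s = single R (r \<odot>\<^bsub>C\<^esub> (c \<otimes>\<^bsub>C\<^esub> m), n) \<ominus>\<^bsub>L\<^esub>
          (r \<odot>\<^bsub>L\<^esub> single R (c \<otimes>\<^bsub>C\<^esub> m, n))"
        unfolding s using car c by (simp only: lin C.smult_mult_r M.smult_closed)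
      moreover have "c \<otimes>\<^bsub>C\<^esub> m \<in> carrier C" using car c by simp
      ultimately show ?thesis unfolding bilinear_rels_def Let_def using car by blast
    next
      fix r m n
      assume s: "s = single R (m, r \<odot>\<^bsub>N\<^esub> n) \<ominus>\<^bsub>L\<^esub> (r \<odot>\<^bsub>L\<^esub> single R (m, n))"
        and car: "r \<in> carrier R" "m \<in> carrier C" "n \<in> carrier N"
      have "left_mult R C c s = single R (c \<otimes>\<^bsub>C\<^esub> m, r \<odot>\<^bsub>N\<^esub> n) \<ominus>\<^bsub>L\<^esub>
          (r \<odot>\<^bsub>L\<^esub> single R (c \<otimes>\<^bsub>C\<^esub> m, n))"
        unfolding s using car c by (simp only: lin N.smult_closed)
      moreover have "c \<otimes>\<^bsub>C\<^esub> m \<in> carrier C" using car c by simp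
      ultimately show ?thesis unfolding bilinear_rels_def Let_def using car by blast
    qed
    then have "left_mult R C c s \<in> K"
      unfolding tensor_kernel_def by (rule subsetD[OF submodule_span_superset])
    then show "s \<in> {a \<in> carrier L. left_mult R C c a \<in> K}"
      using s bilinear_rels_closed by blast
  qed
  ultimately have "K \<subseteq> {a \<in> carrier L. left_mult R C c a \<in> K}"
    unfolding tensor_kernel_def by (rule submodule_span_minimal)
  then show ?thesis
    using a by blast
qed

lemma extend_scalars_simps [simp]:
  "carrier E = carrier T" "zero E = \<zero>\<^bsub>T\<^esub>" "add E = add T"
  by (simp_all add: extend_scalars_def with_smult_def)

lemma extend_scalars_smult_cls:
  assumes c: "c \<in> carrier C" and a: "a \<in> carrier L"
  shows "c \<odot>\<^bsub>E\<^esub> cls a = cls (left_mult R C c a)"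
proof -
  have "left_mult R C c x \<ominus>\<^bsub>L\<^esub> left_mult R C c y \<in> K"
    if "x \<in> carrier L" "y \<in> carrier L" "x \<ominus>\<^bsub>L\<^esub> y \<in> K" for x y
    using that left_mult_kernel[OF c] left_mult_minus[OF c] by metis
  then have "(\<Union>x\<in>K +>\<^bsub>L\<^esub> a. K +>\<^bsub>L\<^esub> left_mult R C c x) = K +>\<^bsub>L\<^esub> left_mult R C c a"
    using left_mult_closed[OF c] a by (intro K.UN_rcos) auto
  then show ?thesis
    by (simp add: extend_scalars_def with_smult_def cls_def)
qed

lemma extend_scalars_smult_pure:
  "\<lbrakk>c \<in> carrier C; f \<in> carrier C; n \<in> carrier N\<rbrakk> \<Longrightarrow> c \<odot>\<^bsub>E\<^esub> pure f n = pure (c \<otimes>\<^bsub>C\<^esub> f) n"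
  by (simp add: pure_def extend_scalars_smult_cls single_closed left_mult_single)

lemma extend_scalars_smult_closed:
  "\<lbrakk>c \<in> carrier C; X \<in> carrier T\<rbrakk> \<Longrightarrow> c \<odot>\<^bsub>E\<^esub> X \<in> carrier T"
  by (auto simp: T_carrier extend_scalars_smult_cls left_mult_closed)

lemma extend_scalars_smult_zero:
  assumes "c \<in> carrier C"
  shows "c \<odot>\<^bsub>E\<^esub> \<zero>\<^bsub>T\<^esub> = \<zero>\<^bsub>T\<^esub>"
  using assms left_mult_zero extend_scalars_smult_cls[OF assms L.M.zero_closed] cls_zero by simp

lemma extend_scalars_smult_add:
  assumes "c \<in> carrier C" "X \<in> carrier T" "Y \<in> carrier T"
  shows "c \<odot>\<^bsub>E\<^esub> (X \<oplus>\<^bsub>T\<^esub> Y) = c \<odot>\<^bsub>E\<^esub> X \<oplus>\<^bsub>T\<^esub> c \<odot>\<^bsub>E\<^esub> Y"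
proof -
  obtain a b where "a \<in> carrier L" "b \<in> carrier L" "X = cls a" "Y = cls b"
    using assms by (auto simp: T_carrier)
  with assms(1) show ?thesis
    by (simp only: cls_add extend_scalars_smult_cls left_mult_add L.M.a_closed left_mult_closed)
qed

lemma extend_scalars_smult_smult:
  assumes "c \<in> carrier C" "r \<in> carrier R" "X \<in> carrier T"
  shows "c \<odot>\<^bsub>E\<^esub> (r \<odot>\<^bsub>T\<^esub> X) = r \<odot>\<^bsub>T\<^esub> (c \<odot>\<^bsub>E\<^esub> X)"
proof -
  obtain a where "a \<in> carrier L" "X = cls a"
    using assms by (auto simp: T_carrier)
  with assms(1,2) show ?thesis
    by (simp only: cls_smult extend_scalars_smult_cls left_mult_smult L.smult_closed left_mult_closed)
qed

text \<open>The laws are checked on sums of pure tensors, where the action multiplies the first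
  factor. Distributivity over a sum of two scalars is the one that relies on additivity in that
  factor, \<open>pure_add_l\<close>.\<close>

lemma extend_scalars_module: "module C E"
proof (rule moduleI)
  show "cring C" ..
  show "abelian_group E"
    by (rule abelian_group_image[OF T.M.abelian_group_axioms, where \<pi> = "\<lambda>x. x"]) auto
  note smult_simps = extend_scalars_smult_add extend_scalars_smult_smult extend_scalars_smult_pure
    extend_scalars_smult_closed extend_scalars_smult_zero
  show one: "\<one>\<^bsub>C\<^esub> \<odot>\<^bsub>E\<^esub> x = x" if "x \<in> carrier E" for x
    using that unfolding extend_scalars_simps
    by (induction rule: tensor_induct) (simp_all add: smult_simps)
  fix c x assume c: "c \<in> carrier C" and "x \<in> carrier E"
  then have x: "x \<in> carrier T" by simp
  show "c \<odot>\<^bsub>E\<^esub> x \<in> carrier E"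
    using c x by (simp add: extend_scalars_smult_closed)
  show "c \<odot>\<^bsub>E\<^esub> (x \<oplus>\<^bsub>E\<^esub> y) = c \<odot>\<^bsub>E\<^esub> x \<oplus>\<^bsub>E\<^esub> c \<odot>\<^bsub>E\<^esub> y" if "y \<in> carrier E" for y
    using c x that by (simp add: extend_scalars_smult_add)
  fix d assume d: "d \<in> carrier C"
  show "(c \<otimes>\<^bsub>C\<^esub> d) \<odot>\<^bsub>E\<^esub> x = c \<odot>\<^bsub>E\<^esub> (d \<odot>\<^bsub>E\<^esub> x)"
    using x c d by (induction rule: tensor_induct) (simp_all add: smult_simps C.A.m_assoc)
  have "(c \<oplus>\<^bsub>C\<^esub> d) \<odot>\<^bsub>E\<^esub> x = c \<odot>\<^bsub>E\<^esub> x \<oplus>\<^bsub>T\<^esub> d \<odot>\<^bsub>E\<^esub> x"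
    using x
  proof (induction rule: tensor_induct)
    case (add r m n Y)
    then show ?case
      using c d by (simp add: smult_simps C.A.l_distr pure_add_l T.smult_r_distr T.M.a_ac)
  qed (use c d in \<open>simp add: smult_simps\<close>)
  then show "(c \<oplus>\<^bsub>C\<^esub> d) \<odot>\<^bsub>E\<^esub> x = c \<odot>\<^bsub>E\<^esub> x \<oplus>\<^bsub>E\<^esub> d \<odot>\<^bsub>E\<^esub> x"
    by simp
qed

end


lemma direct_sum_module:
  assumes C: "cring C" and E: "\<And>i. i \<in> I \<Longrightarrow> module C (E i)"
  shows "module C (direct_sum I E)"
proof -
  note simps = direct_sum_def PiE_iff
  have ab: "abelian_group (E i)" if "i \<in> I" for i
    using E[OF that] by (simp add: module_def)
  have add: "x \<oplus>\<^bsub>direct_sum I E\<^esub> y \<in> carrier (direct_sum I E)"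
    if "x \<in> carrier (direct_sum I E)" "y \<in> carrier (direct_sum I E)" for x y
  proof -
    have "{i \<in> I. x i \<oplus>\<^bsub>E i\<^esub> y i \<noteq> \<zero>\<^bsub>E i\<^esub>} \<subseteq> {i \<in> I. x i \<noteq> \<zero>\<^bsub>E i\<^esub>} \<union> {i \<in> I. y i \<noteq> \<zero>\<^bsub>E i\<^esub>}"
      using abelian_groupE(2,5)[OF ab] by auto
    then show ?thesis
      using that abelian_groupE(1)[OF ab] by (auto simp: simps intro: finite_subset)
  qed
  have smult: "c \<odot>\<^bsub>direct_sum I E\<^esub> x \<in> carrier (direct_sum I E)"
    if "x \<in> carrier (direct_sum I E)" "c \<in> carrier C" for c x
  proof -
    have "{i \<in> I. c \<odot>\<^bsub>E i\<^esub> x i \<noteq> \<zero>\<^bsub>E i\<^esub>} \<subseteq> {i \<in> I. x i \<noteq> \<zero>\<^bsub>E i\<^esub>}"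
      using module.smult_r_null[OF E] that by auto
    then show ?thesis
      using that module.smult_closed[OF E] by (auto simp: simps intro: finite_subset)
  qed
  show ?thesis
  proof (rule moduleI[OF C])
    show "abelian_group (direct_sum I E)"
    proof (rule abelian_groupI)
      fix x assume x: "x \<in> carrier (direct_sum I E)"
      \<comment> \<open>The negative of \<open>x\<close> is taken as \<open>(-1) x\<close>, for
        which membership in the direct sum is already known from closure under scalars.\<close>
      have eq: "(\<ominus>\<^bsub>C\<^esub> \<one>\<^bsub>C\<^esub>) \<odot>\<^bsub>E i\<^esub> x i \<oplus>\<^bsub>E i\<^esub> x i = \<zero>\<^bsub>E i\<^esub>" if "i \<in> I" for i
      proof -
        interpret module C "E i" by (rule E) fact
        show ?thesis using x that by (simp add: simps smult_l_minus M.l_neg)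
      qed
      have "\<ominus>\<^bsub>C\<^esub> \<one>\<^bsub>C\<^esub> \<in> carrier C"
        using C by (simp add: cring.axioms(1) ring.axioms(1) abelian_group.a_inv_closed monoid.one_closed ring.is_monoid)
      then show "\<exists>y\<in>carrier (direct_sum I E). y \<oplus>\<^bsub>direct_sum I E\<^esub> x = \<zero>\<^bsub>direct_sum I E\<^esub>"
        using eq by (intro bexI[OF _ smult[OF x]]) (auto simp: direct_sum_def)
    next
      fix x y z
      assume "x \<in> carrier (direct_sum I E)" "y \<in> carrier (direct_sum I E)" "z \<in> carrier (direct_sum I E)"
      then show "x \<oplus>\<^bsub>direct_sum I E\<^esub> y \<oplus>\<^bsub>direct_sum I E\<^esub> z =
          x \<oplus>\<^bsub>direct_sum I E\<^esub> (y \<oplus>\<^bsub>direct_sum I E\<^esub> z)"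
        using abelian_groupE(3)[OF ab] by (auto simp: simps)
    next
      fix x y
      assume "x \<in> carrier (direct_sum I E)" "y \<in> carrier (direct_sum I E)"
      then show "x \<oplus>\<^bsub>direct_sum I E\<^esub> y = y \<oplus>\<^bsub>direct_sum I E\<^esub> x"
        using abelian_groupE(4)[OF ab] by (auto simp: simps)
    next
      fix x
      assume "x \<in> carrier (direct_sum I E)"
      then show "\<zero>\<^bsub>direct_sum I E\<^esub> \<oplus>\<^bsub>direct_sum I E\<^esub> x = x"
        using abelian_groupE(5)[OF ab] by (auto simp: simps extensional_def fun_eq_iff)
    next
      have "{i \<in> I. (\<lambda>i\<in>I. \<zero>\<^bsub>E i\<^esub>) i \<noteq> \<zero>\<^bsub>E i\<^esub>} = {}" by auto
      then show "\<zero>\<^bsub>direct_sum I E\<^esub> \<in> carrier (direct_sum I E)"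
        using abelian_groupE(2)[OF ab] by (simp add: simps)
    qed (rule add)
    show "\<one>\<^bsub>C\<^esub> \<odot>\<^bsub>direct_sum I E\<^esub> x = x" if "x \<in> carrier (direct_sum I E)" for x
      using that by (auto simp: simps module.smult_one[OF E] fun_eq_iff extensional_def)
  next
    fix c x assume c: "c \<in> carrier C" and x: "x \<in> carrier (direct_sum I E)"
    then show "c \<odot>\<^bsub>direct_sum I E\<^esub> x \<in> carrier (direct_sum I E)"
      by (intro smult)
    have xi: "x i \<in> carrier (E i)" if "i \<in> I" for i using x that by (auto simp: simps)
    show "c \<odot>\<^bsub>direct_sum I E\<^esub> (x \<oplus>\<^bsub>direct_sum I E\<^esub> y) =
        c \<odot>\<^bsub>direct_sum I E\<^esub> x \<oplus>\<^bsub>direct_sum I E\<^esub> c \<odot>\<^bsub>direct_sum I E\<^esub> y"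
      if "y \<in> carrier (direct_sum I E)" for y
      using c xi that by (auto simp: simps module.smult_r_distr[OF E])
    fix d assume d: "d \<in> carrier C"
    then show "(c \<oplus>\<^bsub>C\<^esub> d) \<odot>\<^bsub>direct_sum I E\<^esub> x =
        c \<odot>\<^bsub>direct_sum I E\<^esub> x \<oplus>\<^bsub>direct_sum I E\<^esub> d \<odot>\<^bsub>direct_sum I E\<^esub> x"
      "(c \<otimes>\<^bsub>C\<^esub> d) \<odot>\<^bsub>direct_sum I E\<^esub> x = c \<odot>\<^bsub>direct_sum I E\<^esub> (d \<odot>\<^bsub>direct_sum I E\<^esub> x)"
      using c xi by (auto simp: direct_sum_def module.smult_l_distr[OF E] module.smult_assoc1[OF E])
  qed
qed


section \<open>The supersymmetric algebra\<close>

text \<open>No negatives are included; the sets \<open>S\<close> used below are closed under negation.\<close>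

inductive_set addspan :: "('a, 'd) ring_scheme \<Rightarrow> 'a set \<Rightarrow> 'a set" for A S where
  zero: "\<zero>\<^bsub>A\<^esub> \<in> addspan A S"
| add: "\<lbrakk>x \<in> S; y \<in> addspan A S\<rbrakk> \<Longrightarrow> x \<oplus>\<^bsub>A\<^esub> y \<in> addspan A S"

lemma addspan_mono: "S \<subseteq> S' \<Longrightarrow> addspan A S \<subseteq> addspan A S'"
proof
  fix x assume S: "S \<subseteq> S'" and "x \<in> addspan A S"
  from this(2) show "x \<in> addspan A S'"
    by induction (use S in \<open>auto intro: addspan.intros\<close>)
qed

context abelian_group
begin

lemma addspan_closed:
  assumes "S \<subseteq> carrier G"
  shows "addspan G S \<subseteq> carrier G"
proof
  fix x assume "x \<in> addspan G S"
  then show "x \<in> carrier G" by induction (use assms in auto)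
qed

lemma addspan_base:
  assumes "S \<subseteq> carrier G" "x \<in> S"
  shows "x \<in> addspan G S"
  using addspan.add[OF assms(2) addspan.zero, of G] assms by auto

lemma addspan_add:
  assumes S: "S \<subseteq> carrier G" and "x \<in> addspan G S" and y: "y \<in> addspan G S"
  shows "x \<oplus> y \<in> addspan G S"
  using assms(2)
proof induction
  case zero
  then show ?case using y addspan_closed[OF S] by auto
next
  case (add x z)
  then have "x \<in> carrier G" "z \<in> carrier G" "y \<in> carrier G"
    using S y addspan_closed[OF S] by auto
  then have "x \<oplus> z \<oplus> y = x \<oplus> (z \<oplus> y)" by (rule a_assoc)
  then show ?case using add addspan.add[of x S "z \<oplus> y" G] by simp
qed

lemma addspan_image:
  assumes S: "S \<subseteq> carrier G" and S': "S' \<subseteq> carrier G" and x: "x \<in> addspan G S"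
    and zero: "f \<zero> = \<zero>"
    and add: "\<And>x y. \<lbrakk>x \<in> carrier G; y \<in> carrier G\<rbrakk> \<Longrightarrow> f (x \<oplus> y) = f x \<oplus> f y"
    and f: "\<And>x. x \<in> S \<Longrightarrow> f x \<in> addspan G S'"
  shows "f x \<in> addspan G S'"
  using x
proof induction
  case zero
  then show ?case using addspan.zero assms(4) by metis
next
  case (add x y)
  then show ?case
    using f addspan_add[OF S', of "f x" "f y"] assms(5)[of x y] subsetD[OF S, of x]
      subsetD[OF addspan_closed[OF S], of y] by simp
qed

end


text \<open>Relabelling letters by the bijection \<open>\<phi>\<close> is written as composition of
  the coefficient function with the inverse \<open>\<psi>\<close>. This involves no sums over fibres
  and commutes with cutting words because \<open>map\<close> does. The default zero outside
  \<open>lists X\<close> keeps the support there.\<close>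

lemma (in cring) free_module_pullback_hom:
  fixes \<phi> \<psi> :: "'x \<Rightarrow> 'x"
  assumes \<phi>: "\<And>x. x \<in> X \<Longrightarrow> \<phi> x \<in> X" and \<psi>: "\<And>x. x \<in> X \<Longrightarrow> \<psi> x \<in> X"
    and \<phi>\<psi>: "\<And>x. x \<in> X \<Longrightarrow> \<phi> (\<psi> x) = x" and \<psi>\<phi>: "\<And>x. x \<in> X \<Longrightarrow> \<psi> (\<phi> x) = x"
  defines "g \<equiv> \<lambda>a w. if w \<in> lists X then a (map \<psi> w) else \<zero>"
  shows "g \<in> ring_hom (free_algebra R X) (free_algebra R X)"
    and "\<And>x. x \<in> X \<Longrightarrow> g (single R [x]) = single R [\<phi> x]"
    and "\<And>c a. c \<in> carrier R \<Longrightarrow> a \<in> carrier (free_algebra R X) \<Longrightarrow>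
      g (c \<odot>\<^bsub>free_algebra R X\<^esub> a) = c \<odot>\<^bsub>free_algebra R X\<^esub> g a"
proof -
  have \<psi>_lists: "map \<psi> w \<in> lists X" if "w \<in> lists X" for w
    using that \<psi> by auto
  show "g \<in> ring_hom (free_algebra R X) (free_algebra R X)"
  proof (rule ring_hom_memI)
    fix a assume a: "a \<in> carrier (free_algebra R X)"
    have "{w. g a w \<noteq> \<zero>} \<subseteq> map \<phi> ` {w. a w \<noteq> \<zero>}"
    proof
      fix w assume "w \<in> {w. g a w \<noteq> \<zero>}"
      then have w: "w \<in> lists X" "a (map \<psi> w) \<noteq> \<zero>" by (auto simp: g_def split: if_splits)
      have "map \<phi> (map \<psi> w) = w" using w(1) \<phi>\<psi> by (induction w) auto
      then show "w \<in> map \<phi> ` {w. a w \<noteq> \<zero>}"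
        using w(2) by (intro image_eqI[of _ _ "map \<psi> w"]) simp_all
    qed
    moreover have "finite (map \<phi> ` {w. a w \<noteq> \<zero>})"
      using a by (simp add: free_module_carrier)
    ultimately have "finite {w. g a w \<noteq> \<zero>}"
      by (rule finite_subset)
    then show "g a \<in> carrier (free_algebra R X)"
      using a by (simp add: free_module_carrier g_def)
    fix b assume b: "b \<in> carrier (free_algebra R X)"
    show "g (a \<oplus>\<^bsub>free_algebra R X\<^esub> b) = g a \<oplus>\<^bsub>free_algebra R X\<^esub> g b"
      by (auto simp: g_def)
    show "g (a \<otimes>\<^bsub>free_algebra R X\<^esub> b) = g a \<otimes>\<^bsub>free_algebra R X\<^esub> g b"
    proof
      fix w
      show "g (a \<otimes>\<^bsub>free_algebra R X\<^esub> b) w = (g a \<otimes>\<^bsub>free_algebra R X\<^esub> g b) w"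
      proof (cases "w \<in> lists X")
        case True
        then have "take k w \<in> lists X" "drop k w \<in> lists X" for k
          by (auto dest: in_set_takeD in_set_dropD)
        with True show ?thesis
          by (simp add: g_def take_map drop_map)
      next
        case False
        have "g a (take k w) \<otimes> g b (drop k w) = \<zero>" for k
        proof -
          have "take k w \<notin> lists X \<or> drop k w \<notin> lists X"
            using False append_in_lists_conv[of "take k w" "drop k w" X] by (simp only: append_take_drop_id) blast
          then show ?thesis
            using free_module_app[of a R "lists X"] free_module_app[of b R "lists X"] a b
            by (auto simp: g_def)
        qed
        then have "(g a \<otimes>\<^bsub>free_algebra R X\<^esub> g b) w = \<zero>"
          by simp
        then show ?thesis using False by (simp add: g_def)
      qed
    qed
  next
    show "g \<one>\<^bsub>free_algebra R X\<^esub> = \<one>\<^bsub>free_algebra R X\<^esub>"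
      by (auto simp: g_def single_def)
  qed
  fix x assume x: "x \<in> X"
  show "g (single R [x]) = single R [\<phi> x]"
  proof
    fix w
    show "g (single R [x]) w = single R [\<phi> x] w"
      using x \<phi> \<phi>\<psi> \<psi>\<phi> by (auto simp: g_def single_def map_eq_Cons_conv)
  qed
next
  fix c a assume "c \<in> carrier R" "a \<in> carrier (free_algebra R X)"
  then show "g (c \<odot>\<^bsub>free_algebra R X\<^esub> a) = c \<odot>\<^bsub>free_algebra R X\<^esub> g a"
    by (auto simp: g_def)
qed


text \<open>\<open>Z\<close> are the scalars, \<open>H i\<close> the letters of weight \<open>i\<close>; \<open>k\<close> counts the letters and \<open>r\<close> is the total
  weight.  The zero element may have several weights.\<close>

inductive monomial :: "('a, 'd) ring_scheme \<Rightarrow> 'a set \<Rightarrow> (int \<Rightarrow> 'a set) \<Rightarrow> nat \<Rightarrow> int \<Rightarrow> 'a \<Rightarrow> bool"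
  for A Z H where
  scalar: "z \<in> Z \<Longrightarrow> monomial A Z H 0 0 z"
| letter: "\<lbrakk>x \<in> H i; monomial A Z H k r y\<rbrakk> \<Longrightarrow> monomial A Z H (Suc k) (i + r) (x \<otimes>\<^bsub>A\<^esub> y)"

text \<open>One nonzero coordinate is split off at a time, by induction on the finite set of nonzero
  coordinates. A general letter thereby becomes a finite sum of homogeneous ones.\<close>

lemma direct_sum_induct [consumes 1, case_names group zero add]:
  assumes m: "m \<in> carrier (direct_sum I E)"
    and E: "\<And>i. i \<in> I \<Longrightarrow> abelian_group (E i)"
    and zero: "P \<zero>\<^bsub>direct_sum I E\<^esub>"
    and add: "\<And>i v m'. \<lbrakk>i \<in> I; v \<in> homogeneous I E i; m' \<in> carrier (direct_sum I E); P m'\<rbrakk>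
      \<Longrightarrow> P (v \<oplus>\<^bsub>direct_sum I E\<^esub> m')"
  shows "P m"
proof -
  have "P m" if "finite S" "m \<in> carrier (direct_sum I E)" "{i \<in> I. m i \<noteq> \<zero>\<^bsub>E i\<^esub>} = S" for S m
    using that
  proof (induction S arbitrary: m)
    case empty
    then have "m = \<zero>\<^bsub>direct_sum I E\<^esub>"
      by (auto simp: direct_sum_def PiE_iff extensional_def fun_eq_iff)
    then show ?case using zero by simp
  next
    case (insert i S)
    define v where "v = (\<lambda>j\<in>I. if j = i then m j else \<zero>\<^bsub>E j\<^esub>)"
    define m' where "m' = (\<lambda>j\<in>I. if j = i then \<zero>\<^bsub>E j\<^esub> else m j)"
    have i: "i \<in> I" using insert by auto
    have mi: "m j \<in> carrier (E j)" if "j \<in> I" for j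
      using insert.prems(1) that by (auto simp: direct_sum_def)
    have z: "\<zero>\<^bsub>E j\<^esub> \<in> carrier (E j)" if "j \<in> I" for j
      using abelian_groupE(2)[OF E[OF that]] .
    have "{j \<in> I. v j \<noteq> \<zero>\<^bsub>E j\<^esub>} \<subseteq> {i}" by (auto simp: v_def)
    then have "finite {j \<in> I. v j \<noteq> \<zero>\<^bsub>E j\<^esub>}" by (rule finite_subset) simp
    then have v: "v \<in> homogeneous I E i"
      using mi z by (auto simp: homogeneous_def direct_sum_def v_def)
    have supp: "{j \<in> I. m' j \<noteq> \<zero>\<^bsub>E j\<^esub>} = S"
    proof (intro equalityI subsetI)
      fix j assume "j \<in> {j \<in> I. m' j \<noteq> \<zero>\<^bsub>E j\<^esub>}"
      then have "j \<in> {i \<in> I. m i \<noteq> \<zero>\<^bsub>E i\<^esub>}" "j \<noteq> i" by (auto simp: m'_def split: if_splits)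
      then show "j \<in> S" using insert.prems(2) by simp
    next
      fix j assume "j \<in> S"
      then have "j \<noteq> i" "j \<in> {i \<in> I. m i \<noteq> \<zero>\<^bsub>E i\<^esub>}" using insert by auto
      then show "j \<in> {j \<in> I. m' j \<noteq> \<zero>\<^bsub>E j\<^esub>}" by (simp add: m'_def)
    qed
    then have "finite {j \<in> I. m' j \<noteq> \<zero>\<^bsub>E j\<^esub>}" using insert.hyps(1) by simp
    then have m': "m' \<in> carrier (direct_sum I E)"
      using mi z by (auto simp: direct_sum_def m'_def)
    have "m j = (v \<oplus>\<^bsub>direct_sum I E\<^esub> m') j" for j
    proof (cases "j \<in> I")
      case True
      interpret abelian_group "E j" by (rule E) fact
      show ?thesis using True r_zero[OF mi[OF True]] l_zero[OF mi[OF True]]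
        by (cases "j = i") (simp_all add: direct_sum_def v_def m'_def)
    next
      case False
      then show ?thesis using insert.prems(1) by (auto simp: direct_sum_def PiE_iff extensional_def)
    qed
    then have "m = v \<oplus>\<^bsub>direct_sum I E\<^esub> m'" ..
    then show ?case
      using add[OF i v m' insert.IH[OF m' supp]] by simp
  qed
  from this[OF _ m refl] show ?thesis using m by (simp add: direct_sum_def)
qed


locale super_symmetric =
  fixes C :: "('c, 'd) ring_scheme" and I :: "int set" and E :: "int \<Rightarrow> ('c, 'e) module"
  assumes cring_C: "cring C" and module_E: "\<And>i. i \<in> I \<Longrightarrow> module C (E i)"
begin

abbreviation "M \<equiv> direct_sum I E"
abbreviation "L \<equiv> free_algebra C (carrier M)"
abbreviation "KT \<equiv> tensor_kernel_alg C M"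
abbreviation "T \<equiv> tensor_algebra C M"
abbreviation "KS \<equiv> supercomm_kernel C I E"
abbreviation "A \<equiv> super_sym C I E"

definition q :: "((int \<Rightarrow> 'e) list \<Rightarrow> 'c) \<Rightarrow> ((int \<Rightarrow> 'e) list \<Rightarrow> 'c) set set" where
  "q a = KS +>\<^bsub>T\<^esub> (KT +>\<^bsub>L\<^esub> a)"

definition \<iota> :: "(int \<Rightarrow> 'e) \<Rightarrow> ((int \<Rightarrow> 'e) list \<Rightarrow> 'c) set set" where
  "\<iota> m = q (single C [m])"

sublocale M: module C M
  by (intro direct_sum_module cring_C module_E)

lemma L_algebra: "assoc_algebra C L"
  by (rule M.free_algebra)

lemma single_closed: "w \<in> lists (carrier M) \<Longrightarrow> single C w \<in> carrier L"
  by (simp add: M.single_in_free_module)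

lemma linear_rels_closed: "linear_rels C M \<subseteq> carrier L"
proof -
  interpret L: assoc_algebra C L by (rule L_algebra)
  show ?thesis
    unfolding linear_rels_def Let_def
    by (intro Un_least subsetI; elim CollectE exE conjE; hypsubst;
        intro L.M.minus_closed L.M.a_closed L.smult_closed single_closed; simp)
qed

lemma KT_ideal: "ideal KT L"
  unfolding tensor_kernel_alg_def
  by (intro ring.genideal_ideal assoc_algebra.ring_M[OF L_algebra] linear_rels_closed)

lemma T_algebra: "assoc_algebra C T"
  unfolding tensor_algebra_def by (intro quot_algebra L_algebra KT_ideal)

lemma KT_hom: "(\<lambda>a. KT +>\<^bsub>L\<^esub> a) \<in> ring_hom L T"
  unfolding tensor_algebra_def by (intro quot_ring_hom KT_ideal)

lemma letter_closed: "m \<in> carrier M \<Longrightarrow> letter C M m \<in> carrier T"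
  unfolding letter_def by (intro ring_hom_closed[OF KT_hom] single_closed) simp

lemma homogeneous_closed: "v \<in> homogeneous I E i \<Longrightarrow> v \<in> carrier M"
  by (simp add: homogeneous_def)

lemma koszul_closed: "ring B \<Longrightarrow> x \<in> carrier B \<Longrightarrow> koszul B i j x \<in> carrier B"
  by (simp add: koszul_def ring.is_abelian_group abelian_group.a_inv_closed)

lemma supercomm_rels_closed: "supercomm_rels C I E \<subseteq> carrier T"
proof -
  interpret T: assoc_algebra C T by (rule T_algebra)
  show ?thesis
    unfolding supercomm_rels_def Let_def
    by (intro subsetI; elim CollectE exE conjE; hypsubst;
        intro T.M.minus_closed T.A.m_closed koszul_closed T.ring_M letter_closed homogeneous_closed)
qed

lemma KS_ideal: "ideal KS T"
  unfolding supercomm_kernel_def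
  by (intro ring.genideal_ideal assoc_algebra.ring_M[OF T_algebra] supercomm_rels_closed)

lemma A_algebra: "assoc_algebra C A"
  unfolding super_sym_def by (intro quot_algebra T_algebra KS_ideal)

lemma KS_hom: "(\<lambda>a. KS +>\<^bsub>T\<^esub> a) \<in> ring_hom T A"
  unfolding super_sym_def by (intro quot_ring_hom KS_ideal)

sublocale A: assoc_algebra C A
  by (rule A_algebra)

lemma q_hom: "q \<in> ring_hom L A"
  using ring_hom_trans[OF KT_hom KS_hom] by (simp add: q_def[abs_def] comp_def)

lemma q_carrier: "carrier A = q ` carrier L"
  by (auto simp: q_def super_sym_def tensor_algebra_def)

lemma q_smult:
  assumes "c \<in> carrier C" "a \<in> carrier L"
  shows "q (c \<odot>\<^bsub>L\<^esub> a) = c \<odot>\<^bsub>A\<^esub> q a"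
proof -
  interpret L: assoc_algebra C L by (rule L_algebra)
  interpret T: assoc_algebra C T by (rule T_algebra)
  have "c \<odot>\<^bsub>T\<^esub> (KT +>\<^bsub>L\<^esub> a) = KT +>\<^bsub>L\<^esub> (c \<odot>\<^bsub>L\<^esub> a)"
    unfolding tensor_algebra_def
    by (intro quot_smult[OF L.module L.ideal_submodule[OF KT_ideal]] assms)
  moreover have "c \<odot>\<^bsub>A\<^esub> (KS +>\<^bsub>T\<^esub> (KT +>\<^bsub>L\<^esub> a)) = KS +>\<^bsub>T\<^esub> (c \<odot>\<^bsub>T\<^esub> (KT +>\<^bsub>L\<^esub> a))"
    unfolding super_sym_def
    by (intro quot_smult[OF T.module T.ideal_submodule[OF KS_ideal]] assms ring_hom_closed[OF KT_hom])
  ultimately show ?thesis by (simp only: q_def)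
qed

lemma q_zero: "q \<zero>\<^bsub>L\<^esub> = \<zero>\<^bsub>A\<^esub>"
  by (intro ring_hom_zero[OF q_hom] assoc_algebra.ring_M[OF L_algebra] A.ring_M)

lemma \<iota>_closed [simp]: "m \<in> carrier M \<Longrightarrow> \<iota> m \<in> carrier A"
  unfolding \<iota>_def by (intro ring_hom_closed[OF q_hom] single_closed) simp

lemma KT_eqI:
  assumes "a \<in> carrier L" "b \<in> carrier L" "a \<ominus>\<^bsub>L\<^esub> b \<in> linear_rels C M"
  shows "q a = q b"
proof -
  interpret KT: ideal KT L by (rule KT_ideal)
  have "a \<ominus>\<^bsub>L\<^esub> b \<in> KT"
    unfolding tensor_kernel_alg_def
    using ring.genideal_self[OF assoc_algebra.ring_M[OF L_algebra] linear_rels_closed] assms(3) by (rule subsetD)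
  then have "KT +>\<^bsub>L\<^esub> a = KT +>\<^bsub>L\<^esub> b"
    using KT.rcos_eq_iff[OF assms(1,2)] by simp
  then show ?thesis
    by (simp only: q_def)
qed

lemma \<iota>_add:
  assumes "m \<in> carrier M" "m' \<in> carrier M"
  shows "\<iota> (m \<oplus>\<^bsub>M\<^esub> m') = \<iota> m \<oplus>\<^bsub>A\<^esub> \<iota> m'"
proof -
  interpret L: assoc_algebra C L by (rule L_algebra)
  have s: "single C [m \<oplus>\<^bsub>M\<^esub> m'] \<in> carrier L" "single C [m] \<in> carrier L" "single C [m'] \<in> carrier L"
    using assms by (intro single_closed; simp)+
  have "q (single C [m \<oplus>\<^bsub>M\<^esub> m']) = q (single C [m] \<oplus>\<^bsub>L\<^esub> single C [m'])"
  proof (rule KT_eqI)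
    show "single C [m \<oplus>\<^bsub>M\<^esub> m'] \<ominus>\<^bsub>L\<^esub> (single C [m] \<oplus>\<^bsub>L\<^esub> single C [m']) \<in> linear_rels C M"
      unfolding linear_rels_def Let_def using assms by blast
  qed (intro s L.M.a_closed)+
  then show ?thesis
    using ring_hom_add[OF q_hom s(2,3)] by (simp only: \<iota>_def)
qed

lemma \<iota>_smult:
  assumes "c \<in> carrier C" "m \<in> carrier M"
  shows "\<iota> (c \<odot>\<^bsub>M\<^esub> m) = c \<odot>\<^bsub>A\<^esub> \<iota> m"
proof -
  interpret L: assoc_algebra C L by (rule L_algebra)
  have s: "single C [c \<odot>\<^bsub>M\<^esub> m] \<in> carrier L" "single C [m] \<in> carrier L"
    using assms by (intro single_closed; simp)+
  have "q (single C [c \<odot>\<^bsub>M\<^esub> m]) = q (c \<odot>\<^bsub>L\<^esub> single C [m])"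
  proof (rule KT_eqI)
    show "single C [c \<odot>\<^bsub>M\<^esub> m] \<ominus>\<^bsub>L\<^esub> (c \<odot>\<^bsub>L\<^esub> single C [m]) \<in> linear_rels C M"
      unfolding linear_rels_def Let_def using assms by blast
  qed (intro s L.smult_closed assms)+
  then show ?thesis
    using q_smult[OF assms(1) s(2)] by (simp only: \<iota>_def)
qed

lemma \<iota>_zero: "\<iota> \<zero>\<^bsub>M\<^esub> = \<zero>\<^bsub>A\<^esub>"
  using \<iota>_smult[of "\<zero>\<^bsub>C\<^esub>" "\<zero>\<^bsub>M\<^esub>"] by simp

lemma \<iota>_letter: "\<iota> m = KS +>\<^bsub>T\<^esub> letter C M m"
  by (simp add: \<iota>_def q_def letter_def)

lemma hom_koszul:
  assumes "ring B" "ring B'" "h \<in> ring_hom B B'" "x \<in> carrier B"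
  shows "h (koszul B i j x) = koszul B' i j (h x)"
proof -
  interpret ring_hom_ring B B' h using assms by (intro ring_hom_ringI2)
  show ?thesis using assms by (simp add: koszul_def)
qed

lemma \<iota>_supercomm:
  assumes "i \<in> I" "j \<in> I" "v \<in> homogeneous I E i" "w \<in> homogeneous I E j"
  shows "\<iota> v \<otimes>\<^bsub>A\<^esub> \<iota> w = koszul A i j (\<iota> w \<otimes>\<^bsub>A\<^esub> \<iota> v)"
proof -
  interpret T: assoc_algebra C T by (rule T_algebra)
  interpret KS: ideal KS T by (rule KS_ideal)
  have l: "letter C M v \<in> carrier T" "letter C M w \<in> carrier T"
    using letter_closed[OF homogeneous_closed] assms by simp_all
  have k: "koszul T i j (letter C M w \<otimes>\<^bsub>T\<^esub> letter C M v) \<in> carrier T"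
    using l by (intro koszul_closed T.ring_M) simp
  have "letter C M v \<otimes>\<^bsub>T\<^esub> letter C M w \<ominus>\<^bsub>T\<^esub> koszul T i j (letter C M w \<otimes>\<^bsub>T\<^esub> letter C M v)
      \<in> supercomm_rels C I E"
    unfolding supercomm_rels_def Let_def using assms by blast
  then have "letter C M v \<otimes>\<^bsub>T\<^esub> letter C M w \<ominus>\<^bsub>T\<^esub> koszul T i j (letter C M w \<otimes>\<^bsub>T\<^esub> letter C M v) \<in> KS"
    unfolding supercomm_kernel_def
    by (rule subsetD[OF ring.genideal_self[OF T.ring_M supercomm_rels_closed]])
  then have "KS +>\<^bsub>T\<^esub> (letter C M v \<otimes>\<^bsub>T\<^esub> letter C M w) =
      KS +>\<^bsub>T\<^esub> koszul T i j (letter C M w \<otimes>\<^bsub>T\<^esub> letter C M v)"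
    using KS.rcos_eq_iff[OF T.A.m_closed[OF l] k] by simp
  then show ?thesis
    using ring_hom_mult[OF KS_hom l] ring_hom_mult[OF KS_hom l(2) l(1)]
      hom_koszul[OF T.ring_M A.ring_M KS_hom T.A.m_closed[OF l(2,1)], of i j]
    by (simp only: \<iota>_letter)
qed

lemma q_single_Nil: "q (single C []) = \<one>\<^bsub>A\<^esub>"
  using ring_hom_one[OF q_hom] by simp

lemma q_single_Cons:
  assumes "m \<in> carrier M" "w \<in> lists (carrier M)"
  shows "q (single C (m # w)) = \<iota> m \<otimes>\<^bsub>A\<^esub> q (single C w)"
proof -
  have "single C (m # w) = single C [m] \<otimes>\<^bsub>L\<^esub> single C w"
    by (simp only: M.single_append append_Cons append_Nil)
  moreover have "single C [m] \<in> carrier L" "single C w \<in> carrier L"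
    using assms by (intro single_closed; simp)+
  ultimately show ?thesis
    using ring_hom_mult[OF q_hom] by (simp only: \<iota>_def)
qed

text \<open>A \<open>C\<close>-linear map of the letters that preserves each weight space sends the
  defining relations to zero and so descends through both quotients. An inverse
  \<open>\<psi>\<close> is part of the data because the map on the free algebra is a pullback along
  it.\<close>

lemma functorial:
  assumes \<phi>: "\<And>m. m \<in> carrier M \<Longrightarrow> \<phi> m \<in> carrier M" and \<psi>: "\<And>m. m \<in> carrier M \<Longrightarrow> \<psi> m \<in> carrier M"
    and \<phi>\<psi>: "\<And>m. m \<in> carrier M \<Longrightarrow> \<phi> (\<psi> m) = m" and \<psi>\<phi>: "\<And>m. m \<in> carrier M \<Longrightarrow> \<psi> (\<phi> m) = m"
    and \<phi>_add: "\<And>m m'. \<lbrakk>m \<in> carrier M; m' \<in> carrier M\<rbrakk> \<Longrightarrow> \<phi> (m \<oplus>\<^bsub>M\<^esub> m') = \<phi> m \<oplus>\<^bsub>M\<^esub> \<phi> m'"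
    and \<phi>_smult: "\<And>c m. \<lbrakk>c \<in> carrier C; m \<in> carrier M\<rbrakk> \<Longrightarrow> \<phi> (c \<odot>\<^bsub>M\<^esub> m) = c \<odot>\<^bsub>M\<^esub> \<phi> m"
    and \<phi>_hom: "\<And>i v. \<lbrakk>i \<in> I; v \<in> homogeneous I E i\<rbrakk> \<Longrightarrow> \<phi> v \<in> homogeneous I E i"
  obtains h where "h \<in> ring_hom A A"
    and "\<And>c. c \<in> carrier C \<Longrightarrow> h (c \<odot>\<^bsub>A\<^esub> \<one>\<^bsub>A\<^esub>) = c \<odot>\<^bsub>A\<^esub> \<one>\<^bsub>A\<^esub>"
    and "\<And>m. m \<in> carrier M \<Longrightarrow> h (\<iota> m) = \<iota> (\<phi> m)"
proof -
  interpret L: assoc_algebra C L by (rule L_algebra)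
  interpret T: assoc_algebra C T by (rule T_algebra)
  define g0 where "g0 = (\<lambda>a w. if w \<in> lists (carrier M) then a (map \<psi> w) else \<zero>\<^bsub>C\<^esub>)"
  have g0: "g0 \<in> ring_hom L L" "\<And>m. m \<in> carrier M \<Longrightarrow> g0 (single C [m]) = single C [\<phi> m]"
    "\<And>c a. \<lbrakk>c \<in> carrier C; a \<in> carrier L\<rbrakk> \<Longrightarrow> g0 (c \<odot>\<^bsub>L\<^esub> a) = c \<odot>\<^bsub>L\<^esub> g0 a"
    unfolding g0_def using M.free_module_pullback_hom[of "carrier M" \<phi> \<psi>] \<phi> \<psi> \<phi>\<psi> \<psi>\<phi> by blast+
  define g where "g a = q (g0 a)" for a
  have g_hom: "g \<in> ring_hom L A"
    using ring_hom_trans[OF g0(1) q_hom] by (simp add: g_def[abs_def] comp_def)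
  have g_single: "g (single C [m]) = \<iota> (\<phi> m)" if "m \<in> carrier M" for m
    using that g0(2) by (simp only: g_def \<iota>_def)
  have g_smult: "g (c \<odot>\<^bsub>L\<^esub> a) = c \<odot>\<^bsub>A\<^esub> g a" if "c \<in> carrier C" "a \<in> carrier L" for c a
    using that g0(3)[OF that] ring_hom_closed[OF g0(1) that(2)] by (simp only: g_def q_smult)
  interpret g: ring_hom_ring L A g
    by (intro ring_hom_ringI2 L.ring_M A.ring_M g_hom)
  have sc: "single C [m] \<in> carrier L" if "m \<in> carrier M" for m
    using that by (intro single_closed) simp
  \<comment> \<open>Linear relations die because \<open>\<phi>\<close> is linear and
    \<open>\<iota>\<close> satisfies the same relations.\<close>
  have "g s = \<zero>\<^bsub>A\<^esub>" if "s \<in> linear_rels C M" for s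
    using that[unfolded linear_rels_def Let_def]
  proof (elim UnE CollectE exE conjE)
    fix m m' assume s: "s = single C [m \<oplus>\<^bsub>M\<^esub> m'] \<ominus>\<^bsub>L\<^esub> (single C [m] \<oplus>\<^bsub>L\<^esub> single C [m'])"
      and m: "m \<in> carrier M" "m' \<in> carrier M"
    have "g s = \<iota> (\<phi> (m \<oplus>\<^bsub>M\<^esub> m')) \<ominus>\<^bsub>A\<^esub> (\<iota> (\<phi> m) \<oplus>\<^bsub>A\<^esub> \<iota> (\<phi> m'))"
      unfolding s a_minus_def using m
      by (simp only: g.hom_add g.hom_a_inv g_single sc L.M.a_closed L.M.a_inv_closed M.M.a_closed)
    then show ?thesis
      using m \<phi> \<phi>_add \<iota>_add by (simp add: A.M.r_neg a_minus_def)
  next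
    fix c m assume s: "s = single C [c \<odot>\<^bsub>M\<^esub> m] \<ominus>\<^bsub>L\<^esub> (c \<odot>\<^bsub>L\<^esub> single C [m])"
      and m: "c \<in> carrier C" "m \<in> carrier M"
    have "g s = \<iota> (\<phi> (c \<odot>\<^bsub>M\<^esub> m)) \<ominus>\<^bsub>A\<^esub> (c \<odot>\<^bsub>A\<^esub> \<iota> (\<phi> m))"
      unfolding s a_minus_def using m
      by (simp only: g.hom_add g.hom_a_inv g_single g_smult sc L.smult_closed L.M.a_inv_closed M.smult_closed)
    then show ?thesis
      using m \<phi> \<phi>_smult \<iota>_smult by (simp add: A.M.r_neg a_minus_def)
  qed
  then obtain h1 where h1: "h1 \<in> ring_hom T A"
    and h1_eq: "\<And>x. x \<in> carrier L \<Longrightarrow> h1 (KT +>\<^bsub>L\<^esub> x) = g x"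
    using quot_lift[OF L.ring_M A.ring_M g_hom linear_rels_closed]
    unfolding tensor_algebra_def tensor_kernel_alg_def by metis
  interpret h1: ring_hom_ring T A h1
    by (intro ring_hom_ringI2 T.ring_M A.ring_M h1)
  have h1_letter: "h1 (letter C M m) = \<iota> (\<phi> m)" if "m \<in> carrier M" for m
    using that h1_eq[OF sc[OF that]] g_single by (simp only: letter_def)
  \<comment> \<open>Exchange relations die because \<open>\<phi>\<close> keeps the weights of
    \<open>v\<close> and \<open>w\<close>, hence also the sign.\<close>
  have "h1 s = \<zero>\<^bsub>A\<^esub>" if "s \<in> supercomm_rels C I E" for s
    using that[unfolded supercomm_rels_def Let_def]
  proof (elim UnE CollectE exE conjE)
    fix v w i j
    assume s: "s = letter C M v \<otimes>\<^bsub>T\<^esub> letter C M w \<ominus>\<^bsub>T\<^esub> koszul T i j (letter C M w \<otimes>\<^bsub>T\<^esub> letter C M v)"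
      and ij: "i \<in> I" "j \<in> I" and vw: "v \<in> homogeneous I E i" "w \<in> homogeneous I E j"
    have c: "v \<in> carrier M" "w \<in> carrier M" using vw by (simp_all add: homogeneous_closed)
    have "h1 s = \<iota> (\<phi> v) \<otimes>\<^bsub>A\<^esub> \<iota> (\<phi> w) \<ominus>\<^bsub>A\<^esub> koszul A i j (\<iota> (\<phi> w) \<otimes>\<^bsub>A\<^esub> \<iota> (\<phi> v))"
      unfolding s a_minus_def using c
      by (simp only: h1.hom_add h1.hom_a_inv h1.hom_mult h1_letter T.M.a_inv_closed T.A.m_closed
          letter_closed hom_koszul[OF T.ring_M A.ring_M h1] koszul_closed[OF T.ring_M])
    also have "\<dots> = \<zero>\<^bsub>A\<^esub>"
      using \<iota>_supercomm[OF ij \<phi>_hom[OF ij(1) vw(1)] \<phi>_hom[OF ij(2) vw(2)]] c \<phi>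
      by (simp add: A.M.r_neg a_minus_def koszul_closed[OF A.ring_M])
    finally show ?thesis .
  qed
  then obtain h where h: "h \<in> ring_hom A A"
    and h_eq: "\<And>x. x \<in> carrier T \<Longrightarrow> h (KS +>\<^bsub>T\<^esub> x) = h1 x"
    using quot_lift[OF T.ring_M A.ring_M h1 supercomm_rels_closed]
    unfolding super_sym_def supercomm_kernel_def by metis
  have h_q: "h (q a) = g a" if "a \<in> carrier L" for a
    using h_eq[OF ring_hom_closed[OF KT_hom that]] h1_eq[OF that] by (simp only: q_def)
  show thesis
  proof (rule that[OF h])
    fix c assume c: "c \<in> carrier C"
    have "g \<one>\<^bsub>L\<^esub> = \<one>\<^bsub>A\<^esub>" using ring_hom_one[OF g_hom] .
    then show "h (c \<odot>\<^bsub>A\<^esub> \<one>\<^bsub>A\<^esub>) = c \<odot>\<^bsub>A\<^esub> \<one>\<^bsub>A\<^esub>"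
      using h_q[of "c \<odot>\<^bsub>L\<^esub> \<one>\<^bsub>L\<^esub>"] c q_smult[OF c L.A.one_closed] g_smult[OF c L.A.one_closed]
        ring_hom_one[OF q_hom] L.smult_closed[OF c L.A.one_closed]
      by (simp only:)
  next
    fix m assume "m \<in> carrier M"
    then show "h (\<iota> m) = \<iota> (\<phi> m)"
      using h_q[OF sc] g_single by (simp only: \<iota>_def)
  qed
qed

section \<open>Words in homogeneous letters\<close>

abbreviation "scalars \<equiv> (\<lambda>c. c \<odot>\<^bsub>A\<^esub> \<one>\<^bsub>A\<^esub>) ` carrier C"

text \<open>For \<open>i\<close> outside \<open>I\<close> the set \<open>homogeneous I E i\<close>
  still contains zero. The guard keeps it from counting as a letter, in particular as one of weight
  0.\<close>

abbreviation "letters i \<equiv> (if i \<in> I then \<iota> ` homogeneous I E i else {})"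

abbreviation "word_weights \<equiv> list_all2 (\<lambda>v i. i \<in> I \<and> v \<in> homogeneous I E i)"

lemma word_weights_closed: "word_weights w ks \<Longrightarrow> w \<in> lists (carrier M)"
  by (induction rule: list_all2_induct) (auto simp: homogeneous_closed)

lemma q_single_closed [simp]: "w \<in> lists (carrier M) \<Longrightarrow> q (single C w) \<in> carrier A"
  by (intro ring_hom_closed[OF q_hom] single_closed)

text \<open>In a \<open>monomial\<close> the scalar stands at the right end, whereas here it
  multiplies the whole word; \<open>C\<close>-bilinearity of the product moves it across each
  letter.\<close>

lemma monomial_word:
  assumes c: "c \<in> carrier C" and w: "word_weights w ks"
  shows "monomial A scalars letters (length w) (sum_list ks) (c \<odot>\<^bsub>A\<^esub> q (single C w))"
  using w
proof (induction rule: list_all2_induct)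
  case Nil
  show ?case using c monomial.scalar[of "c \<odot>\<^bsub>A\<^esub> \<one>\<^bsub>A\<^esub>" scalars A letters] by (simp add: q_single_Nil)
next
  case (Cons v w i ks)
  then have v: "v \<in> carrier M" and w: "w \<in> lists (carrier M)"
    using homogeneous_closed[of v i] by (simp_all add: word_weights_closed)
  then have "c \<odot>\<^bsub>A\<^esub> q (single C (v # w)) = \<iota> v \<otimes>\<^bsub>A\<^esub> (c \<odot>\<^bsub>A\<^esub> q (single C w))"
    using c by (simp add: q_single_Cons A.smult_mult_r)
  moreover have "\<iota> v \<in> letters i"
    using Cons by simp
  ultimately show ?case
    using monomial.letter[of "\<iota> v" letters i A scalars] Cons.IH by simp
qed

lemma monomial_wordE:
  assumes "monomial A scalars letters k r x"
  obtains c w ks where "c \<in> carrier C" "word_weights w ks" "sum_list ks = r"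
    "x = c \<odot>\<^bsub>A\<^esub> q (single C w)"
proof -
  from assms have "\<exists>c w ks. c \<in> carrier C \<and> word_weights w ks \<and> sum_list ks = r \<and>
      x = c \<odot>\<^bsub>A\<^esub> q (single C w)"
  proof induction
    case (scalar z)
    then obtain c where "c \<in> carrier C" "z = c \<odot>\<^bsub>A\<^esub> q (single C [])" by (auto simp: q_single_Nil)
    then show ?case by (intro exI[of _ c] exI[of _ "[]"]) simp
  next
    case (letter x i k r y)
    then obtain c w ks v where c: "c \<in> carrier C" and w: "word_weights w ks" "sum_list ks = r"
      and y: "y = c \<odot>\<^bsub>A\<^esub> q (single C w)" and v: "i \<in> I" "v \<in> homogeneous I E i" "x = \<iota> v"
      by (auto split: if_splits)
    have "x \<otimes>\<^bsub>A\<^esub> y = c \<odot>\<^bsub>A\<^esub> q (single C (v # w))"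
      using c v word_weights_closed[OF w(1)] homogeneous_closed[OF v(2)]
      by (simp add: q_single_Cons A.smult_mult_r y)
    with c w v show ?case
      by (intro exI[of _ c] exI[of _ "v # w"] exI[of _ "i # ks"]) simp
  qed
  then show thesis using that by blast
qed

lemma monomial_closed: "monomial A scalars letters k r x \<Longrightarrow> x \<in> carrier A"
  by (elim monomial_wordE) (simp add: word_weights_closed)

lemma q_smult_single_add:
  assumes "c \<in> carrier C" "w \<in> lists (carrier M)" "b \<in> carrier L"
  shows "q (\<lambda>y. c \<otimes>\<^bsub>C\<^esub> single C w y \<oplus>\<^bsub>C\<^esub> b y) = c \<odot>\<^bsub>A\<^esub> q (single C w) \<oplus>\<^bsub>A\<^esub> q b"
proof -
  interpret L: assoc_algebra C L by (rule L_algebra)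
  have "q (c \<odot>\<^bsub>L\<^esub> single C w \<oplus>\<^bsub>L\<^esub> b) = c \<odot>\<^bsub>A\<^esub> q (single C w) \<oplus>\<^bsub>A\<^esub> q b"
    using ring_hom_add[OF q_hom L.smult_closed[OF assms(1) single_closed[OF assms(2)]] assms(3)]
      q_smult[OF assms(1) single_closed[OF assms(2)]] by (simp only:)
  then show ?thesis by simp
qed

text \<open>This trades the defining description of a component, by representatives supported on
  words of weight \<open>r\<close>, for an inductive one that works inside the algebra
  itself.\<close>

lemma component_eq:
  "super_sym_component C I E r = addspan A {x. \<exists>k. monomial A scalars letters k r x}"
    (is "_ = addspan A ?S")
proof -
  have comp: "super_sym_component C I E r = q ` {a \<in> carrier L. \<forall>w. a w \<noteq> \<zero>\<^bsub>C\<^esub> \<longrightarrow> has_weight I E r w}"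
    by (simp add: super_sym_component_def q_def Let_def)
  have "q a \<in> addspan A ?S" if a: "a \<in> carrier L" "\<And>w. a w \<noteq> \<zero>\<^bsub>C\<^esub> \<Longrightarrow> has_weight I E r w" for a
    using a(1) unfolding free_algebra_simps
  proof (induction rule: M.free_module_induct)
    case zero
    then show ?case using q_zero addspan.zero[of A] by simp
  next
    case (add c w b)
    show ?case
    proof (cases "c = \<zero>\<^bsub>C\<^esub>")
      \<comment> \<open>A zero coefficient says nothing about the weight of \<open>w\<close>, so
        this case is separate.\<close>
      case True
      then have "(\<lambda>y. c \<otimes>\<^bsub>C\<^esub> single C w y \<oplus>\<^bsub>C\<^esub> b y) = b"
        using free_module_app[OF add(3)] by (simp add: M.single_closed)
      then show ?thesis using add by simp
    next
      case False
      then have "a w \<noteq> \<zero>\<^bsub>C\<^esub>"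
        using add.hyps(1,4) by (intro add.hyps(5)) (simp add: single_def)
      then obtain ks where "word_weights w ks" "sum_list ks = r"
        using a(2) by (auto simp: has_weight_def)
      then have "c \<odot>\<^bsub>A\<^esub> q (single C w) \<in> ?S"
        using monomial_word[OF add(1), of w ks] by auto
      then have "c \<odot>\<^bsub>A\<^esub> q (single C w) \<oplus>\<^bsub>A\<^esub> q b \<in> addspan A ?S"
        using add.IH by (rule addspan.add)
      then show ?thesis
        using q_smult_single_add[of c w b] add by simp
    qed
  qed
  moreover have "x \<in> super_sym_component C I E r" if "x \<in> addspan A ?S" for x
    using that
  proof induction
    case zero
    show ?case
      unfolding comp
    proof (rule image_eqI)
      show "\<zero>\<^bsub>A\<^esub> = q (\<lambda>x. \<zero>\<^bsub>C\<^esub>)" using q_zero by simp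
    qed (simp add: free_module_carrier)
  next
    case (add x y)
    then obtain b k where b: "b \<in> carrier L" "\<And>w. b w \<noteq> \<zero>\<^bsub>C\<^esub> \<Longrightarrow> has_weight I E r w" "y = q b"
      and x: "monomial A scalars letters k r x"
      by (auto simp: comp)
    from x obtain c w ks where c: "c \<in> carrier C" and w: "word_weights w ks" "sum_list ks = r"
      and x: "x = c \<odot>\<^bsub>A\<^esub> q (single C w)" by (rule monomial_wordE)
    have w': "w \<in> lists (carrier M)" using w(1) by (rule word_weights_closed)
    have "x \<oplus>\<^bsub>A\<^esub> y = q (\<lambda>y. c \<otimes>\<^bsub>C\<^esub> single C w y \<oplus>\<^bsub>C\<^esub> b y)"
      using q_smult_single_add[OF c w' b(1)] x b(3) by simp
    moreover have "(\<lambda>y. c \<otimes>\<^bsub>C\<^esub> single C w y \<oplus>\<^bsub>C\<^esub> b y) \<in> carrier L"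
      using M.free_module_add_closed[OF M.free_module_smult_closed[OF c], of "single C w" "lists (carrier M)" b]
        single_closed[OF w'] b(1) by simp
    moreover have "has_weight I E r u" if "c \<otimes>\<^bsub>C\<^esub> single C w u \<oplus>\<^bsub>C\<^esub> b u \<noteq> \<zero>\<^bsub>C\<^esub>" for u
    proof (cases "u = w")
      case True
      then show ?thesis using w by (auto simp: has_weight_def)
    next
      case False
      then show ?thesis
        using that c b(2)[of u] free_module_app[of b C "lists (carrier M)" u] b(1) by (auto simp: single_def)
    qed
    ultimately show ?case unfolding comp by auto
  qed
  ultimately show ?thesis by (auto simp: comp)
qed

text \<open>Letters of the tensor algebra are arbitrary elements of the direct sum. Each is replaced
  by the sum of its homogeneous parts, and the products are expanded.\<close>

lemma carrier_eq:
  "carrier A = addspan A {x. \<exists>k r. monomial A scalars letters k r x}" (is "_ = addspan A ?S")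
proof
  have S: "?S \<subseteq> carrier A" using monomial_closed by auto
  then show "addspan A ?S \<subseteq> carrier A" by (rule A.M.addspan_closed)
  have letter_mult: "\<iota> m \<otimes>\<^bsub>A\<^esub> y \<in> addspan A ?S" if m: "m \<in> carrier M" and y: "y \<in> addspan A ?S" for m y
  proof -
    have y': "y \<in> carrier A" using y A.M.addspan_closed[OF S] by auto
    from m show ?thesis
    proof (induction rule: direct_sum_induct)
      case (group i)
      then show ?case using module_E by (simp add: module_def)
    next
      case zero
      then show ?case using y' addspan.zero[of A] by (simp add: \<iota>_zero)
    next
      case (add i v m')
      have "v \<in> carrier M" using add by (simp add: homogeneous_closed)
      moreover have "\<iota> v \<otimes>\<^bsub>A\<^esub> y \<in> addspan A ?S"
        using S S y
      proof (rule A.M.addspan_image)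
        fix x assume "x \<in> ?S"
        then obtain k r where "monomial A scalars letters k r x" by auto
        then have "monomial A scalars letters (Suc k) (i + r) (\<iota> v \<otimes>\<^bsub>A\<^esub> x)"
          using add by (intro monomial.letter) auto
        then show "\<iota> v \<otimes>\<^bsub>A\<^esub> x \<in> addspan A ?S"
          by (intro A.M.addspan_base[OF S]) auto
      qed (use \<open>v \<in> carrier M\<close> in \<open>simp_all add: A.A.r_distr\<close>)
      ultimately show ?case
        using add A.M.addspan_add[OF S, of "\<iota> v \<otimes>\<^bsub>A\<^esub> y" "\<iota> m' \<otimes>\<^bsub>A\<^esub> y"] y'
        by (simp add: \<iota>_add A.A.l_distr)
    qed
  qed
  have word: "c \<odot>\<^bsub>A\<^esub> q (single C w) \<in> addspan A ?S" if c: "c \<in> carrier C" and "w \<in> lists (carrier M)" for c w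
    using that(2)
  proof (induction w)
    case Nil
    have "monomial A scalars letters 0 0 (c \<odot>\<^bsub>A\<^esub> \<one>\<^bsub>A\<^esub>)"
      using c by (intro monomial.scalar) simp
    then show ?case
      using A.M.addspan_base[OF S, of "c \<odot>\<^bsub>A\<^esub> \<one>\<^bsub>A\<^esub>"] by (auto simp: q_single_Nil)
  next
    case (Cons m w)
    then show ?case
      using letter_mult[of m "c \<odot>\<^bsub>A\<^esub> q (single C w)"] c by (simp add: q_single_Cons A.smult_mult_r)
  qed
  have "q a \<in> addspan A ?S" if "a \<in> carrier L" for a
    using that unfolding free_algebra_simps
  proof (induction rule: M.free_module_induct)
    case zero
    then show ?case using q_zero addspan.zero[of A] by simp
  next
    case (add c w b)
    then show ?case
      using A.M.addspan_add[OF S word] by (simp add: q_smult_single_add)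
  qed
  then show "carrier A \<subseteq> addspan A ?S"
    by (auto simp: q_carrier)
qed

text \<open>Diagonal scaling of the module of letters is invertible because each \<open>u i\<close>
  is a unit with inverse \<open>u' i\<close>, so \<open>functorial\<close> applies. On a letter of
  weight \<open>i\<close> only the coordinate \<open>i\<close> can be nonzero, whence scaling acts
  on it as the scalar \<open>u i\<close>.\<close>

lemma scaling:
  assumes u: "\<And>i. u i \<in> carrier C" and u': "\<And>i. u' i \<in> carrier C"
    and inv: "\<And>i. u i \<otimes>\<^bsub>C\<^esub> u' i = \<one>\<^bsub>C\<^esub>"
  obtains h where "h \<in> ring_hom A A" "\<And>z. z \<in> scalars \<Longrightarrow> h z = z"
    "\<And>i x. x \<in> letters i \<Longrightarrow> h x = u i \<odot>\<^bsub>A\<^esub> x"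
proof -
  define \<phi> where "\<phi> u m = (\<lambda>i\<in>I. u i \<odot>\<^bsub>E i\<^esub> m i)" for u :: "int \<Rightarrow> 'c" and m :: "int \<Rightarrow> 'e"
  have closed: "\<phi> u m \<in> carrier M" if u: "\<And>i. u i \<in> carrier C" and m: "m \<in> carrier M" for u m
  proof -
    have "{i \<in> I. u i \<odot>\<^bsub>E i\<^esub> m i \<noteq> \<zero>\<^bsub>E i\<^esub>} \<subseteq> {i \<in> I. m i \<noteq> \<zero>\<^bsub>E i\<^esub>}"
      using module.smult_r_null[OF module_E] u by auto
    moreover have "finite {i \<in> I. m i \<noteq> \<zero>\<^bsub>E i\<^esub>}" using m by (simp add: direct_sum_def)
    ultimately have "finite {i \<in> I. u i \<odot>\<^bsub>E i\<^esub> m i \<noteq> \<zero>\<^bsub>E i\<^esub>}" by (rule finite_subset)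
    then show ?thesis
      using m module.smult_closed[OF module_E] u
      by (simp add: direct_sum_def \<phi>_def PiE_iff cong: conj_cong)
  qed
  have comp: "m i \<in> carrier (E i)" if "m \<in> carrier M" "i \<in> I" for m i
    using that by (auto simp: direct_sum_def)
  have inverse: "\<phi> u (\<phi> v m) = m" if m: "m \<in> carrier M"
    and u: "\<And>i. u i \<in> carrier C" and v: "\<And>i. v i \<in> carrier C" and uv: "\<And>i. u i \<otimes>\<^bsub>C\<^esub> v i = \<one>\<^bsub>C\<^esub>" for u v m
  proof -
    have "u i \<odot>\<^bsub>E i\<^esub> (v i \<odot>\<^bsub>E i\<^esub> m i) = m i" if "i \<in> I" for i
      using module.smult_assoc1[OF module_E[OF that] u v comp[OF m that], of i i]
        module.smult_one[OF module_E[OF that] comp[OF m that]] uv by simp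
    then show ?thesis
      using m by (auto simp: \<phi>_def direct_sum_def PiE_iff extensional_def fun_eq_iff)
  qed
  have homog: "\<phi> u v \<in> homogeneous I E i" if "v \<in> homogeneous I E i" for v i
    using that closed[OF u, of v] module.smult_r_null[OF module_E] u
    by (auto simp: homogeneous_def \<phi>_def)
  obtain h where h: "h \<in> ring_hom A A"
    and h_scalar: "\<And>c. c \<in> carrier C \<Longrightarrow> h (c \<odot>\<^bsub>A\<^esub> \<one>\<^bsub>A\<^esub>) = c \<odot>\<^bsub>A\<^esub> \<one>\<^bsub>A\<^esub>"
    and h_letter: "\<And>m. m \<in> carrier M \<Longrightarrow> h (\<iota> m) = \<iota> (\<phi> u m)"
  proof (rule functorial[of "\<phi> u" "\<phi> u'"])
    show "\<phi> u m \<in> carrier M" "\<phi> u' m \<in> carrier M" "\<phi> u (\<phi> u' m) = m" if "m \<in> carrier M" for m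
      using that closed inverse u u' inv by blast+
    show "\<phi> u' (\<phi> u m) = m" if "m \<in> carrier M" for m
      using inverse[OF that u' u] inv M.R.m_comm[OF u' u] by simp
    show "\<phi> u (m \<oplus>\<^bsub>M\<^esub> m') = \<phi> u m \<oplus>\<^bsub>M\<^esub> \<phi> u m'" if "m \<in> carrier M" "m' \<in> carrier M" for m m'
      using comp[OF that(1)] comp[OF that(2)] module.smult_r_distr[OF module_E u]
      by (auto simp: \<phi>_def direct_sum_def)
    show "\<phi> u (c \<odot>\<^bsub>M\<^esub> m) = c \<odot>\<^bsub>M\<^esub> \<phi> u m" if "c \<in> carrier C" "m \<in> carrier M" for c m
    proof -
      have "u i \<odot>\<^bsub>E i\<^esub> (c \<odot>\<^bsub>E i\<^esub> m i) = c \<odot>\<^bsub>E i\<^esub> (u i \<odot>\<^bsub>E i\<^esub> m i)" if i: "i \<in> I" for i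
        using module.smult_assoc1[OF module_E[OF i] u \<open>c \<in> carrier C\<close> comp[OF \<open>m \<in> carrier M\<close> i], of i]
          module.smult_assoc1[OF module_E[OF i] \<open>c \<in> carrier C\<close> u comp[OF \<open>m \<in> carrier M\<close> i], of i]
          M.R.m_comm[OF u \<open>c \<in> carrier C\<close>] by simp
      then show ?thesis
        by (auto simp: \<phi>_def direct_sum_def)
    qed
    show "\<phi> u v \<in> homogeneous I E i" if "i \<in> I" "v \<in> homogeneous I E i" for i v
      using that homog by blast
  qed (use that in blast)
  show thesis
  proof (rule that[OF h])
    show "h z = z" if "z \<in> scalars" for z
      using that h_scalar by auto
    show "h x = u i \<odot>\<^bsub>A\<^esub> x" if x: "x \<in> letters i" for i x
    proof -
      obtain v where i: "i \<in> I" and v: "v \<in> homogeneous I E i" and x: "x = \<iota> v"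
        using x by (auto split: if_splits)
      have "(\<phi> u v) j = (u i \<odot>\<^bsub>M\<^esub> v) j" for j
        using v module.smult_r_null[OF module_E] u
        by (cases "j \<in> I"; cases "j = i") (auto simp: \<phi>_def homogeneous_def direct_sum_def)
      then have "\<phi> u v = u i \<odot>\<^bsub>M\<^esub> v" ..
      then show ?thesis
        using h_letter[of v] \<iota>_smult[of "u i" v] u v by (simp add: x homogeneous_closed)
    qed
  qed
qed

text \<open>Letters exist formally in every weight of \<open>I\<close>. Those over a zero module
  vanish in the algebra, which is how finiteness of the support of \<open>V\<close> turns into a
  bound on the weights of nonzero letters.\<close>

lemma letters_trivial:
  assumes "i \<in> I" "carrier (E i) = {\<zero>\<^bsub>E i\<^esub>}"
  shows "letters i \<subseteq> {\<zero>\<^bsub>A\<^esub>}"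
proof -
  have "v = \<zero>\<^bsub>M\<^esub>" if "v \<in> homogeneous I E i" for v
  proof
    fix j
    show "v j = \<zero>\<^bsub>M\<^esub> j"
      using that assms by (cases "j \<in> I"; cases "j = i") (auto simp: homogeneous_def direct_sum_def)
  qed
  then show ?thesis using assms \<iota>_zero by (auto simp only: if_True image_iff singleton_iff)
qed

end


section \<open>Weights and filtrations\<close>

lemma real_ring_simps [simp]:
  "carrier real_ring = UNIV" "mult real_ring = (*)" "one real_ring = 1" "zero real_ring = 0"
  "add real_ring = (+)"
  by (simp_all add: real_ring_def)

lemma cring_real_ring: "cring real_ring"
proof (rule cringI)
  show "abelian_group real_ring"
  proof (rule abelian_groupI)
    fix x :: real
    show "\<exists>y\<in>carrier real_ring. y \<oplus>\<^bsub>real_ring\<^esub> x = \<zero>\<^bsub>real_ring\<^esub>"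
      by (intro bexI[of _ "- x"]) simp_all
  qed simp_all
  show "comm_monoid real_ring" by (rule comm_monoidI) simp_all
qed (simp add: distrib_right)

lemma real_ring_a_inv [simp]: "\<ominus>\<^bsub>real_ring\<^esub> x = - x"
proof -
  interpret cring real_ring by (rule cring_real_ring)
  show ?thesis by (rule minus_equality) simp_all
qed

text \<open>Negatives arise as multiples by \<open>-1\<close>, which compensates for their absence
  from the rules of \<open>addspan\<close>.\<close>

lemma (in module) addspan_submodule:
  assumes S: "S \<subseteq> carrier M" and smult: "\<And>k x. \<lbrakk>k \<in> carrier R; x \<in> S\<rbrakk> \<Longrightarrow> k \<odot>\<^bsub>M\<^esub> x \<in> S"
  shows "submodule (addspan M S) R M"
proof (rule submoduleI)
  show sub: "addspan M S \<subseteq> carrier M" using S by (rule M.addspan_closed)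
  show sm: "k \<odot>\<^bsub>M\<^esub> x \<in> addspan M S" if k: "k \<in> carrier R" and x: "x \<in> addspan M S" for k x
    using S S x
  proof (rule M.addspan_image)
    show "k \<odot>\<^bsub>M\<^esub> y \<in> addspan M S" if "y \<in> S" for y
      using k that S smult by (intro M.addspan_base) auto
  qed (use k in \<open>simp_all add: smult_r_distr\<close>)
  show "\<ominus>\<^bsub>M\<^esub> x \<in> addspan M S" if "x \<in> addspan M S" for x
    using sm[of "\<ominus> \<one>" x] that sub smult_l_minus[of \<one> x] by auto
qed (use M.addspan_add[OF S] addspan.zero in blast)+

text \<open>This collects the facts about the algebra from which the comparison of the filtrations
  is derived; \<open>h\<close> is the scaling endomorphism. \<open>H_bound\<close> speaks of nonzero
  letters because in the application zero is a letter of every nonzero weight.\<close>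

locale super_monomials = assoc_algebra real_ring A
  for A :: "(real, 'a) module" (structure) +
  fixes Z :: "'a set" and H :: "int \<Rightarrow> 'a set" and G :: "int \<Rightarrow> 'a set" and h :: "'a \<Rightarrow> 'a" and N :: nat
  assumes Z_closed: "Z \<subseteq> carrier A" and one_Z: "\<one> \<in> Z"
    and Z_mult: "\<And>x y. \<lbrakk>x \<in> Z; y \<in> Z\<rbrakk> \<Longrightarrow> x \<otimes> y \<in> Z"
    and Z_smult: "\<And>k x. x \<in> Z \<Longrightarrow> k \<odot> x \<in> Z"
    and Z_central: "\<And>x y. \<lbrakk>x \<in> Z; y \<in> carrier A\<rbrakk> \<Longrightarrow> x \<otimes> y = y \<otimes> x"
    and H_closed: "\<And>i. H i \<subseteq> carrier A" and H_0: "H 0 = {}"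
    and H_supercomm: "\<And>i j x y. \<lbrakk>x \<in> H i; y \<in> H j\<rbrakk> \<Longrightarrow> x \<otimes> y = koszul A i j (y \<otimes> x)"
    and G_eq: "\<And>r. G r = addspan A {x. \<exists>k. monomial A Z H k r x}"
    and carrier_eq: "carrier A = addspan A {x. \<exists>k r. monomial A Z H k r x}"
    and h_hom: "h \<in> ring_hom A A" and h_Z: "\<And>z. z \<in> Z \<Longrightarrow> h z = z"
    and h_H: "\<And>i x. x \<in> H i \<Longrightarrow> h x = (2 powi i) \<odot> x"
    and N: "N > 0" and H_bound: "\<And>i x. \<lbrakk>x \<in> H i; x \<noteq> \<zero>\<rbrakk> \<Longrightarrow> \<bar>i\<bar> \<le> int N"
begin

section \<open>Calculus of monomials and signs\<close>

abbreviation "is_mono \<equiv> monomial A Z H"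

text \<open>The sign as a real scalar: signs from successive exchanges then multiply, and
  bilinearity takes them out of products.\<close>

definition koszul_sign :: "int \<Rightarrow> int \<Rightarrow> real" where "koszul_sign i j = (if odd (i * j) then - 1 else 1)"

lemma smult_uminus: "x \<in> carrier A \<Longrightarrow> (- k) \<odot> x = \<ominus> (k \<odot> x)"
  using smult_l_minus[of k x] by simp

lemma smult_closed': "x \<in> carrier A \<Longrightarrow> k \<odot> x \<in> carrier A"
  by (rule smult_closed) simp_all

lemma smult_smult: "x \<in> carrier A \<Longrightarrow> k \<odot> (l \<odot> x) = (k * l) \<odot> x"
  using smult_assoc1[of k l x] by simp

lemma smult_1: "x \<in> carrier A \<Longrightarrow> 1 \<odot> x = x"
  using smult_one[of x] by simp

lemma smult_mult:
  "\<lbrakk>x \<in> carrier A; y \<in> carrier A\<rbrakk> \<Longrightarrow> (k \<odot> x) \<otimes> y = k \<odot> (x \<otimes> y)"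
  "\<lbrakk>x \<in> carrier A; y \<in> carrier A\<rbrakk> \<Longrightarrow> x \<otimes> (k \<odot> y) = k \<odot> (x \<otimes> y)"
  by (simp_all add: smult_mult_l smult_mult_r)

lemma smult_add: "\<lbrakk>x \<in> carrier A; y \<in> carrier A\<rbrakk> \<Longrightarrow> k \<odot> (x \<oplus> y) = k \<odot> x \<oplus> k \<odot> y"
  by (simp add: smult_r_distr)

lemma smult_zero: "k \<odot> \<zero> = \<zero>"
  using smult_r_null[of k] by simp

lemmas smult_simps = smult_closed' smult_smult smult_1 smult_mult smult_add smult_zero

lemma koszul_eq: "x \<in> carrier A \<Longrightarrow> koszul A i j x = koszul_sign i j \<odot> x"
  by (simp add: koszul_def koszul_sign_def smult_uminus smult_1)

lemma koszul_sign_add: "koszul_sign (i + j) k = koszul_sign i k * koszul_sign j k" "koszul_sign k (i + j) = koszul_sign k i * koszul_sign k j"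
  by (auto simp: koszul_sign_def)

lemma koszul_sign_0: "koszul_sign 0 k = 1" "koszul_sign k 0 = 1"
  by (auto simp: koszul_sign_def)

lemma mono_closed: "is_mono k r x \<Longrightarrow> x \<in> carrier A"
  by (induction rule: monomial.induct) (use Z_closed H_closed in auto)

lemma H_closedD: "x \<in> H i \<Longrightarrow> x \<in> carrier A"
  using H_closed by auto

lemma mono_smult: "is_mono k r x \<Longrightarrow> is_mono k r (c \<odot> x)"
proof (induction rule: monomial.induct)
  case (letter x i k r y)
  then have "is_mono (Suc k) (i + r) (x \<otimes> (c \<odot> y))" by (intro monomial.letter)
  then show ?case using letter by (simp add: smult_simps H_closedD mono_closed)
qed (intro monomial.scalar Z_smult)

lemma mono_scalar_mult:
  assumes z: "z \<in> Z"
  shows "is_mono k r y \<Longrightarrow> is_mono k r (z \<otimes> y)"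
proof (induction rule: monomial.induct)
  case (letter x i k r y)
  have zc: "z \<in> carrier A" using z Z_closed by auto
  have "z \<otimes> (x \<otimes> y) = x \<otimes> (z \<otimes> y)"
    using letter zc Z_central[OF z H_closedD[OF letter(1)]] mono_closed[OF letter(2)] H_closedD[OF letter(1)]
    by (metis A.m_assoc)
  then show ?case using letter monomial.letter[of x H i A Z k r "z \<otimes> y"] by simp
qed (intro monomial.scalar Z_mult z)

lemma mono_mult: "is_mono k r x \<Longrightarrow> is_mono l s y \<Longrightarrow> is_mono (k + l) (r + s) (x \<otimes> y)"
proof (induction rule: monomial.induct)
  case (scalar z)
  then show ?case using mono_scalar_mult by simp
next
  case (letter x i k r u)
  then have "is_mono (Suc (k + l)) (i + (r + s)) (x \<otimes> (u \<otimes> y))"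
    by (intro monomial.letter) auto
  then show ?case using letter by (simp add: A.m_assoc H_closedD mono_closed add.assoc)
qed

text \<open>The sign is multiplicative in the weight (\<open>koszul_sign_add\<close>), so carrying
  \<open>x\<close> across the letters of \<open>y\<close> one by one accumulates the sign belonging
  to their total weight.\<close>

lemma letter_mono_comm:
  assumes x: "x \<in> H i"
  shows "is_mono l s y \<Longrightarrow> x \<otimes> y = koszul_sign i s \<odot> (y \<otimes> x)"
proof (induction rule: monomial.induct)
  case (scalar z)
  then show ?case
    using Z_central[OF scalar H_closedD[OF x]] Z_closed H_closedD[OF x] by (auto simp: koszul_sign_0 smult_1)
next
  case (letter x' j k r y)
  note c = H_closedD[OF x] H_closedD[OF letter(1)] mono_closed[OF letter(2)]
  have "x \<otimes> (x' \<otimes> y) = (x \<otimes> x') \<otimes> y"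
    using c by (simp add: A.m_assoc)
  also have "\<dots> = koszul_sign i j \<odot> (x' \<otimes> (x \<otimes> y))"
    using c H_supercomm[OF x letter(1)] by (simp add: koszul_eq smult_simps A.m_assoc)
  also have "\<dots> = koszul_sign i (j + r) \<odot> ((x' \<otimes> y) \<otimes> x)"
    using c letter.IH by (simp add: smult_simps A.m_assoc koszul_sign_add)
  finally show ?case .
qed

lemma mono_comm: "is_mono k r x \<Longrightarrow> is_mono l s y \<Longrightarrow> x \<otimes> y = koszul_sign r s \<odot> (y \<otimes> x)"
proof (induction rule: monomial.induct)
  case (scalar z)
  then show ?case
    using Z_central[OF scalar(1) mono_closed[OF scalar(2)]] Z_closed mono_closed[OF scalar(2)]
    by (auto simp: koszul_sign_0 smult_1)
next
  case (letter x' i k r x)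
  note c = H_closedD[OF letter(1)] mono_closed[OF letter(2)] mono_closed[OF letter(4)]
  have "(x' \<otimes> x) \<otimes> y = koszul_sign r s \<odot> ((x' \<otimes> y) \<otimes> x)"
    using c letter by (simp add: smult_simps A.m_assoc)
  also have "\<dots> = koszul_sign (i + r) s \<odot> (y \<otimes> (x' \<otimes> x))"
    using c letter_mono_comm[OF letter(1,4)] by (simp add: smult_simps A.m_assoc koszul_sign_add mult.commute)
  finally show ?case .
qed

lemma monos_closed: "{x. \<exists>k. is_mono k r x} \<subseteq> carrier A"
  using mono_closed by auto

lemma G_closed: "G r \<subseteq> carrier A"
  unfolding G_eq using monos_closed by (rule M.addspan_closed)

lemma mono_G: "is_mono k r x \<Longrightarrow> x \<in> G r"
  unfolding G_eq by (intro M.addspan_base monos_closed) auto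

lemma G_submodule: "submodule (G r) real_ring A"
  unfolding G_eq using monos_closed by (intro addspan_submodule) (auto intro: mono_smult)

lemma one_G: "\<one> \<in> G 0"
  by (rule mono_G[OF monomial.scalar[OF one_Z]])

lemma addspan_mult:
  assumes S: "S \<subseteq> carrier A" and S': "S' \<subseteq> carrier A" and T: "T \<subseteq> carrier A"
    and mult: "\<And>x y. \<lbrakk>x \<in> S; y \<in> S'\<rbrakk> \<Longrightarrow> x \<otimes> y \<in> T"
    and x: "x \<in> addspan A S" and y: "y \<in> addspan A S'"
  shows "x \<otimes> y \<in> addspan A T"
  using S T x
proof (rule M.addspan_image)
  have y': "y \<in> carrier A" using y M.addspan_closed[OF S'] by auto
  then show "\<zero> \<otimes> y = \<zero>"
    "\<And>u v. \<lbrakk>u \<in> carrier A; v \<in> carrier A\<rbrakk> \<Longrightarrow> (u \<oplus> v) \<otimes> y = u \<otimes> y \<oplus> v \<otimes> y"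
    by (simp_all add: A.l_distr)
  fix u assume u: "u \<in> S"
  show "u \<otimes> y \<in> addspan A T"
    using S' T y
  proof (rule M.addspan_image)
    show "u \<otimes> v \<in> addspan A T" if "v \<in> S'" for v
      using mult[OF u that] T by (intro M.addspan_base) auto
  qed (use u S in \<open>auto simp: A.r_distr\<close>)
qed

lemma G_mult: "\<lbrakk>x \<in> G r; y \<in> G s\<rbrakk> \<Longrightarrow> x \<otimes> y \<in> G (r + s)"
  unfolding G_eq
  by (rule addspan_mult[OF monos_closed monos_closed monos_closed]) (auto intro: mono_mult)

lemma G_supercomm:
  assumes x: "x \<in> G r" and y: "y \<in> G s"
  shows "x \<otimes> y = koszul A r s (y \<otimes> x)"
proof -
  have cl: "u \<in> carrier A" if "u \<in> addspan A {x. \<exists>k. is_mono k t x}" for u t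
    using that M.addspan_closed[OF monos_closed] by auto
  have mono_y: "u \<otimes> y = koszul_sign r s \<odot> (y \<otimes> u)" if u: "is_mono k r u" for k u
    using y unfolding G_eq
  proof induction
    case (add v w)
    then show ?case
      using mono_closed[OF u] mono_comm[OF u] cl[OF add(2)]
      by (auto simp: smult_simps A.l_distr A.r_distr mono_closed)
  qed (simp add: mono_closed[OF u] smult_simps)
  have y': "y \<in> carrier A" using y G_closed by auto
  have "x \<otimes> y = koszul_sign r s \<odot> (y \<otimes> x)"
    using x unfolding G_eq
  proof induction
    case (add v w)
    then show ?case
      using y' mono_y cl[OF add(2)] by (auto simp: smult_simps A.l_distr A.r_distr mono_closed)
  qed (simp add: y' smult_simps)
  then show ?thesis
    using x y G_closed by (subst koszul_eq) auto
qed

section \<open>Independence of the weight components\<close>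

lemma h_mono: "is_mono k r x \<Longrightarrow> h x = (2 powi r) \<odot> x"
proof (induction rule: monomial.induct)
  case (scalar z)
  then show ?case using h_Z Z_closed by (auto simp: smult_1)
next
  case (letter x i k r y)
  then show ?case
    using ring_hom_mult[OF h_hom H_closedD[OF letter(1)] mono_closed[OF letter(2)]] h_H[OF letter(1)]
      H_closedD[OF letter(1)] mono_closed[OF letter(2)]
    by (simp add: smult_simps power_int_add mult.commute)
qed

lemma h_G: "x \<in> G r \<Longrightarrow> h x = (2 powi r) \<odot> x"
  unfolding G_eq
proof (induction rule: addspan.induct)
  case zero
  then show ?case using ring_hom_zero[OF h_hom ring_M ring_M] smult_zero by simp
next
  case (add x y)
  then have "x \<in> carrier A" "y \<in> carrier A"
    using mono_closed subsetD[OF M.addspan_closed[OF monos_closed]] by auto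
  then show ?case
    using add h_mono ring_hom_add[OF h_hom] by (auto simp: smult_simps)
qed

lemma h_finsum: "\<lbrakk>finite S; \<And>s. s \<in> S \<Longrightarrow> f s \<in> carrier A\<rbrakk> \<Longrightarrow> h (\<Oplus>s\<in>S. f s) = (\<Oplus>s\<in>S. h (f s))"
proof (induction S rule: finite_induct)
  case empty
  then show ?case using ring_hom_zero[OF h_hom ring_M ring_M] by simp
next
  case (insert s S)
  then show ?case
    using ring_hom_add[OF h_hom] ring_hom_closed[OF h_hom] by (simp add: Pi_def)
qed

text \<open>Elements of different weights are eigenvectors of \<open>h\<close> for different eigenvalues.\<close>

lemma G_independent:
  "\<lbrakk>finite S; \<And>s. b s \<in> G s; (\<Oplus>s\<in>S. b s) = \<zero>; s \<in> S\<rbrakk> \<Longrightarrow> b s = \<zero>"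
proof (induction S arbitrary: b s rule: finite_induct)
  case (insert t S)
  have b: "b s \<in> carrier A" for s using insert.prems(1) G_closed by auto
  define \<Sigma> where "\<Sigma> = (\<Oplus>s\<in>S. b s)"
  have \<Sigma>: "\<Sigma> \<in> carrier A" using b by (simp add: \<Sigma>_def)
  have "b t \<oplus> \<Sigma> = \<zero>"
    using insert.prems(2) insert.hyps b by (simp add: \<Sigma>_def)
  then have bt: "b t = \<ominus> \<Sigma>" using b \<Sigma> by (metis M.minus_equality)
  \<comment> \<open>The relation after applying \<open>h - 2^t\<close>: the term of index
    \<open>t\<close> disappears and every other \<open>b s\<close> is multiplied by a nonzero
    number, so the induction hypothesis applies to the remaining terms.\<close>
  define b' where "b' s = (2 powi s - 2 powi t :: real) \<odot> b s" for s
  have "b' s \<in> G s" for s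
    using submodule.smult_closed[OF G_submodule] insert.prems(1) by (simp add: b'_def)
  moreover have "(\<Oplus>s\<in>S. b' s) = \<zero>"
  proof -
    have "h \<Sigma> = (\<Oplus>s\<in>S. (2 powi s) \<odot> b s)"
      unfolding \<Sigma>_def using insert.hyps b
      by (subst h_finsum) (auto simp: h_G[OF insert.prems(1)] smult_closed' intro!: M.finsum_cong')
    \<comment> \<open>The second evaluation of \<open>h\<close>: since the whole sum vanishes,
      \<open>\<Sigma>\<close> is the negative of \<open>b t\<close> and therefore itself of weight
      \<open>t\<close>.\<close>
    moreover have "h \<Sigma> = (2 powi t) \<odot> \<Sigma>"
    proof -
      have "\<Sigma> = (- 1) \<odot> b t"
        using bt \<Sigma> b by (simp add: smult_uminus smult_1)
      then have "\<Sigma> \<in> G t"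
        using submodule.smult_closed[OF G_submodule] insert.prems(1) by simp
      then show ?thesis by (rule h_G)
    qed
    moreover have "(2 powi t) \<odot> \<Sigma> = (\<Oplus>s\<in>S. (2 powi t) \<odot> b s)"
      unfolding \<Sigma>_def using insert.hyps b by (intro finsum_smult_ldistr) auto
    moreover have "(\<Oplus>s\<in>S. (2 powi s) \<odot> b s) = (\<Oplus>s\<in>S. b' s \<oplus> (2 powi t) \<odot> b s)"
      using b smult_l_distr[of _ "2 powi t" "b _"]
      by (intro M.finsum_cong') (auto simp: b'_def smult_closed' smult_l_distr[symmetric, simplified])
    moreover have "\<dots> = (\<Oplus>s\<in>S. b' s) \<oplus> (\<Oplus>s\<in>S. (2 powi t) \<odot> b s)"
      using b by (intro M.finsum_addf) (auto simp: b'_def smult_closed')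
    ultimately show ?thesis
      using b M.add.r_cancel_one'[of "\<Oplus>s\<in>S. (2 powi t) \<odot> b s" "\<Oplus>s\<in>S. b' s"]
      by (simp add: b'_def smult_closed' Pi_def)
  qed
  ultimately have b'_0: "b' s = \<zero>" if "s \<in> S" for s
    using insert.IH[of b' s] that by blast
  have b_0: "b s = \<zero>" if s: "s \<in> S" for s
  proof -
    have "s \<noteq> t" using insert.hyps s by auto
    then have ne: "(2 powi s - 2 powi t :: real) \<noteq> 0"
      using power_int_strict_increasing[of s t "2 :: real"] power_int_strict_increasing[of t s "2 :: real"]
      by (cases s t rule: linorder_cases) auto
    have "inverse (2 powi s - 2 powi t) \<odot> b' s = b s"
      using ne b by (simp add: b'_def smult_simps)
    then show ?thesis using b'_0[OF s] smult_zero by simp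
  qed
  moreover have "b t = \<zero>"
    using bt b_0 by (simp add: \<Sigma>_def M.add.finprod_one_eqI)
  ultimately show ?case using insert.prems(3) by blast
qed simp


section \<open>The weight filtration inside the polynomial filtration\<close>

definition J :: "'a set" where "J = Idl (\<Union>i\<in>{i. i \<noteq> 0}. G i)"

lemma H_G: "x \<in> H i \<Longrightarrow> x \<in> G i"
  using mono_G[OF monomial.letter[OF _ monomial.scalar[OF one_Z]], of x i] by (simp add: H_closedD)

lemma J_ideal: "ideal J A"
  unfolding J_def using G_closed by (intro A.genideal_ideal) auto

lemma J_power_ideal: "ideal (ideal_power A J p) A"
proof (induction p)
  case 0
  show ?case using A.oneideal by simp
next
  case (Suc p)
  then show ?case using A.ideal_prod_is_ideal[OF J_ideal] by simp
qed

lemma J_power_decreasing: "p \<le> k \<Longrightarrow> ideal_power A J k \<subseteq> ideal_power A J p"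
proof (induction k rule: dec_induct)
  case (step k)
  then show ?case using A.ideal_prod_inter[OF J_ideal J_power_ideal[of k]] by auto
qed simp

lemma mono_J_power: "is_mono k r x \<Longrightarrow> x \<in> ideal_power A J k"
proof (induction rule: monomial.induct)
  case (scalar z)
  then show ?case using Z_closed by auto
next
  case (letter x i k r y)
  have "(\<Union>i\<in>{i. i \<noteq> 0}. G i) \<subseteq> J"
    unfolding J_def using G_closed by (intro A.genideal_self) auto
  moreover have "i \<noteq> 0" using letter(1) H_0 by auto
  ultimately have "x \<in> J" using H_G[OF letter(1)] by auto
  then show ?case
    using ideal_prod.prod[of x J y "ideal_power A J k" A] letter.IH by simp
qed

text \<open>All factors of a nonzero word are nonzero, so each letter obeys \<open>H_bound\<close>.
  The zero element can be a word of arbitrarily large weight with a single letter, hence the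
  restriction.\<close>

lemma mono_weight_bound: "is_mono k r x \<Longrightarrow> x \<noteq> \<zero> \<Longrightarrow> \<bar>r\<bar> \<le> int N * int k"
proof (induction rule: monomial.induct)
  case (letter x i k r y)
  have "x \<noteq> \<zero>" "y \<noteq> \<zero>"
    using letter.prems H_closedD[OF letter(1)] mono_closed[OF letter(2)] by auto
  then show ?case using letter H_bound[OF letter(1)] by (simp add: algebra_simps)
qed simp

lemma weight_filtration_le: "weight_filtration A G (N * p) \<subseteq> polynomial_filtration A G p"
proof (cases "p = 0")
  case True
  then show ?thesis by (simp add: weight_filtration_def polynomial_filtration_def)
next
  case False
  interpret Jp: ideal "ideal_power A J p" A by (rule J_power_ideal)
  have "G i \<subseteq> ideal_power A J p" if i: "i \<ge> int (N * p)" for i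
  proof
    fix x assume "x \<in> G i"
    then have "x \<in> addspan A {x. \<exists>k. is_mono k i x}" by (simp add: G_eq)
    then show "x \<in> ideal_power A J p"
    proof induction
      case (add x y)
      then obtain k where k: "is_mono k i x" by auto
      have "x \<in> ideal_power A J p"
      \<comment> \<open>The zero word lies in every ideal; for the others the weight bound gives at
        least \<open>p\<close> letters.\<close>
      proof (cases "x = \<zero>")
        case False
        have "int N * int p \<le> int N * int k" using mono_weight_bound[OF k False] i by simp
        then have "p \<le> k" using N by simp
        then show ?thesis using mono_J_power[OF k] J_power_decreasing by auto
      qed simp
      then show ?case using add by simp
    qed simp
  qed
  then have "Idl (\<Union>i\<in>{i. i \<ge> int (N * p)}. G i) \<subseteq> ideal_power A J p"
    by (intro A.genideal_minimal Jp.ideal_axioms) auto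
  then show ?thesis
    using False N by (simp add: weight_filtration_def polynomial_filtration_def J_def)
qed

section \<open>The polynomial filtration inside the weight filtration, one weight at a time\<close>

abbreviation "long_mono p \<equiv> {x. \<exists>k r. p \<le> k \<and> is_mono k r x}"

lemma long_mono_closed: "long_mono p \<subseteq> carrier A"
  using mono_closed by auto

lemma long_mult:
  "\<lbrakk>x \<in> addspan A (long_mono p); y \<in> addspan A (long_mono p')\<rbrakk> \<Longrightarrow>
    x \<otimes> y \<in> addspan A (long_mono (p + p'))"
proof (rule addspan_mult[OF long_mono_closed long_mono_closed long_mono_closed])
  fix x y assume "x \<in> long_mono p" "y \<in> long_mono p'"
  then obtain k r l s where "is_mono k r x" "is_mono l s y" "p \<le> k" "p' \<le> l" by auto
  then show "x \<otimes> y \<in> long_mono (p + p')"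
    using mono_mult[of k r x l s y] add_mono[of p k p' l] by blast
qed

lemma long_carrier: "addspan A (long_mono 0) = carrier A"
  by (subst carrier_eq) simp

text \<open>Lengths add under multiplication, and an arbitrary factor is a sum of words of length at
  least 0.\<close>

lemma long_ideal: "ideal (addspan A (long_mono p)) A"
proof (rule idealI[OF ring_M])
  have "submodule (addspan A (long_mono p)) real_ring A"
    using long_mono_closed by (intro addspan_submodule) (auto intro: mono_smult)
  then show "subgroup (addspan A (long_mono p)) (add_monoid A)"
    by (rule submodule.axioms)
  show "x \<otimes> a \<in> addspan A (long_mono p)" "a \<otimes> x \<in> addspan A (long_mono p)"
    if "a \<in> addspan A (long_mono p)" "x \<in> carrier A" for a x
    using long_mult[of x 0 a p] long_mult[of a p x 0] that long_carrier by simp_all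
qed

text \<open>Lengths add, so the point is the case of \<open>J\<close> itself: its generators are
  sums of words of nonzero weight, and those have at least one letter because scalars have weight
  0.\<close>

lemma J_power_long: "ideal_power A J p \<subseteq> addspan A (long_mono p)"
proof (induction p)
  case 0
  then show ?case using long_carrier by simp
next
  case (Suc p)
  have "G i \<subseteq> addspan A (long_mono 1)" if i: "i \<noteq> 0" for i
    unfolding G_eq
  proof (rule addspan_mono, safe)
    fix k x assume m: "is_mono k i x"
    then have "k \<noteq> 0" using i by (auto elim: monomial.cases)
    then show "\<exists>k r. 1 \<le> k \<and> is_mono k r x" using m by (intro exI[of _ k] exI[of _ i]) simp
  qed
  then have J: "J \<subseteq> addspan A (long_mono 1)"
    unfolding J_def by (intro A.genideal_minimal long_ideal) auto
  interpret W: ideal "addspan A (long_mono (Suc p))" A by (rule long_ideal)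
  have "x \<in> addspan A (long_mono (Suc p))" if "x \<in> ideal_prod A J (ideal_power A J p)" for x
    using that
  proof induction
    case (prod i j)
    then show ?case using long_mult[of i 1 j p] J Suc by auto
  next
    case (sum s1 s2)
    then show ?case by (intro W.a_closed)
  qed
  then show ?case by auto
qed

abbreviation "long_weight p r \<equiv> {x. \<exists>k. p \<le> k \<and> is_mono k r x}"

lemma long_weight_closed: "long_weight p r \<subseteq> carrier A"
  using mono_closed by auto

lemma long_weight_G: "addspan A (long_weight p r) \<subseteq> G r"
  unfolding G_eq by (rule addspan_mono) auto

text \<open>Words are collected by weight. The family \<open>b\<close> is defined for all weights
  and zero off \<open>S\<close>, so that a further weight can be added to the index set
  later.\<close>

lemma long_decompose:
  assumes "a \<in> addspan A (long_mono p)"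
  obtains S b where "finite S" "\<And>s. b s \<in> addspan A (long_weight p s)" "a = (\<Oplus>s\<in>S. b s)"
    "\<And>s. s \<notin> S \<Longrightarrow> b s = \<zero>"
proof -
  from assms have "\<exists>S b. finite S \<and> (\<forall>s. b s \<in> addspan A (long_weight p s)) \<and>
      a = (\<Oplus>s\<in>S. b s) \<and> (\<forall>s. s \<notin> S \<longrightarrow> b s = \<zero>)"
  proof induction
    case zero
    then show ?case
      by (intro exI[of _ "{}"] exI[of _ "\<lambda>_. \<zero>"]) (simp add: addspan.zero)
  next
    case (add x y)
    then obtain S b k r where S: "finite S" and b: "\<And>s. b s \<in> addspan A (long_weight p s)"
      and y: "y = (\<Oplus>s\<in>S. b s)" and b0: "\<And>s. s \<notin> S \<Longrightarrow> b s = \<zero>"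
      and x: "p \<le> k" "is_mono k r x" by auto
    have bc: "b s \<in> carrier A" for s using b M.addspan_closed[OF long_weight_closed] by blast
    have xc: "x \<in> carrier A" using x by (simp add: mono_closed)
    define b' where "b' = b(r := x \<oplus> b r)"
    have "b' s \<in> addspan A (long_weight p s)" for s
      using b x by (auto simp: b'_def intro!: addspan.add)
    moreover have "(\<Oplus>s\<in>insert r S. b' s) = x \<oplus> y"
    proof -
      have "(\<Oplus>s\<in>insert r S. b' s) = (\<Oplus>s\<in>insert r (S - {r}). b' s)"
        by simp
      also have "\<dots> = b' r \<oplus> (\<Oplus>s\<in>S - {r}. b' s)"
        using S bc xc by (subst M.finsum_insert) (auto simp: b'_def)
      also have "(\<Oplus>s\<in>S - {r}. b' s) = (\<Oplus>s\<in>S - {r}. b s)"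
        using bc by (intro M.finsum_cong') (auto simp: b'_def)
      also have "b' r \<oplus> (\<Oplus>s\<in>S - {r}. b s) = x \<oplus> (b r \<oplus> (\<Oplus>s\<in>S - {r}. b s))"
        using bc xc by (simp add: b'_def M.a_assoc)
      also have "b r \<oplus> (\<Oplus>s\<in>S - {r}. b s) = y"
      proof (cases "r \<in> S")
        case True
        then have "(\<Oplus>s\<in>insert r (S - {r}). b s) = b r \<oplus> (\<Oplus>s\<in>S - {r}. b s)"
          using S bc by (subst M.finsum_insert) auto
        then show ?thesis using True by (simp add: y insert_absorb)
      next
        case False
        then show ?thesis using b0[OF False] bc by (simp add: y)
      qed
      finally show ?thesis .
    qed
    ultimately show ?case
      using S b0 by (intro exI[of _ "insert r S"] exI[of _ b']) (auto simp: b'_def)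
  qed
  then show thesis using that by blast
qed

text \<open>An element of weight \<open>r\<close> might a priori be a sum of long words whose parts
  of other weights cancel only through the relations. Independence of the weights excludes this: the
  part of weight \<open>r\<close> is the whole element.\<close>

lemma long_inter_G: "addspan A (long_mono p) \<inter> G r \<subseteq> addspan A (long_weight p r)"
proof
  fix a assume a: "a \<in> addspan A (long_mono p) \<inter> G r"
  then obtain S b where S: "finite S" and b: "\<And>s. b s \<in> addspan A (long_weight p s)"
    and a_eq: "a = (\<Oplus>s\<in>S. b s)" and b0: "\<And>s. s \<notin> S \<Longrightarrow> b s = \<zero>"
    using long_decompose by blast
  have bc: "b s \<in> carrier A" for s using b M.addspan_closed[OF long_weight_closed] by blast
  have ac: "a \<in> carrier A" using a G_closed by auto
  \<comment> \<open>Subtracting \<open>a\<close> in weight \<open>r\<close> turns the decomposition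
    into a vanishing sum of elements of different weights; its term at \<open>r\<close> is therefore
    zero.\<close>
  define c where "c = b(r := b r \<oplus> \<ominus> a)"
  have G_sub: "subgroup (G s) (add_monoid A)" for s
    using G_submodule by (rule submodule.axioms)
  have cG: "c s \<in> G s" for s
  proof -
    interpret additive_subgroup "G r" A using G_sub by (rule additive_subgroup.intro)
    show ?thesis using a subsetD[OF long_weight_G b] by (auto simp: c_def)
  qed
  have c': "(\<Oplus>s\<in>S - {r}. c s) = (\<Oplus>s\<in>S - {r}. b s)"
    using bc by (intro M.finsum_cong') (auto simp: c_def)
  have a_split: "a = b r \<oplus> (\<Oplus>s\<in>S - {r}. b s)"
  proof (cases "r \<in> S")
    case True
    then have "(\<Oplus>s\<in>insert r (S - {r}). b s) = b r \<oplus> (\<Oplus>s\<in>S - {r}. b s)"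
      using S bc by (subst M.finsum_insert) auto
    then show ?thesis using True by (simp add: a_eq insert_absorb)
  next
    case False
    then show ?thesis using b0[OF False] bc by (simp add: a_eq)
  qed
  have fc: "(\<Oplus>s\<in>S - {r}. b s) \<in> carrier A" using bc by simp
  \<comment> \<open>The index \<open>r\<close> is put in by hand: it may be missing from
    \<open>S\<close>, in which case \<open>b r\<close> is zero.\<close>
  have "(\<Oplus>s\<in>insert r (S - {r}). c s) = c r \<oplus> (\<Oplus>s\<in>S - {r}. c s)"
    using S bc ac by (subst M.finsum_insert) (auto simp: c_def)
  also have "\<dots> = (b r \<oplus> (\<Oplus>s\<in>S - {r}. b s)) \<oplus> \<ominus> a"
    unfolding c' using bc ac fc by (simp add: c_def M.a_ac)
  also have "\<dots> = \<zero>"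
    using ac by (simp add: M.r_neg flip: a_split)
  finally have "c r = \<zero>"
    using S cG by (intro G_independent[of "insert r (S - {r})" c r]) auto
  then have "a = b r"
    using bc ac by (simp add: c_def) (metis M.minus_equality M.minus_minus M.a_inv_closed)
  then show "a \<in> addspan A (long_weight p r)" using b by simp
qed

text \<open>The letters of positive weight can be moved to the front.\<close>

lemma mono_split:
  "is_mono k r x \<Longrightarrow> \<exists>l r' u v. is_mono l r' u \<and> v \<in> carrier A \<and> x = u \<otimes> v \<and> int k + r \<le> 2 * r'"
proof (induction rule: monomial.induct)
  case (scalar z)
  then show ?case
    using Z_closed by (intro exI[of _ 0] exI[of _ z] exI[of _ \<one>]) (auto intro: monomial.scalar)
next
  case (letter x i k r y)
  then obtain l r' u v where u: "is_mono l r' u" and v: "v \<in> carrier A" and y: "y = u \<otimes> v"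
    and le: "int k + r \<le> 2 * r'" by auto
  have xc: "x \<in> carrier A" and uc: "u \<in> carrier A"
    using H_closedD[OF letter(1)] mono_closed[OF u] by auto
  consider "i > 0" | "i < 0" using letter(1) H_0 by (cases "i = 0") force+
  then show ?case
  proof cases
    case 1
    \<comment> \<open>The letter joins the front factor. As \<open>i \<ge> 1\<close>, the left side
      of the inequality grows by \<open>1 + i \<le> 2 i\<close>.\<close>
    have "x \<otimes> y = (x \<otimes> u) \<otimes> v" using xc uc v by (simp add: y A.m_assoc)
    moreover have "is_mono (Suc l) (i + r') (x \<otimes> u)" using letter(1) u by (rule monomial.letter)
    ultimately show ?thesis using v le 1 by (intro exI conjI) auto
  next
    case 2
    \<comment> \<open>The letter is moved behind \<open>u\<close> at the cost of a sign, and the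
      front factor keeps its weight. As \<open>i \<le> -1\<close>, the left side changes by
      \<open>1 + i \<le> 0\<close>.\<close>
    have "x \<otimes> y = (x \<otimes> u) \<otimes> v" using xc uc v by (simp add: y A.m_assoc)
    also have "\<dots> = u \<otimes> (koszul_sign i r' \<odot> (x \<otimes> v))"
      using xc uc v letter_mono_comm[OF letter(1) u] by (simp add: smult_simps A.m_assoc)
    finally show ?thesis using u v xc le 2 by (intro exI conjI) (auto simp: smult_closed')
  qed
qed

lemma polynomial_filtration_le:
  assumes le: "2 * int q \<le> int p + r"
  shows "polynomial_filtration A G p \<inter> G r \<subseteq> weight_filtration A G q"
proof (cases "q = 0")
  case True
  then show ?thesis using G_closed by (auto simp: weight_filtration_def)
next
  case False
  let ?F = "Idl (\<Union>i\<in>{i. i \<ge> int q}. G i)"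
  have sub: "(\<Union>i\<in>{i. i \<ge> int q}. G i) \<subseteq> carrier A" using G_closed by auto
  interpret F: ideal ?F A using sub by (rule A.genideal_ideal)
  have "x \<in> ?F" if "x \<in> addspan A (long_weight p r)" for x
    using that
  proof induction
    case (add x y)
    then obtain k where k: "p \<le> k" "is_mono k r x" by auto
    obtain l r' u v where u: "is_mono l r' u" and v: "v \<in> carrier A" and x: "x = u \<otimes> v"
      and "int k + r \<le> 2 * r'"
      using mono_split[OF k(2)] by blast
    \<comment> \<open>Here \<open>2 q \<le> p + r \<le> k + r \<le> 2 r'\<close>, so the front
      factor \<open>u\<close> is itself among the generators of \<open>F q\<close>.\<close>
    then have "int q \<le> r'" using le k(1) by linarith
    then have "u \<in> (\<Union>i\<in>{i. i \<ge> int q}. G i)" using mono_G[OF u] by auto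
    then have "u \<in> ?F" using A.genideal_self[OF sub] by blast
    then have "x \<in> ?F" unfolding x using v by (rule F.I_r_closed)
    then show ?case using add by simp
  qed simp
  moreover have "polynomial_filtration A G p \<inter> G r \<subseteq> addspan A (long_weight p r)"
    using J_power_long long_inter_G unfolding polynomial_filtration_def J_def by blast
  ultimately show ?thesis using False by (auto simp: weight_filtration_def)
qed

section \<open>Both filtrations are decreasing sequences of ideals\<close>

lemma weight_filtration_ideal: "ideal (weight_filtration A G p) A"
proof (cases "p = 0")
  case True
  then show ?thesis using A.oneideal by (simp add: weight_filtration_def)
next
  case False
  then show ?thesis
    using G_closed by (simp add: weight_filtration_def) (intro A.genideal_ideal; auto)
qed

lemma weight_filtration_decreasing: "p \<le> q \<Longrightarrow> weight_filtration A G q \<subseteq> weight_filtration A G p"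
proof (cases "p = 0")
  case True
  then show ?thesis
    using ideal.Icarr[OF weight_filtration_ideal] by (auto simp: weight_filtration_def[of _ _ 0])
next
  case False
  assume pq: "p \<le> q"
  have "(\<Union>i\<in>{i. i \<ge> int p}. G i) \<subseteq> weight_filtration A G p"
    using False G_closed by (simp add: weight_filtration_def) (intro A.genideal_self; auto)
  moreover have "(\<Union>i\<in>{i. i \<ge> int q}. G i) \<subseteq> (\<Union>i\<in>{i. i \<ge> int p}. G i)"
    using pq by (intro UN_mono) auto
  ultimately have "Idl (\<Union>i\<in>{i. i \<ge> int q}. G i) \<subseteq> weight_filtration A G p"
    by (intro A.genideal_minimal weight_filtration_ideal) blast
  then show ?thesis
    using False pq by (simp add: weight_filtration_def)
qed

lemma polynomial_filtration_ideal: "ideal (polynomial_filtration A G p) A"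
  using J_power_ideal by (simp add: polynomial_filtration_def J_def)

lemma polynomial_filtration_decreasing:
  "p \<le> q \<Longrightarrow> polynomial_filtration A G q \<subseteq> polynomial_filtration A G p"
  using J_power_decreasing by (simp add: polynomial_filtration_def J_def)

end


section \<open>External direct sums of graded families\<close>

lemma (in abelian_monoid) finsum_swap:
  assumes "finite S" "finite T" "\<And>s t. \<lbrakk>s \<in> S; t \<in> T\<rbrakk> \<Longrightarrow> f s t \<in> carrier G"
  shows "(\<Oplus>s\<in>S. \<Oplus>t\<in>T. f s t) = (\<Oplus>t\<in>T. \<Oplus>s\<in>S. f s t)"
  using assms(1,3)
proof (induction S rule: finite_induct)
  case empty
  then show ?case by simp
next
  case (insert s S)
  have "(\<Oplus>t\<in>T. \<Oplus>s\<in>insert s S. f s t) = (\<Oplus>t\<in>T. f s t \<oplus> (\<Oplus>s\<in>S. f s t))"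
    using insert by (intro finsum_cong') (auto intro!: finsum_insert)
  also have "\<dots> = (\<Oplus>t\<in>T. f s t) \<oplus> (\<Oplus>t\<in>T. \<Oplus>s\<in>S. f s t)"
    using insert by (intro finsum_addf) auto
  also have "\<dots> = (\<Oplus>s\<in>insert s S. \<Oplus>t\<in>T. f s t)"
    using insert by (subst finsum_insert) auto
  finally show ?case ..
qed

lemma (in abelian_monoid) finsum_nonzeroE:
  assumes "(\<Oplus>s\<in>S. f s) \<noteq> \<zero>"
  obtains s where "s \<in> S" "f s \<noteq> \<zero>"
  using assms add.finprod_one_eqI[of S f] by blast

text \<open>The limits in the different weights will be such a family inside a product of quotients.
  Nothing here makes the \<open>L r\<close> independent in \<open>P\<close>; the grading is created
  by the external sum.\<close>

locale graded_family = assoc_algebra R P for R and P (structure) +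
  fixes L :: "int \<Rightarrow> 'c set"
  assumes L_submodule: "\<And>r. submodule (L r) R P"
    and L_mult: "\<And>r s x y. \<lbrakk>x \<in> L r; y \<in> L s\<rbrakk> \<Longrightarrow> x \<otimes> y \<in> L (r + s)"
    and L_supercomm: "\<And>r s x y. \<lbrakk>x \<in> L r; y \<in> L s\<rbrakk> \<Longrightarrow> x \<otimes> y = koszul P r s (y \<otimes> x)"
    and L_one: "\<one> \<in> L 0"

text \<open>\<open>B\<close> is described by equations on its carrier instead of being constructed,
  so that the record \<open>completion\<close> itself is an instance.\<close>

locale external_sum = graded_family R P L
  for R and P :: "('k, 'a, 'p) module_scheme" (structure) and L +
  fixes B :: "('k, int \<Rightarrow> 'a) module"
  assumes B_carrier: "carrier B = {x. (\<forall>r. x r \<in> L r) \<and> finite {r. x r \<noteq> \<zero>}}"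
    and B_zero: "\<zero>\<^bsub>B\<^esub> = (\<lambda>r. \<zero>)"
    and B_one: "\<one>\<^bsub>B\<^esub> = (\<lambda>r. if r = 0 then \<one> else \<zero>)"
    and B_add: "\<And>x y. \<lbrakk>x \<in> carrier B; y \<in> carrier B\<rbrakk> \<Longrightarrow> x \<oplus>\<^bsub>B\<^esub> y = (\<lambda>r. x r \<oplus> y r)"
    and B_smult: "\<And>k x. \<lbrakk>k \<in> carrier R; x \<in> carrier B\<rbrakk> \<Longrightarrow> k \<odot>\<^bsub>B\<^esub> x = (\<lambda>r. k \<odot> x r)"
    and B_mult: "\<And>x y. \<lbrakk>x \<in> carrier B; y \<in> carrier B\<rbrakk> \<Longrightarrow>
      x \<otimes>\<^bsub>B\<^esub> y = (\<lambda>t. \<Oplus>r\<in>{r. x r \<noteq> \<zero>}. x r \<otimes> y (t - r))"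
begin

section \<open>Ring and module laws of the external sum\<close>

lemma L_subgroup: "additive_subgroup (L r) P"
  by (intro additive_subgroup.intro submodule.axioms(1)[OF L_submodule])

lemma L_closed: "x \<in> L r \<Longrightarrow> x \<in> carrier P"
  by (rule additive_subgroup.a_Hcarr[OF L_subgroup])

lemma L_zero: "\<zero> \<in> L r"
  by (rule additive_subgroup.zero_closed[OF L_subgroup])

lemma L_add: "\<lbrakk>x \<in> L r; y \<in> L r\<rbrakk> \<Longrightarrow> x \<oplus> y \<in> L r"
  by (rule additive_subgroup.a_closed[OF L_subgroup])

lemma L_uminus: "x \<in> L r \<Longrightarrow> \<ominus> x \<in> L r"
  by (rule additive_subgroup.a_inv_closed[OF L_subgroup])

lemma L_smult: "\<lbrakk>k \<in> carrier R; x \<in> L r\<rbrakk> \<Longrightarrow> k \<odot> x \<in> L r"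
  by (rule submodule.smult_closed[OF L_submodule])

lemma L_finsum: "\<lbrakk>finite S; \<And>s. s \<in> S \<Longrightarrow> f s \<in> L r\<rbrakk> \<Longrightarrow> (\<Oplus>s\<in>S. f s) \<in> L r"
proof (induction S rule: finite_induct)
  case (insert s S)
  then show ?case using L_add L_closed[of _ r] by (subst M.finsum_insert) auto
qed (simp add: L_zero)

lemma BI: "\<lbrakk>\<And>r. x r \<in> L r; finite S; \<And>r. x r \<noteq> \<zero> \<Longrightarrow> r \<in> S\<rbrakk> \<Longrightarrow> x \<in> carrier B"
  unfolding B_carrier by (auto intro: finite_subset[of _ S])

lemma B_L: "x \<in> carrier B \<Longrightarrow> x r \<in> L r"
  by (simp add: B_carrier)

lemma B_closed: "x \<in> carrier B \<Longrightarrow> x r \<in> carrier P"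
  using B_L L_closed by blast

lemma B_finite: "x \<in> carrier B \<Longrightarrow> finite {r. x r \<noteq> \<zero>}"
  by (simp add: B_carrier)

text \<open>The product is defined by a sum over the support of \<open>x\<close> alone. Padding it
  with zero terms gives a common index set for products with different left factors.\<close>

lemma B_mult_eq:
  assumes x: "x \<in> carrier B" and y: "y \<in> carrier B" and S: "finite S" "\<And>r. x r \<noteq> \<zero> \<Longrightarrow> r \<in> S"
  shows "(x \<otimes>\<^bsub>B\<^esub> y) t = (\<Oplus>r\<in>S. x r \<otimes> y (t - r))"
  unfolding B_mult[OF x y]
proof (rule M.add.finprod_mono_neutral_cong_left)
  show "x r \<otimes> y (t - r) = \<zero>" if "r \<in> S - {r. x r \<noteq> \<zero>}" for r
    using that B_closed[OF y] by auto
qed (use S B_closed[OF x] B_closed[OF y] in auto)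

lemma B_add_closed:
  assumes x: "x \<in> carrier B" and y: "y \<in> carrier B"
  shows "x \<oplus>\<^bsub>B\<^esub> y \<in> carrier B"
proof (rule BI)
  show "finite ({r. x r \<noteq> \<zero>} \<union> {r. y r \<noteq> \<zero>})" using B_finite x y by simp
  show "(x \<oplus>\<^bsub>B\<^esub> y) r \<in> L r" for r using B_L x y L_add by (simp add: B_add)
  show "r \<in> {r. x r \<noteq> \<zero>} \<union> {r. y r \<noteq> \<zero>}" if "(x \<oplus>\<^bsub>B\<^esub> y) r \<noteq> \<zero>" for r
    using that x y by (auto simp: B_add)
qed

lemma B_uminus_closed:
  assumes x: "x \<in> carrier B"
  shows "(\<lambda>r. \<ominus> x r) \<in> carrier B"
  using B_finite[OF x] B_L[OF x] L_uminus by (intro BI[of _ "{r. x r \<noteq> \<zero>}"]) auto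

lemma B_mult_closed:
  assumes x: "x \<in> carrier B" and y: "y \<in> carrier B"
  shows "x \<otimes>\<^bsub>B\<^esub> y \<in> carrier B"
proof (rule BI)
  let ?S = "(\<lambda>(r, u). r + u) ` ({r. x r \<noteq> \<zero>} \<times> {u. y u \<noteq> \<zero>})"
  show "finite ?S" using B_finite x y by simp
  show "(x \<otimes>\<^bsub>B\<^esub> y) t \<in> L t" for t
    unfolding B_mult[OF x y]
  proof (rule L_finsum)
    show "x r \<otimes> y (t - r) \<in> L t" for r
      using L_mult[OF B_L[OF x, of r] B_L[OF y, of "t - r"]] by simp
  qed (use B_finite x in simp)
  show "t \<in> ?S" if nz: "(x \<otimes>\<^bsub>B\<^esub> y) t \<noteq> \<zero>" for t
  proof -
    obtain r where "r \<in> {r. x r \<noteq> \<zero>}" "x r \<otimes> y (t - r) \<noteq> \<zero>"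
      using nz[unfolded B_mult[OF x y]] by (rule M.finsum_nonzeroE)
    moreover from this have "y (t - r) \<noteq> \<zero>" using B_closed[OF x] by auto
    ultimately show ?thesis by (intro image_eqI[of _ _ "(r, t - r)"]) auto
  qed
qed

lemma B_mult_assoc:
  assumes x: "x \<in> carrier B" and y: "y \<in> carrier B" and z: "z \<in> carrier B"
  shows "(x \<otimes>\<^bsub>B\<^esub> y) \<otimes>\<^bsub>B\<^esub> z = x \<otimes>\<^bsub>B\<^esub> (y \<otimes>\<^bsub>B\<^esub> z)"
proof
  fix t
  define X where "X = {r. x r \<noteq> \<zero>}"
  define Y where "Y = {r. y r \<noteq> \<zero>}"
  \<comment> \<open>All sums of a weight of \<open>x\<close> and a weight of \<open>y\<close>: this
    contains the support of the product and, for each \<open>r\<close> in \<open>X\<close>, the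
    translate of \<open>Y\<close> by \<open>r\<close>.\<close>
  define S where "S = (\<lambda>(r, u). r + u) ` (X \<times> Y)"
  have fin: "finite X" "finite Y" "finite S" using B_finite x y by (auto simp: X_def Y_def S_def)
  have c: "x r \<in> carrier P" "y r \<in> carrier P" "z r \<in> carrier P" for r
    using B_closed x y z by auto
  have supp: "s \<in> S" if nz: "(x \<otimes>\<^bsub>B\<^esub> y) s \<noteq> \<zero>" for s
  proof -
    obtain r where "r \<in> X" "x r \<otimes> y (s - r) \<noteq> \<zero>"
      using nz[unfolded B_mult[OF x y], folded X_def] by (rule M.finsum_nonzeroE)
    moreover from this have "y (s - r) \<noteq> \<zero>" using c by auto
    ultimately show ?thesis unfolding S_def Y_def by (intro image_eqI[of _ _ "(r, s - r)"]) auto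
  qed
  \<comment> \<open>The substitution is \<open>s = r + u\<close>; indices of \<open>S\<close>
    outside the translate of \<open>Y\<close> contribute zero.\<close>
  have inner: "(\<Oplus>s\<in>S. y (s - r) \<otimes> z (t - s)) = (y \<otimes>\<^bsub>B\<^esub> z) (t - r)" if r: "r \<in> X" for r
  proof -
    have "(y \<otimes>\<^bsub>B\<^esub> z) (t - r) = (\<Oplus>u\<in>Y. y u \<otimes> z (t - r - u))"
      using fin by (intro B_mult_eq y z) (auto simp: Y_def)
    also have "\<dots> = (\<Oplus>u\<in>Y. y ((r + u) - r) \<otimes> z (t - (r + u)))"
      using c by (intro M.finsum_cong') (auto simp: algebra_simps)
    also have "\<dots> = (\<Oplus>s\<in>(\<lambda>u. r + u) ` Y. y (s - r) \<otimes> z (t - s))"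
      using c by (intro M.finsum_reindex[symmetric]) (auto simp: inj_on_def)
    also have "\<dots> = (\<Oplus>s\<in>S. y (s - r) \<otimes> z (t - s))"
    proof (rule M.add.finprod_mono_neutral_cong_left)
      show "(\<lambda>u. r + u) ` Y \<subseteq> S" using r by (auto simp: S_def)
      show "y (s - r) \<otimes> z (t - s) = \<zero>" if s: "s \<in> S - (\<lambda>u. r + u) ` Y" for s
      proof -
        have "s - r \<notin> Y" using s image_eqI[of s "\<lambda>u. r + u" "s - r" Y] by auto
        then show ?thesis using c by (simp add: Y_def)
      qed
    qed (use c fin in auto)
    finally show ?thesis ..
  qed
  have "((x \<otimes>\<^bsub>B\<^esub> y) \<otimes>\<^bsub>B\<^esub> z) t = (\<Oplus>s\<in>S. (x \<otimes>\<^bsub>B\<^esub> y) s \<otimes> z (t - s))"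
    using fin supp by (intro B_mult_eq B_mult_closed x y z) auto
  also have "\<dots> = (\<Oplus>s\<in>S. \<Oplus>r\<in>X. x r \<otimes> (y (s - r) \<otimes> z (t - s)))"
  proof (intro M.finsum_cong' refl)
    fix s
    have "(x \<otimes>\<^bsub>B\<^esub> y) s \<otimes> z (t - s) = (\<Oplus>r\<in>X. x r \<otimes> y (s - r) \<otimes> z (t - s))"
      using c fin unfolding B_mult[OF x y] X_def[symmetric] by (intro A.finsum_ldistr) auto
    also have "\<dots> = (\<Oplus>r\<in>X. x r \<otimes> (y (s - r) \<otimes> z (t - s)))"
      using c by (intro M.finsum_cong') (auto simp: A.m_assoc)
    finally show "(x \<otimes>\<^bsub>B\<^esub> y) s \<otimes> z (t - s) = \<dots>" .
  qed (use c in auto)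
  also have "\<dots> = (\<Oplus>r\<in>X. \<Oplus>s\<in>S. x r \<otimes> (y (s - r) \<otimes> z (t - s)))"
    using c fin by (intro M.finsum_swap) auto
  also have "\<dots> = (\<Oplus>r\<in>X. x r \<otimes> (y \<otimes>\<^bsub>B\<^esub> z) (t - r))"
  proof (intro M.finsum_cong' refl)
    fix r assume r: "r \<in> X"
    have "(\<Oplus>s\<in>S. x r \<otimes> (y (s - r) \<otimes> z (t - s))) =
        x r \<otimes> (\<Oplus>s\<in>S. y (s - r) \<otimes> z (t - s))"
      using c fin by (intro A.finsum_rdistr[symmetric]) auto
    then show "(\<Oplus>s\<in>S. x r \<otimes> (y (s - r) \<otimes> z (t - s))) = x r \<otimes> (y \<otimes>\<^bsub>B\<^esub> z) (t - r)"
      using inner[OF r] by simp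
  qed (use c B_closed[OF B_mult_closed[OF y z]] in auto)
  also have "\<dots> = (x \<otimes>\<^bsub>B\<^esub> (y \<otimes>\<^bsub>B\<^esub> z)) t"
    using B_mult[OF x B_mult_closed[OF y z]] by (simp add: X_def)
  finally show "((x \<otimes>\<^bsub>B\<^esub> y) \<otimes>\<^bsub>B\<^esub> z) t = (x \<otimes>\<^bsub>B\<^esub> (y \<otimes>\<^bsub>B\<^esub> z)) t" .
qed

lemma B_one_closed: "\<one>\<^bsub>B\<^esub> \<in> carrier B"
  by (rule BI[of _ "{0}"]) (auto simp: B_one L_one L_zero split: if_splits)

lemma B_l_one:
  assumes x: "x \<in> carrier B"
  shows "\<one>\<^bsub>B\<^esub> \<otimes>\<^bsub>B\<^esub> x = x"
proof
  fix t
  have "(\<one>\<^bsub>B\<^esub> \<otimes>\<^bsub>B\<^esub> x) t = (\<Oplus>r\<in>{0}. \<one>\<^bsub>B\<^esub> r \<otimes> x (t - r))"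
    by (intro B_mult_eq B_one_closed x) (auto simp: B_one split: if_splits)
  then show "(\<one>\<^bsub>B\<^esub> \<otimes>\<^bsub>B\<^esub> x) t = x t"
    using B_closed[OF x] by (simp add: B_one)
qed

lemma B_r_one:
  assumes x: "x \<in> carrier B"
  shows "x \<otimes>\<^bsub>B\<^esub> \<one>\<^bsub>B\<^esub> = x"
proof
  fix t
  \<comment> \<open>The weight \<open>t\<close> is added so that the single surviving term has an
    index even if \<open>x t\<close> is zero.\<close>
  have "(x \<otimes>\<^bsub>B\<^esub> \<one>\<^bsub>B\<^esub>) t = (\<Oplus>r\<in>insert t {r. x r \<noteq> \<zero>}. x r \<otimes> \<one>\<^bsub>B\<^esub> (t - r))"
    using B_finite[OF x] by (intro B_mult_eq B_one_closed x) auto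
  also have "\<dots> = (\<Oplus>r\<in>insert t {r. x r \<noteq> \<zero>}. if t = r then x r else \<zero>)"
    using B_closed[OF x] by (intro M.finsum_cong') (auto simp: B_one)
  also have "\<dots> = x t"
    using B_finite[OF x] B_closed[OF x] by (intro M.finsum_singleton) auto
  finally show "(x \<otimes>\<^bsub>B\<^esub> \<one>\<^bsub>B\<^esub>) t = x t" .
qed

lemma B_distr:
  assumes x: "x \<in> carrier B" and y: "y \<in> carrier B" and z: "z \<in> carrier B"
  shows "(x \<oplus>\<^bsub>B\<^esub> y) \<otimes>\<^bsub>B\<^esub> z = x \<otimes>\<^bsub>B\<^esub> z \<oplus>\<^bsub>B\<^esub> y \<otimes>\<^bsub>B\<^esub> z"
    and "z \<otimes>\<^bsub>B\<^esub> (x \<oplus>\<^bsub>B\<^esub> y) = z \<otimes>\<^bsub>B\<^esub> x \<oplus>\<^bsub>B\<^esub> z \<otimes>\<^bsub>B\<^esub> y"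
proof -
  define S where "S = {r. x r \<noteq> \<zero>} \<union> {r. y r \<noteq> \<zero>} \<union> {r. z r \<noteq> \<zero>}"
  have S: "finite S" "\<And>r. x r \<noteq> \<zero> \<Longrightarrow> r \<in> S" "\<And>r. y r \<noteq> \<zero> \<Longrightarrow> r \<in> S" "\<And>r. z r \<noteq> \<zero> \<Longrightarrow> r \<in> S"
    using B_finite x y z by (auto simp: S_def)
  have xy: "r \<in> S" if "(x \<oplus>\<^bsub>B\<^esub> y) r \<noteq> \<zero>" for r
    using that x y by (auto simp: B_add S_def)
  have c: "x r \<in> carrier P" "y r \<in> carrier P" "z r \<in> carrier P" for r
    using B_closed x y z by auto
  have "((x \<oplus>\<^bsub>B\<^esub> y) \<otimes>\<^bsub>B\<^esub> z) t = (x \<otimes>\<^bsub>B\<^esub> z \<oplus>\<^bsub>B\<^esub> y \<otimes>\<^bsub>B\<^esub> z) t" for t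
  proof -
    have "((x \<oplus>\<^bsub>B\<^esub> y) \<otimes>\<^bsub>B\<^esub> z) t = (\<Oplus>r\<in>S. (x \<oplus>\<^bsub>B\<^esub> y) r \<otimes> z (t - r))"
      using xy S by (intro B_mult_eq B_add_closed x y z)
    also have "\<dots> = (\<Oplus>r\<in>S. x r \<otimes> z (t - r) \<oplus> y r \<otimes> z (t - r))"
      using c by (intro M.finsum_cong') (auto simp: B_add[OF x y] A.l_distr)
    also have "\<dots> = (\<Oplus>r\<in>S. x r \<otimes> z (t - r)) \<oplus> (\<Oplus>r\<in>S. y r \<otimes> z (t - r))"
      using c by (intro M.finsum_addf) auto
    also have "\<dots> = (x \<otimes>\<^bsub>B\<^esub> z) t \<oplus> (y \<otimes>\<^bsub>B\<^esub> z) t"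
      using B_mult_eq[OF x z S(1,2)] B_mult_eq[OF y z S(1,3)] by simp
    finally show ?thesis using x y z by (simp add: B_add B_mult_closed)
  qed
  then show "(x \<oplus>\<^bsub>B\<^esub> y) \<otimes>\<^bsub>B\<^esub> z = x \<otimes>\<^bsub>B\<^esub> z \<oplus>\<^bsub>B\<^esub> y \<otimes>\<^bsub>B\<^esub> z" ..
  have "(z \<otimes>\<^bsub>B\<^esub> (x \<oplus>\<^bsub>B\<^esub> y)) t = (z \<otimes>\<^bsub>B\<^esub> x \<oplus>\<^bsub>B\<^esub> z \<otimes>\<^bsub>B\<^esub> y) t" for t
  proof -
    have "(z \<otimes>\<^bsub>B\<^esub> (x \<oplus>\<^bsub>B\<^esub> y)) t = (\<Oplus>r\<in>S. z r \<otimes> (x \<oplus>\<^bsub>B\<^esub> y) (t - r))"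
      using S by (intro B_mult_eq B_add_closed x y z)
    also have "\<dots> = (\<Oplus>r\<in>S. z r \<otimes> x (t - r) \<oplus> z r \<otimes> y (t - r))"
      using c by (intro M.finsum_cong') (auto simp: B_add[OF x y] A.r_distr)
    also have "\<dots> = (\<Oplus>r\<in>S. z r \<otimes> x (t - r)) \<oplus> (\<Oplus>r\<in>S. z r \<otimes> y (t - r))"
      using c by (intro M.finsum_addf) auto
    also have "\<dots> = (z \<otimes>\<^bsub>B\<^esub> x) t \<oplus> (z \<otimes>\<^bsub>B\<^esub> y) t"
      using B_mult_eq[OF z x S(1,4)] B_mult_eq[OF z y S(1,4)] by simp
    finally show ?thesis using x y z by (simp add: B_add B_mult_closed)
  qed
  then show "z \<otimes>\<^bsub>B\<^esub> (x \<oplus>\<^bsub>B\<^esub> y) = z \<otimes>\<^bsub>B\<^esub> x \<oplus>\<^bsub>B\<^esub> z \<otimes>\<^bsub>B\<^esub> y" ..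
qed

lemma B_zero_closed: "\<zero>\<^bsub>B\<^esub> \<in> carrier B"
  by (rule BI[of _ "{}"]) (auto simp: B_zero L_zero)

lemma B_abelian_group: "abelian_group B"
proof (rule abelian_groupI)
  fix x assume x: "x \<in> carrier B"
  show "\<exists>y\<in>carrier B. y \<oplus>\<^bsub>B\<^esub> x = \<zero>\<^bsub>B\<^esub>"
    using B_closed[OF x] B_add[OF B_uminus_closed[OF x] x]
    by (intro bexI[OF _ B_uminus_closed[OF x]]) (simp add: B_zero M.l_neg)
  show "\<zero>\<^bsub>B\<^esub> \<oplus>\<^bsub>B\<^esub> x = x"
    using x B_closed[OF x] by (simp add: B_add B_zero_closed) (simp add: B_zero)
next
  fix x y assume "x \<in> carrier B" "y \<in> carrier B"
  then show "x \<oplus>\<^bsub>B\<^esub> y = y \<oplus>\<^bsub>B\<^esub> x"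
    by (simp add: B_add M.a_comm B_closed)
next
  fix x y z assume "x \<in> carrier B" "y \<in> carrier B" "z \<in> carrier B"
  then show "x \<oplus>\<^bsub>B\<^esub> y \<oplus>\<^bsub>B\<^esub> z = x \<oplus>\<^bsub>B\<^esub> (y \<oplus>\<^bsub>B\<^esub> z)"
    using B_add_closed[of x y] B_add_closed[of y z] by (simp add: B_add M.a_assoc B_closed)
qed (use B_zero_closed B_add_closed in auto)

lemma B_ring: "ring B"
proof (rule ringI)
  show "Group.monoid B"
    by (rule monoidI) (simp_all add: B_mult_closed B_one_closed B_mult_assoc B_l_one B_r_one)
qed (simp_all add: B_abelian_group B_distr)

lemma B_smult_closed:
  assumes "k \<in> carrier R" "x \<in> carrier B"
  shows "k \<odot>\<^bsub>B\<^esub> x \<in> carrier B"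
proof (rule BI)
  show "finite {r. x r \<noteq> \<zero>}" using assms B_finite by blast
  show "(k \<odot>\<^bsub>B\<^esub> x) r \<in> L r" for r using assms B_L L_smult by (simp add: B_smult)
  show "r \<in> {r. x r \<noteq> \<zero>}" if "(k \<odot>\<^bsub>B\<^esub> x) r \<noteq> \<zero>" for r
    using that assms by (auto simp: B_smult)
qed

lemma B_module: "module R B"
proof (rule moduleI)
  show "cring R" ..
  fix a b x y assume a: "a \<in> carrier R" and x: "x \<in> carrier B"
  note c = B_closed[OF x]
  show "a \<odot>\<^bsub>B\<^esub> (x \<oplus>\<^bsub>B\<^esub> y) = a \<odot>\<^bsub>B\<^esub> x \<oplus>\<^bsub>B\<^esub> a \<odot>\<^bsub>B\<^esub> y" if "y \<in> carrier B"
    using a x that B_add_closed[OF x that] B_smult_closed[of a]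
    by (simp add: B_add B_smult_closed) (simp add: B_smult B_add smult_r_distr B_closed)
  assume b: "b \<in> carrier R"
  show "(a \<oplus>\<^bsub>R\<^esub> b) \<odot>\<^bsub>B\<^esub> x = a \<odot>\<^bsub>B\<^esub> x \<oplus>\<^bsub>B\<^esub> b \<odot>\<^bsub>B\<^esub> x"
    using a b x by (simp add: B_add B_smult_closed) (simp add: B_smult smult_l_distr B_closed)
  have "b \<odot>\<^bsub>B\<^esub> x \<in> carrier B" using b x by (rule B_smult_closed)
  then show "(a \<otimes>\<^bsub>R\<^esub> b) \<odot>\<^bsub>B\<^esub> x = a \<odot>\<^bsub>B\<^esub> (b \<odot>\<^bsub>B\<^esub> x)"
    using a b x by (simp add: B_smult[of a]) (simp add: B_smult smult_assoc1 B_closed)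
next
  fix x assume x: "x \<in> carrier B"
  then show "\<one>\<^bsub>R\<^esub> \<odot>\<^bsub>B\<^esub> x = x"
    by (simp add: B_smult B_closed)
qed (simp_all add: B_abelian_group B_smult_closed)

lemma B_algebra: "assoc_algebra R B"
proof (intro assoc_algebra.intro assoc_algebra_axioms.intro B_module B_ring)
  fix k x y assume k: "k \<in> carrier R" and x: "x \<in> carrier B" and y: "y \<in> carrier B"
  define S where "S = {r. x r \<noteq> \<zero>}"
  have S: "finite S" "\<And>r. x r \<noteq> \<zero> \<Longrightarrow> r \<in> S" "\<And>r. (k \<odot>\<^bsub>B\<^esub> x) r \<noteq> \<zero> \<Longrightarrow> r \<in> S"
    using B_finite x k by (auto simp: S_def B_smult)
  have c: "x r \<in> carrier P" "y r \<in> carrier P" for r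
    using B_closed x y by auto
  have eq: "(k \<odot>\<^bsub>B\<^esub> (x \<otimes>\<^bsub>B\<^esub> y)) t = (\<Oplus>r\<in>S. k \<odot> (x r \<otimes> y (t - r)))" for t
    using k x y c S by (simp add: B_smult B_mult_closed B_mult_eq[OF x y S(1,2)] finsum_smult_ldistr)
  have eq_l: "((k \<odot>\<^bsub>B\<^esub> x) \<otimes>\<^bsub>B\<^esub> y) t = (\<Oplus>r\<in>S. (k \<odot>\<^bsub>B\<^esub> x) r \<otimes> y (t - r))"
    and eq_r: "(x \<otimes>\<^bsub>B\<^esub> (k \<odot>\<^bsub>B\<^esub> y)) t = (\<Oplus>r\<in>S. x r \<otimes> (k \<odot>\<^bsub>B\<^esub> y) (t - r))" for t
    using S by (intro B_mult_eq B_smult_closed k x y; blast)+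
  have "((k \<odot>\<^bsub>B\<^esub> x) \<otimes>\<^bsub>B\<^esub> y) t = (k \<odot>\<^bsub>B\<^esub> (x \<otimes>\<^bsub>B\<^esub> y)) t" for t
    unfolding eq eq_l
    using k c by (intro M.finsum_cong') (auto simp: B_smult[OF k x] smult_mult_l)
  then show "(k \<odot>\<^bsub>B\<^esub> x) \<otimes>\<^bsub>B\<^esub> y = k \<odot>\<^bsub>B\<^esub> (x \<otimes>\<^bsub>B\<^esub> y)" ..
  have "(x \<otimes>\<^bsub>B\<^esub> (k \<odot>\<^bsub>B\<^esub> y)) t = (k \<odot>\<^bsub>B\<^esub> (x \<otimes>\<^bsub>B\<^esub> y)) t" for t
    unfolding eq eq_r
    using k c by (intro M.finsum_cong') (auto simp: B_smult[OF k y] smult_mult_r)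
  then show "x \<otimes>\<^bsub>B\<^esub> (k \<odot>\<^bsub>B\<^esub> y) = k \<odot>\<^bsub>B\<^esub> (x \<otimes>\<^bsub>B\<^esub> y)" ..
qed

sublocale B: assoc_algebra R B
  by (rule B_algebra)

lemma B_uminus: "x \<in> carrier B \<Longrightarrow> \<ominus>\<^bsub>B\<^esub> x = (\<lambda>r. \<ominus> x r)"
  using B_uminus_closed[of x] B_add[OF B_uminus_closed[of x], of x] B_closed[of x]
  by (intro B.M.minus_equality) (auto simp: B_zero M.l_neg)

lemma B_finsum:
  "\<lbrakk>finite S; \<And>s. s \<in> S \<Longrightarrow> f s \<in> carrier B\<rbrakk> \<Longrightarrow> (\<Oplus>\<^bsub>B\<^esub>s\<in>S. f s) t = (\<Oplus>s\<in>S. f s t)"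
proof (induction S rule: finite_induct)
  case (insert s S)
  have "(\<Oplus>\<^bsub>B\<^esub>s\<in>insert s S. f s) = f s \<oplus>\<^bsub>B\<^esub> (\<Oplus>\<^bsub>B\<^esub>s\<in>S. f s)"
    using insert by (intro B.M.finsum_insert) auto
  moreover have "(\<Oplus>\<^bsub>B\<^esub>s\<in>S. f s) \<in> carrier B"
    using insert by (intro B.M.finsum_closed) auto
  ultimately show ?case
    using insert B_closed by (simp add: B_add Pi_def)
qed (simp add: B_zero)

section \<open>The grading of the external sum\<close>

definition comp :: "int \<Rightarrow> (int \<Rightarrow> 'a) set" where
  "comp r = {x \<in> carrier B. \<forall>s. s \<noteq> r \<longrightarrow> x s = \<zero>}"

lemma comp_mult:
  assumes x: "x \<in> comp r" and y: "y \<in> comp s"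
  shows "(x \<otimes>\<^bsub>B\<^esub> y) t = (if t = r + s then x r \<otimes> y s else \<zero>)"
proof -
  have x': "x \<in> carrier B" "\<And>s. s \<noteq> r \<Longrightarrow> x s = \<zero>"
    and y': "y \<in> carrier B" "\<And>t. t \<noteq> s \<Longrightarrow> y t = \<zero>"
    using x y by (auto simp: comp_def)
  have "(x \<otimes>\<^bsub>B\<^esub> y) t = (\<Oplus>u\<in>{r}. x u \<otimes> y (t - u))"
    using x'(2) by (intro B_mult_eq x' y') auto
  then show ?thesis
    using y'(2)[of "t - r"] B_closed[OF x'(1)] B_closed[OF y'(1)] by auto
qed

lemma comp_submodule: "submodule (comp r) R B"
proof (rule B.submoduleI)
  show "\<ominus>\<^bsub>B\<^esub> x \<in> comp r" if "x \<in> comp r" for x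
    using that B_uminus_closed[of x] by (auto simp: comp_def B_uminus)
  show "x \<oplus>\<^bsub>B\<^esub> y \<in> comp r" if "x \<in> comp r" "y \<in> comp r" for x y
    using that B_add_closed[of x y] by (auto simp: comp_def B_add)
  show "k \<odot>\<^bsub>B\<^esub> x \<in> comp r" if "k \<in> carrier R" "x \<in> comp r" for k x
    using that B_smult_closed[of k x] by (auto simp: comp_def B_smult)
  show "\<zero>\<^bsub>B\<^esub> \<in> comp r" using B_zero_closed by (simp add: comp_def B_zero)
qed (auto simp: comp_def)

lemma comp_decomposition:
  assumes x: "x \<in> carrier B"
  shows "\<exists>!a. (\<forall>r. a r \<in> comp r) \<and> finite {r. a r \<noteq> \<zero>\<^bsub>B\<^esub>} \<and> x = (\<Oplus>\<^bsub>B\<^esub>r\<in>{r. a r \<noteq> \<zero>\<^bsub>B\<^esub>}. a r)"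
proof -
  define a where "a r = (\<lambda>s. if s = r then x r else \<zero>)" for r
  have a: "a r \<in> comp r" for r
    unfolding comp_def using B_L[OF x] L_zero
    by (auto simp: a_def split: if_splits intro!: BI[of _ "{r}"])
  have supp: "{r. a r \<noteq> \<zero>\<^bsub>B\<^esub>} = {r. x r \<noteq> \<zero>}"
    by (auto simp: a_def B_zero fun_eq_iff)
  \<comment> \<open>A family of homogeneous elements is recovered from its sum by reading the
    coordinate \<open>t\<close>; this yields both existence and uniqueness of the
    decomposition.\<close>
  have sum_at: "(\<Oplus>\<^bsub>B\<^esub>r\<in>{r. b r \<noteq> \<zero>\<^bsub>B\<^esub>}. b r) t = b t t"
    if b: "\<And>r. b r \<in> comp r" and fin: "finite {r. b r \<noteq> \<zero>\<^bsub>B\<^esub>}" for b t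
  proof -
    have bB: "b r \<in> carrier B" for r using b by (auto simp: comp_def)
    have "(\<Oplus>\<^bsub>B\<^esub>r\<in>{r. b r \<noteq> \<zero>\<^bsub>B\<^esub>}. b r) t = (\<Oplus>r\<in>{r. b r \<noteq> \<zero>\<^bsub>B\<^esub>}. b r t)"
      using fin bB by (intro B_finsum) auto
    also have "\<dots> = (\<Oplus>r\<in>insert t {r. b r \<noteq> \<zero>\<^bsub>B\<^esub>}. if t = r then b r t else \<zero>)"
    proof (rule M.add.finprod_mono_neutral_cong_left)
      show "b r t = (if t = r then b r t else \<zero>)" for r
        using b[of r] by (simp add: comp_def)
      show "(if t = r then b r t else \<zero>) = \<zero>"
        if "r \<in> insert t {r. b r \<noteq> \<zero>\<^bsub>B\<^esub>} - {r. b r \<noteq> \<zero>\<^bsub>B\<^esub>}" for r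
        using that by (auto simp: B_zero)
    qed (use fin B_closed[OF bB] in auto)
    also have "\<dots> = b t t"
      using fin B_closed[OF bB] by (intro M.finsum_singleton) auto
    finally show ?thesis .
  qed
  show ?thesis
  proof (rule ex1I[of _ a])
    have "finite {r. a r \<noteq> \<zero>\<^bsub>B\<^esub>}" unfolding supp by (rule B_finite[OF x])
    moreover from this have "x t = (\<Oplus>\<^bsub>B\<^esub>r\<in>{r. a r \<noteq> \<zero>\<^bsub>B\<^esub>}. a r) t" for t
      using sum_at[OF a] by (simp add: a_def)
    ultimately show "(\<forall>r. a r \<in> comp r) \<and> finite {r. a r \<noteq> \<zero>\<^bsub>B\<^esub>} \<and>
        x = (\<Oplus>\<^bsub>B\<^esub>r\<in>{r. a r \<noteq> \<zero>\<^bsub>B\<^esub>}. a r)"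
      using a by blast
  next
    fix b assume b: "(\<forall>r. b r \<in> comp r) \<and> finite {r. b r \<noteq> \<zero>\<^bsub>B\<^esub>} \<and>
        x = (\<Oplus>\<^bsub>B\<^esub>r\<in>{r. b r \<noteq> \<zero>\<^bsub>B\<^esub>}. b r)"
    then have "x t = b t t" for t using sum_at[of b t] by simp
    then show "b = a"
      using b by (intro ext) (simp add: a_def comp_def)
  qed
qed

lemma B_graded: "graded_supercomm_algebra R B comp"
  unfolding graded_supercomm_algebra_def
proof (intro conjI ballI allI B_ring B_module comp_submodule comp_decomposition)
  show "\<one>\<^bsub>B\<^esub> \<in> comp 0" using B_one_closed by (auto simp: comp_def B_one)
  fix r s x y assume x: "x \<in> comp r" and y: "y \<in> comp s"
  have xB: "x \<in> carrier B" and yB: "y \<in> carrier B" using x y by (auto simp: comp_def)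
  show "x \<otimes>\<^bsub>B\<^esub> y \<in> comp (r + s)"
    using B_mult_closed[OF xB yB] comp_mult[OF x y] by (simp add: comp_def)
  have "(x \<otimes>\<^bsub>B\<^esub> y) t = koszul B r s (y \<otimes>\<^bsub>B\<^esub> x) t" for t
    using L_supercomm[OF B_L[OF xB, of r] B_L[OF yB, of s]]
    by (simp add: koszul_def B_uminus B_mult_closed xB yB comp_mult[OF x y] comp_mult[OF y x] add.commute)
  then show "x \<otimes>\<^bsub>B\<^esub> y = koszul B r s (y \<otimes>\<^bsub>B\<^esub> x)" ..
qed (use B.smult_mult_l B.smult_mult_r in auto)

end

text \<open>The isomorphism applies \<open>\<eta>\<close> to each coordinate. Bijectivity between
  corresponding \<open>L r\<close> is enough, because the coordinates of an element of
  \<open>B\<close> lie there.\<close>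

lemma external_sum_isomorphic:
  fixes R (structure)
  assumes "external_sum R P L B" "external_sum R P' L' B'"
    and \<eta>: "\<eta> \<in> ring_hom P P'"
    and \<eta>_smult: "\<And>k x. \<lbrakk>k \<in> carrier R; x \<in> carrier P\<rbrakk> \<Longrightarrow> \<eta> (k \<odot>\<^bsub>P\<^esub> x) = k \<odot>\<^bsub>P'\<^esub> \<eta> x"
    and bij: "\<And>r. bij_betw \<eta> (L r) (L' r)"
  shows "isomorphic_graded_supercomm_algebras R B (external_sum.comp P B) B' (external_sum.comp P' B')"
proof -
  interpret X: external_sum R P L B by fact
  interpret Y: external_sum R P' L' B' by fact
  have \<eta>0: "\<eta> \<zero>\<^bsub>P\<^esub> = \<zero>\<^bsub>P'\<^esub>" by (rule ring_hom_zero[OF \<eta> X.ring_M Y.ring_M])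
  \<comment> \<open>Injectivity on \<open>L r\<close>, which contains zero, makes the coordinatewise
    map preserve supports, so the sums in the two products run over the same index set.\<close>
  have \<eta>0_iff: "\<eta> x = \<zero>\<^bsub>P'\<^esub> \<longleftrightarrow> x = \<zero>\<^bsub>P\<^esub>" if "x \<in> L r" for x r
    using bij_betw_imp_inj_on[OF bij[of r]] that X.L_zero[of r] \<eta>0 by (metis inj_onD)
  have \<eta>L: "\<eta> x \<in> L' r" if "x \<in> L r" for x r
    using bij[of r] that by (rule bij_betwE[rule_format])
  define h where "h x = (\<lambda>r. \<eta> (x r))" for x :: "int \<Rightarrow> _"
  have supp: "{r. h x r \<noteq> \<zero>\<^bsub>P'\<^esub>} = {r. x r \<noteq> \<zero>\<^bsub>P\<^esub>}" if "x \<in> carrier B" for x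
    using \<eta>0_iff X.B_L[OF that] by (auto simp: h_def)
  have h_closed: "h x \<in> carrier B'" if "x \<in> carrier B" for x
    using supp[OF that] X.B_finite[OF that] \<eta>L X.B_L[OF that] by (simp add: Y.B_carrier h_def)
  have \<eta>_finsum: "\<eta> (\<Oplus>\<^bsub>P\<^esub>s\<in>S. f s) = (\<Oplus>\<^bsub>P'\<^esub>s\<in>S. \<eta> (f s))"
    if "finite S" "\<And>s. s \<in> S \<Longrightarrow> f s \<in> carrier P" for S and f :: "int \<Rightarrow> _"
    using that
  proof (induction S rule: finite_induct)
    case (insert s S)
    then show ?case using ring_hom_add[OF \<eta>] ring_hom_closed[OF \<eta>] by (simp add: Pi_def)
  qed (simp add: \<eta>0)
  have hom: "h \<in> ring_hom B B'"
  proof (rule ring_hom_memI)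
    fix x y assume x: "x \<in> carrier B" and y: "y \<in> carrier B"
    have c: "x r \<in> carrier P" "y r \<in> carrier P" for r using X.B_closed x y by auto
    show "h (x \<oplus>\<^bsub>B\<^esub> y) = h x \<oplus>\<^bsub>B'\<^esub> h y"
      unfolding X.B_add[OF x y] Y.B_add[OF h_closed[OF x] h_closed[OF y]]
      using ring_hom_add[OF \<eta>] c by (simp add: h_def)
    show "h (x \<otimes>\<^bsub>B\<^esub> y) = h x \<otimes>\<^bsub>B'\<^esub> h y"
      unfolding X.B_mult[OF x y] Y.B_mult[OF h_closed[OF x] h_closed[OF y]] supp[OF x]
      using ring_hom_mult[OF \<eta>] ring_hom_closed[OF \<eta>] c X.B_finite[OF x]
      by (simp add: h_def \<eta>_finsum)
  next
    show "h \<one>\<^bsub>B\<^esub> = \<one>\<^bsub>B'\<^esub>"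
      using ring_hom_one[OF \<eta>] \<eta>0 by (auto simp: h_def X.B_one Y.B_one)
  qed (rule h_closed)
  have inj: "inj_on h (carrier B)"
  proof (rule inj_onI)
    fix x y assume x: "x \<in> carrier B" and y: "y \<in> carrier B" and eq: "h x = h y"
    have "x r = y r" for r
    proof -
      have "\<eta> (x r) = \<eta> (y r)" using fun_cong[OF eq, of r] by (simp only: h_def)
      then show ?thesis
        using X.B_L[OF x] X.B_L[OF y] by (rule inj_onD[OF bij_betw_imp_inj_on[OF bij[of r]]])
    qed
    then show "x = y" ..
  qed
  have surj: "\<exists>x. x \<in> carrier B \<and> h x = y \<and> (\<forall>r. y r = \<zero>\<^bsub>P'\<^esub> \<longrightarrow> x r = \<zero>\<^bsub>P\<^esub>)" if y: "y \<in> carrier B'" for y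
  proof -
    define x where "x r = inv_into (L r) \<eta> (y r)" for r
    have yr: "y r \<in> \<eta> ` L r" for r
      unfolding bij_betw_imp_surj_on[OF bij] by (rule Y.B_L[OF y])
    have x: "x r \<in> L r" "\<eta> (x r) = y r" for r
      using inv_into_into[OF yr, of r] f_inv_into_f[OF yr, of r] by (simp_all only: x_def)
    have x0: "x r = \<zero>\<^bsub>P\<^esub> \<longleftrightarrow> y r = \<zero>\<^bsub>P'\<^esub>" for r
      using \<eta>0_iff[OF x(1)[of r]] x(2)[of r] by auto
    then have "x \<in> carrier B"
      using x(1) Y.B_finite[OF y] by (simp add: X.B_carrier)
    moreover have "h x = y" using x(2) by (simp add: h_def)
    ultimately show ?thesis using x0 by blast
  qed
  have "bij_betw h (carrier B) (carrier B')"
    unfolding bij_betw_def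
  proof (intro conjI inj equalityI subsetI)
    fix y assume "y \<in> carrier B'"
    then show "y \<in> h ` carrier B" using surj[of y] by blast
  qed (use h_closed in blast)
  then have "h \<in> ring_iso B B'" using hom by (simp add: ring_iso_def)
  moreover have "h (k \<odot>\<^bsub>B\<^esub> x) = k \<odot>\<^bsub>B'\<^esub> h x" if "k \<in> carrier R" "x \<in> carrier B" for k x
    using that h_closed[OF that(2)] \<eta>_smult X.B_closed by (simp add: X.B_smult Y.B_smult) (simp add: h_def)
  moreover have "h ` external_sum.comp P B r = external_sum.comp P' B' r" for r
  proof
    show "h ` X.comp r \<subseteq> Y.comp r"
      using h_closed \<eta>0 by (auto simp: X.comp_def Y.comp_def h_def)
    show "Y.comp r \<subseteq> h ` X.comp r"
    proof
      fix y assume "y \<in> Y.comp r"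
      then obtain x where "x \<in> carrier B" "h x = y" "\<And>s. s \<noteq> r \<Longrightarrow> x s = \<zero>\<^bsub>P\<^esub>"
        using surj[of y] unfolding Y.comp_def by blast
      then show "y \<in> h ` X.comp r"
        unfolding X.comp_def by blast
    qed
  qed
  ultimately show ?thesis
    unfolding isomorphic_graded_supercomm_algebras_def
    using X.B_graded Y.B_graded by blast
qed


section \<open>Completions\<close>

text \<open>All elements of \<open>I + a\<close> are congruent to \<open>a\<close> modulo
  \<open>J\<close>, so the cosets united in the set sum are all the same.\<close>

lemma quot_transition:
  fixes A (structure)
  assumes I: "ideal I A" and J: "ideal J A" and sub: "I \<subseteq> J" and a: "a \<in> carrier A"
  shows "J <+> (I +> a) = J +> a"
proof -
  interpret I: ideal I A by (rule I)
  interpret J: ideal J A by (rule J)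
  have "J +> y = J +> a" if y: "y \<in> I +> a" for y
  proof -
    obtain i where "i \<in> I" "y = i \<oplus> a"
      using y unfolding a_r_coset_def' by blast
    then have "y \<ominus> a = i" "y \<in> carrier A" "i \<in> J"
      using a sub by (auto simp: a_minus_def I.a_assoc I.r_neg)
    then show ?thesis using a by (simp add: J.rcos_eq_iff)
  qed
  then show ?thesis
    unfolding set_add_rcos by (intro UN_constant_eq[OF I.a_rcos_self[OF a]]) simp
qed

text \<open>The limits are computed inside this product.\<close>

definition quot_product :: "('k, 'a) module \<Rightarrow> (nat \<Rightarrow> 'a set) \<Rightarrow> ('k, nat \<Rightarrow> 'a set) module" where
  "quot_product A F =
     \<lparr>carrier = {x. \<forall>p. x p \<in> carrier (quot A (F p))},
      mult = (\<lambda>x y p. x p \<otimes>\<^bsub>quot A (F p)\<^esub> y p), one = (\<lambda>p. \<one>\<^bsub>quot A (F p)\<^esub>),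
      zero = (\<lambda>p. \<zero>\<^bsub>quot A (F p)\<^esub>), add = (\<lambda>x y p. x p \<oplus>\<^bsub>quot A (F p)\<^esub> y p),
      smult = (\<lambda>k x p. k \<odot>\<^bsub>quot A (F p)\<^esub> x p)\<rparr>"

locale filtered_algebra = assoc_algebra R A
  for R :: "('k, 'd) ring_scheme" and A :: "('k, 'a) module" +
  fixes G :: "int \<Rightarrow> 'a set" and F :: "nat \<Rightarrow> 'a set"
  assumes G_submodule: "\<And>r. submodule (G r) R A"
    and G_mult: "\<And>r s x y. \<lbrakk>x \<in> G r; y \<in> G s\<rbrakk> \<Longrightarrow> x \<otimes>\<^bsub>A\<^esub> y \<in> G (r + s)"
    and G_supercomm: "\<And>r s x y. \<lbrakk>x \<in> G r; y \<in> G s\<rbrakk> \<Longrightarrow> x \<otimes>\<^bsub>A\<^esub> y = koszul A r s (y \<otimes>\<^bsub>A\<^esub> x)"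
    and G_one: "\<one>\<^bsub>A\<^esub> \<in> G 0"
    and F_ideal: "\<And>p. ideal (F p) A"
    and F_decreasing: "\<And>p q. p \<le> q \<Longrightarrow> F q \<subseteq> F p"
begin

section \<open>Limits inside the product of the quotients\<close>

abbreviation "Q p \<equiv> quot A (F p)"
abbreviation "PP \<equiv> quot_product A F"
abbreviation "L \<equiv> limit_component A G F"

definition \<pi> :: "nat \<Rightarrow> 'a \<Rightarrow> 'a set" where "\<pi> p a = F p +>\<^bsub>A\<^esub> a"

lemma Q_algebra: "assoc_algebra R (Q p)"
  by (rule quot_algebra[OF assoc_algebra_axioms F_ideal])

lemma \<pi>_hom: "\<pi> p \<in> ring_hom A (Q p)"
  using quot_ring_hom[OF F_ideal] by (simp add: \<pi>_def[abs_def])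

lemma Q_carrier: "carrier (Q p) = \<pi> p ` carrier A"
  by (simp add: \<pi>_def[abs_def])

lemma \<pi>_closed: "a \<in> carrier A \<Longrightarrow> \<pi> p a \<in> carrier (Q p)"
  by (rule ring_hom_closed[OF \<pi>_hom])

lemma \<pi>_add: "\<lbrakk>a \<in> carrier A; b \<in> carrier A\<rbrakk> \<Longrightarrow> \<pi> p a \<oplus>\<^bsub>Q p\<^esub> \<pi> p b = \<pi> p (a \<oplus>\<^bsub>A\<^esub> b)"
  by (rule ring_hom_add[OF \<pi>_hom, symmetric])

lemma \<pi>_mult: "\<lbrakk>a \<in> carrier A; b \<in> carrier A\<rbrakk> \<Longrightarrow> \<pi> p a \<otimes>\<^bsub>Q p\<^esub> \<pi> p b = \<pi> p (a \<otimes>\<^bsub>A\<^esub> b)"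
  by (rule ring_hom_mult[OF \<pi>_hom, symmetric])

lemma \<pi>_smult: "\<lbrakk>k \<in> carrier R; a \<in> carrier A\<rbrakk> \<Longrightarrow> k \<odot>\<^bsub>Q p\<^esub> \<pi> p a = \<pi> p (k \<odot>\<^bsub>A\<^esub> a)"
  unfolding \<pi>_def by (intro quot_smult[OF module ideal_submodule[OF F_ideal]])

lemma \<pi>_zero: "\<pi> p \<zero>\<^bsub>A\<^esub> = \<zero>\<^bsub>Q p\<^esub>"
  by (rule ring_hom_zero[OF \<pi>_hom ring_M assoc_algebra.ring_M[OF Q_algebra]])

lemma \<pi>_eq_iff: "\<lbrakk>a \<in> carrier A; b \<in> carrier A\<rbrakk> \<Longrightarrow> \<pi> p a = \<pi> p b \<longleftrightarrow> a \<ominus>\<^bsub>A\<^esub> b \<in> F p"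
proof -
  interpret ideal "F p" A by (rule F_ideal)
  show "\<lbrakk>a \<in> carrier A; b \<in> carrier A\<rbrakk> \<Longrightarrow> \<pi> p a = \<pi> p b \<longleftrightarrow> a \<ominus>\<^bsub>A\<^esub> b \<in> F p"
    unfolding \<pi>_def by (rule rcos_eq_iff)
qed

lemma \<pi>_transition: "\<lbrakk>p \<le> q; a \<in> carrier A\<rbrakk> \<Longrightarrow> F p <+>\<^bsub>A\<^esub> \<pi> q a = \<pi> p a"
  unfolding \<pi>_def by (rule quot_transition[OF F_ideal F_ideal F_decreasing])

lemma G_closed: "x \<in> G r \<Longrightarrow> x \<in> carrier A"
  using submoduleE(1)[OF G_submodule] by blast

lemma PP_simps:
  "carrier PP = {x. \<forall>p. x p \<in> carrier (Q p)}"
  "x \<otimes>\<^bsub>PP\<^esub> y = (\<lambda>p. x p \<otimes>\<^bsub>Q p\<^esub> y p)" "\<one>\<^bsub>PP\<^esub> = (\<lambda>p. \<one>\<^bsub>Q p\<^esub>)"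
  "\<zero>\<^bsub>PP\<^esub> = (\<lambda>p. \<zero>\<^bsub>Q p\<^esub>)" "x \<oplus>\<^bsub>PP\<^esub> y = (\<lambda>p. x p \<oplus>\<^bsub>Q p\<^esub> y p)"
  "k \<odot>\<^bsub>PP\<^esub> x = (\<lambda>p. k \<odot>\<^bsub>Q p\<^esub> x p)"
  by (simp_all add: quot_product_def)

lemma PP_closed: "x \<in> carrier PP \<Longrightarrow> x p \<in> carrier (Q p)"
  unfolding PP_simps by blast

lemma PP_I: "(\<And>p. x p \<in> carrier (Q p)) \<Longrightarrow> x \<in> carrier PP"
  unfolding PP_simps by blast

lemma PP_algebra: "assoc_algebra R PP"
proof (intro assoc_algebra.intro assoc_algebra_axioms.intro)
  note Q_ring = assoc_algebra.ring_M[OF Q_algebra]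
  note Q_ab = ring.is_abelian_group[OF Q_ring]
  note Q_mon = ring.is_monoid[OF Q_ring]
  note Q_mod = assoc_algebra.module[OF Q_algebra]
  have ab: "abelian_group PP"
  proof (rule abelian_groupI)
    fix x assume x: "x \<in> carrier PP"
    show "\<exists>y\<in>carrier PP. y \<oplus>\<^bsub>PP\<^esub> x = \<zero>\<^bsub>PP\<^esub>"
    proof (rule bexI)
      show "(\<lambda>p. \<ominus>\<^bsub>Q p\<^esub> x p) \<in> carrier PP"
        by (intro PP_I abelian_group.a_inv_closed[OF Q_ab] PP_closed[OF x])
      show "(\<lambda>p. \<ominus>\<^bsub>Q p\<^esub> x p) \<oplus>\<^bsub>PP\<^esub> x = \<zero>\<^bsub>PP\<^esub>"
        unfolding PP_simps by (intro ext abelian_group.l_neg[OF Q_ab] PP_closed[OF x])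
    qed
    show "\<zero>\<^bsub>PP\<^esub> \<oplus>\<^bsub>PP\<^esub> x = x"
      unfolding PP_simps by (intro ext abelian_groupE(5)[OF Q_ab] PP_closed[OF x])
    fix y assume y: "y \<in> carrier PP"
    show "x \<oplus>\<^bsub>PP\<^esub> y \<in> carrier PP"
      unfolding PP_simps(5) by (intro PP_I abelian_groupE(1)[OF Q_ab] PP_closed[OF x] PP_closed[OF y])
    show "x \<oplus>\<^bsub>PP\<^esub> y = y \<oplus>\<^bsub>PP\<^esub> x"
      unfolding PP_simps by (intro ext abelian_groupE(4)[OF Q_ab] PP_closed[OF x] PP_closed[OF y])
    fix z assume z: "z \<in> carrier PP"
    show "x \<oplus>\<^bsub>PP\<^esub> y \<oplus>\<^bsub>PP\<^esub> z = x \<oplus>\<^bsub>PP\<^esub> (y \<oplus>\<^bsub>PP\<^esub> z)"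
      unfolding PP_simps by (intro ext abelian_groupE(3)[OF Q_ab] PP_closed[OF x] PP_closed[OF y] PP_closed[OF z])
  next
    show "\<zero>\<^bsub>PP\<^esub> \<in> carrier PP"
      unfolding PP_simps(4) by (intro PP_I abelian_groupE(2)[OF Q_ab])
  qed
  show "ring PP"
  proof (rule ringI[OF ab])
    show "Group.monoid PP"
    proof (rule monoidI)
      show "\<one>\<^bsub>PP\<^esub> \<in> carrier PP"
        unfolding PP_simps(3) by (intro PP_I monoid.one_closed[OF Q_mon])
      fix x assume x: "x \<in> carrier PP"
      show "\<one>\<^bsub>PP\<^esub> \<otimes>\<^bsub>PP\<^esub> x = x" "x \<otimes>\<^bsub>PP\<^esub> \<one>\<^bsub>PP\<^esub> = x"
        unfolding PP_simps by (intro ext monoid.l_one[OF Q_mon] monoid.r_one[OF Q_mon] PP_closed[OF x])+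
      fix y assume y: "y \<in> carrier PP"
      show "x \<otimes>\<^bsub>PP\<^esub> y \<in> carrier PP"
        unfolding PP_simps(2) by (intro PP_I monoid.m_closed[OF Q_mon] PP_closed[OF x] PP_closed[OF y])
      fix z assume z: "z \<in> carrier PP"
      show "x \<otimes>\<^bsub>PP\<^esub> y \<otimes>\<^bsub>PP\<^esub> z = x \<otimes>\<^bsub>PP\<^esub> (y \<otimes>\<^bsub>PP\<^esub> z)"
        unfolding PP_simps by (intro ext monoid.m_assoc[OF Q_mon] PP_closed[OF x] PP_closed[OF y] PP_closed[OF z])
    qed
    fix x y z assume x: "x \<in> carrier PP" and y: "y \<in> carrier PP" and z: "z \<in> carrier PP"
    show "(x \<oplus>\<^bsub>PP\<^esub> y) \<otimes>\<^bsub>PP\<^esub> z = x \<otimes>\<^bsub>PP\<^esub> z \<oplus>\<^bsub>PP\<^esub> y \<otimes>\<^bsub>PP\<^esub> z"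
      "z \<otimes>\<^bsub>PP\<^esub> (x \<oplus>\<^bsub>PP\<^esub> y) = z \<otimes>\<^bsub>PP\<^esub> x \<oplus>\<^bsub>PP\<^esub> z \<otimes>\<^bsub>PP\<^esub> y"
      unfolding PP_simps(2,5) by (intro ext ringE(3)[OF Q_ring] ringE(4)[OF Q_ring] PP_closed[OF x] PP_closed[OF y] PP_closed[OF z])+
  qed
  show "module R PP"
  proof (rule moduleI[OF R.is_cring ab])
    fix k x assume k: "k \<in> carrier R" and x: "x \<in> carrier PP"
    show "k \<odot>\<^bsub>PP\<^esub> x \<in> carrier PP"
      unfolding PP_simps(6) by (intro PP_I module.smult_closed[OF Q_mod] PP_closed[OF x] k)
    show "k \<odot>\<^bsub>PP\<^esub> (x \<oplus>\<^bsub>PP\<^esub> y) = k \<odot>\<^bsub>PP\<^esub> x \<oplus>\<^bsub>PP\<^esub> k \<odot>\<^bsub>PP\<^esub> y" if "y \<in> carrier PP" for y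
      unfolding PP_simps by (intro ext module.smult_r_distr[OF Q_mod] PP_closed[OF x] PP_closed[OF that] k)
    fix l assume l: "l \<in> carrier R"
    show "(k \<oplus>\<^bsub>R\<^esub> l) \<odot>\<^bsub>PP\<^esub> x = k \<odot>\<^bsub>PP\<^esub> x \<oplus>\<^bsub>PP\<^esub> l \<odot>\<^bsub>PP\<^esub> x"
      unfolding PP_simps by (intro ext module.smult_l_distr[OF Q_mod] PP_closed[OF x] k l)
    show "(k \<otimes>\<^bsub>R\<^esub> l) \<odot>\<^bsub>PP\<^esub> x = k \<odot>\<^bsub>PP\<^esub> (l \<odot>\<^bsub>PP\<^esub> x)"
      unfolding PP_simps by (intro ext module.smult_assoc1[OF Q_mod] PP_closed[OF x] k l)
  next
    fix x assume x: "x \<in> carrier PP"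
    show "\<one>\<^bsub>R\<^esub> \<odot>\<^bsub>PP\<^esub> x = x"
      unfolding PP_simps by (intro ext module.smult_one[OF Q_mod] PP_closed[OF x])
  qed
  fix k x y assume k: "k \<in> carrier R" and x: "x \<in> carrier PP" and y: "y \<in> carrier PP"
  show "(k \<odot>\<^bsub>PP\<^esub> x) \<otimes>\<^bsub>PP\<^esub> y = k \<odot>\<^bsub>PP\<^esub> (x \<otimes>\<^bsub>PP\<^esub> y)"
    "x \<otimes>\<^bsub>PP\<^esub> (k \<odot>\<^bsub>PP\<^esub> y) = k \<odot>\<^bsub>PP\<^esub> (x \<otimes>\<^bsub>PP\<^esub> y)"
    unfolding PP_simps(2,6) by (intro ext assoc_algebra.smult_mult_l[OF Q_algebra] assoc_algebra.smult_mult_r[OF Q_algebra] PP_closed[OF x] PP_closed[OF y] k)+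
qed

sublocale PP: assoc_algebra R PP
  by (rule PP_algebra)

lemma PP_a_inv: "x \<in> carrier PP \<Longrightarrow> (\<ominus>\<^bsub>PP\<^esub> x) p = \<ominus>\<^bsub>Q p\<^esub> x p"
proof -
  assume x: "x \<in> carrier PP"
  interpret Q: assoc_algebra R "Q p" by (rule Q_algebra)
  have "(\<ominus>\<^bsub>PP\<^esub> x) p \<oplus>\<^bsub>Q p\<^esub> x p = \<zero>\<^bsub>Q p\<^esub>"
    using PP.M.l_neg[OF x] unfolding PP_simps by (rule fun_cong)
  moreover have "(\<ominus>\<^bsub>PP\<^esub> x) p \<in> carrier (Q p)" "x p \<in> carrier (Q p)"
    using PP_closed x PP.M.a_inv_closed[OF x] by blast+
  ultimately show ?thesis by (metis Q.M.minus_equality)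
qed

lemma PP_finsum:
  "\<lbrakk>finite S; \<And>s. s \<in> S \<Longrightarrow> f s \<in> carrier PP\<rbrakk> \<Longrightarrow> (\<Oplus>\<^bsub>PP\<^esub>s\<in>S. f s) p = (\<Oplus>\<^bsub>Q p\<^esub>s\<in>S. f s p)"
proof (induction S rule: finite_induct)
  case empty
  interpret Q: assoc_algebra R "Q p" by (rule Q_algebra)
  show ?case using PP_simps(4) by simp
next
  case (insert s S)
  interpret Q: assoc_algebra R "Q p" by (rule Q_algebra)
  have "(\<Oplus>\<^bsub>PP\<^esub>s\<in>insert s S. f s) = f s \<oplus>\<^bsub>PP\<^esub> (\<Oplus>\<^bsub>PP\<^esub>s\<in>S. f s)"
    using insert by (intro PP.M.finsum_insert) auto
  then have "(\<Oplus>\<^bsub>PP\<^esub>s\<in>insert s S. f s) p = f s p \<oplus>\<^bsub>Q p\<^esub> (\<Oplus>\<^bsub>Q p\<^esub>s\<in>S. f s p)"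
    using insert.IH insert.prems by (simp only: PP_simps(5) insertI2)
  moreover have "(\<Oplus>\<^bsub>Q p\<^esub>s\<in>insert s S. f s p) = f s p \<oplus>\<^bsub>Q p\<^esub> (\<Oplus>\<^bsub>Q p\<^esub>s\<in>S. f s p)"
    using insert.hyps PP_closed[OF insert.prems] by (intro Q.M.finsum_insert) (auto simp only: Pi_iff insert_iff)
  ultimately show ?case by simp
qed

lemma L_iff:
  "x \<in> L r \<longleftrightarrow> (\<forall>p. \<exists>a\<in>G r. x p = \<pi> p a) \<and> (\<forall>p q. p \<le> q \<longrightarrow> F p <+>\<^bsub>A\<^esub> x q = x p)"
  unfolding limit_component_def \<pi>_def by (simp only: mem_Collect_eq image_iff)

lemma L_rep: "x \<in> L r \<Longrightarrow> \<exists>a\<in>G r. x p = \<pi> p a"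
  by (simp add: L_iff)

text \<open>A representative chosen at stage \<open>q\<close> serves all earlier stages through the
  transition maps. With the converse \<open>LI\<close>, compatible families are replaced by elements
  of \<open>G r\<close> valid up to a stage, and the limits inherit their closure properties from
  \<open>G\<close>.\<close>

lemma L_rep_le: "x \<in> L r \<Longrightarrow> \<exists>a\<in>G r. \<forall>p\<le>q. x p = \<pi> p a"
proof -
  assume x: "x \<in> L r"
  then obtain a where a: "a \<in> G r" "x q = \<pi> q a" using L_rep by blast
  have "x p = \<pi> p a" if "p \<le> q" for p
    using x that \<pi>_transition[OF that G_closed[OF a(1)]] unfolding L_iff a(2)[symmetric] by metis
  then show ?thesis using a by blast
qed

lemma LI:
  assumes "\<And>q. \<exists>a\<in>G r. \<forall>p\<le>q. x p = \<pi> p a"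
  shows "x \<in> L r"
  unfolding L_iff
proof (intro conjI allI impI)
  show "\<exists>a\<in>G r. x p = \<pi> p a" for p using assms[of p] by blast
  fix p q :: nat assume pq: "p \<le> q"
  obtain a where "a \<in> G r" "\<And>p. p \<le> q \<Longrightarrow> x p = \<pi> p a" using assms[of q] by blast
  then show "F p <+>\<^bsub>A\<^esub> x q = x p"
    using \<pi>_transition[OF pq G_closed] pq by simp
qed

lemma L_PP: "x \<in> L r \<Longrightarrow> x \<in> carrier PP"
proof (rule PP_I)
  fix p assume "x \<in> L r"
  then obtain a where "a \<in> G r" "x p = \<pi> p a" using L_rep by blast
  then show "x p \<in> carrier (Q p)" by (simp only: \<pi>_closed[OF G_closed])
qed

lemma G_add: "\<lbrakk>x \<in> G r; y \<in> G r\<rbrakk> \<Longrightarrow> x \<oplus>\<^bsub>A\<^esub> y \<in> G r"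
  by (rule submoduleE(5)[OF G_submodule])

lemma G_smult: "\<lbrakk>k \<in> carrier R; x \<in> G r\<rbrakk> \<Longrightarrow> k \<odot>\<^bsub>A\<^esub> x \<in> G r"
  by (rule submoduleE(4)[OF G_submodule])

lemma G_zero: "\<zero>\<^bsub>A\<^esub> \<in> G r"
  using subgroup.one_closed[OF submodule.axioms(1)[OF G_submodule]] by simp

lemma G_minus: "\<lbrakk>x \<in> G r; y \<in> G r\<rbrakk> \<Longrightarrow> x \<ominus>\<^bsub>A\<^esub> y \<in> G r"
  unfolding a_minus_def by (intro G_add submoduleE(3)[OF G_submodule])

lemma L_submodule: "submodule (L r) R PP"
proof (rule PP.submoduleI)
  show "L r \<subseteq> carrier PP" using L_PP by blast
  show "\<zero>\<^bsub>PP\<^esub> \<in> L r"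
    using G_zero \<pi>_zero PP_simps(4) by (intro LI bexI[of _ "\<zero>\<^bsub>A\<^esub>"]) simp_all
  show "x \<oplus>\<^bsub>PP\<^esub> y \<in> L r" if x: "x \<in> L r" and y: "y \<in> L r" for x y
  proof (rule LI)
    fix q
    obtain a b where a: "a \<in> G r" "\<And>p. p \<le> q \<Longrightarrow> x p = \<pi> p a" and b: "b \<in> G r" "\<And>p. p \<le> q \<Longrightarrow> y p = \<pi> p b"
      using L_rep_le[OF x, of q] L_rep_le[OF y, of q] by blast
    have "(x \<oplus>\<^bsub>PP\<^esub> y) p = \<pi> p (a \<oplus>\<^bsub>A\<^esub> b)" if "p \<le> q" for p
      unfolding PP_simps a(2)[OF that] b(2)[OF that]
      by (rule \<pi>_add[OF G_closed[OF a(1)] G_closed[OF b(1)]])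
    then show "\<exists>c\<in>G r. \<forall>p\<le>q. (x \<oplus>\<^bsub>PP\<^esub> y) p = \<pi> p c"
      using G_add[OF a(1) b(1)] by blast
  qed
  show smult: "k \<odot>\<^bsub>PP\<^esub> x \<in> L r" if k: "k \<in> carrier R" and x: "x \<in> L r" for k x
  proof (rule LI)
    fix q
    obtain a where a: "a \<in> G r" "\<And>p. p \<le> q \<Longrightarrow> x p = \<pi> p a"
      using L_rep_le[OF x, of q] by blast
    have "(k \<odot>\<^bsub>PP\<^esub> x) p = \<pi> p (k \<odot>\<^bsub>A\<^esub> a)" if "p \<le> q" for p
      unfolding PP_simps a(2)[OF that] by (rule \<pi>_smult[OF k G_closed[OF a(1)]])
    then show "\<exists>c\<in>G r. \<forall>p\<le>q. (k \<odot>\<^bsub>PP\<^esub> x) p = \<pi> p c"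
      using G_smult[OF k a(1)] by blast
  qed
  show "\<ominus>\<^bsub>PP\<^esub> x \<in> L r" if "x \<in> L r" for x
    using smult[of "\<ominus>\<^bsub>R\<^esub> \<one>\<^bsub>R\<^esub>" x] that PP.smult_l_minus[of "\<one>\<^bsub>R\<^esub>" x] L_PP[OF that] PP.smult_one[of x] by simp
qed

lemma PP_koszul: "x \<in> carrier PP \<Longrightarrow> koszul PP r s x p = koszul (Q p) r s (x p)"
  by (simp only: koszul_def PP_a_inv split: if_split) simp

sublocale L: graded_family R PP L
proof (intro graded_family.intro graded_family_axioms.intro PP_algebra)
  show "submodule (L r) R PP" for r by (rule L_submodule)
  show "\<one>\<^bsub>PP\<^esub> \<in> L 0"
    using G_one ring_hom_one[OF \<pi>_hom] PP_simps(3) by (intro LI bexI[of _ "\<one>\<^bsub>A\<^esub>"]) simp_all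
  fix r s x y assume x: "x \<in> L r" and y: "y \<in> L s"
  show "x \<otimes>\<^bsub>PP\<^esub> y \<in> L (r + s)"
  proof (rule LI)
    fix q
    obtain a b where a: "a \<in> G r" "\<And>p. p \<le> q \<Longrightarrow> x p = \<pi> p a" and b: "b \<in> G s" "\<And>p. p \<le> q \<Longrightarrow> y p = \<pi> p b"
      using L_rep_le[OF x, of q] L_rep_le[OF y, of q] by blast
    have "(x \<otimes>\<^bsub>PP\<^esub> y) p = \<pi> p (a \<otimes>\<^bsub>A\<^esub> b)" if "p \<le> q" for p
      unfolding PP_simps a(2)[OF that] b(2)[OF that]
      by (rule \<pi>_mult[OF G_closed[OF a(1)] G_closed[OF b(1)]])
    then show "\<exists>c\<in>G (r + s). \<forall>p\<le>q. (x \<otimes>\<^bsub>PP\<^esub> y) p = \<pi> p c"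
      using G_mult[OF a(1) b(1)] by blast
  qed
  have "(x \<otimes>\<^bsub>PP\<^esub> y) p = koszul PP r s (y \<otimes>\<^bsub>PP\<^esub> x) p" for p
  proof -
    obtain a b where a: "a \<in> G r" "x p = \<pi> p a" and b: "b \<in> G s" "y p = \<pi> p b"
      using L_rep[OF x, of p] L_rep[OF y, of p] by blast
    have c: "a \<in> carrier A" "b \<in> carrier A" using a b G_closed by blast+
    interpret h: ring_hom_ring A "Q p" "\<pi> p"
      by (intro ring_hom_ringI2 ring_M assoc_algebra.ring_M[OF Q_algebra] \<pi>_hom)
    have "(x \<otimes>\<^bsub>PP\<^esub> y) p = \<pi> p (koszul A r s (b \<otimes>\<^bsub>A\<^esub> a))"
      using G_supercomm[OF a(1) b(1)] by (simp only: PP_simps a(2) b(2) \<pi>_mult c)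
    also have "\<dots> = koszul (Q p) r s (\<pi> p (b \<otimes>\<^bsub>A\<^esub> a))"
      using c by (simp only: koszul_def h.hom_a_inv A.m_closed split: if_split) simp
    also have "\<dots> = koszul (Q p) r s ((y \<otimes>\<^bsub>PP\<^esub> x) p)"
      by (simp only: PP_simps a(2) b(2) \<pi>_mult c)
    also have "\<dots> = koszul PP r s (y \<otimes>\<^bsub>PP\<^esub> x) p"
      using PP.A.m_closed[OF L_PP[OF y] L_PP[OF x]] by (rule PP_koszul[symmetric])
    finally show ?thesis .
  qed
  then show "x \<otimes>\<^bsub>PP\<^esub> y = koszul PP r s (y \<otimes>\<^bsub>PP\<^esub> x)" ..
qed

lemma limit_zero_eq: "limit_zero A F = \<zero>\<^bsub>PP\<^esub>"
  unfolding limit_zero_def PP_simps ..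

sublocale completion: external_sum R PP L "completion A G F"
proof (intro external_sum.intro external_sum_axioms.intro L.graded_family_axioms)
  show carrier: "carrier (completion A G F) = {x. (\<forall>r. x r \<in> L r) \<and> finite {r. x r \<noteq> \<zero>\<^bsub>PP\<^esub>}}"
    unfolding limit_zero_eq[symmetric] by (simp add: completion_def)
  show "\<zero>\<^bsub>completion A G F\<^esub> = (\<lambda>r. \<zero>\<^bsub>PP\<^esub>)"
    unfolding limit_zero_eq[symmetric] by (simp add: completion_def)
  show "\<one>\<^bsub>completion A G F\<^esub> = (\<lambda>r. if r = 0 then \<one>\<^bsub>PP\<^esub> else \<zero>\<^bsub>PP\<^esub>)"
    unfolding limit_zero_eq[symmetric] PP_simps(3) by (simp add: completion_def)
  fix x y assume x: "x \<in> carrier (completion A G F)" and y: "y \<in> carrier (completion A G F)"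
  show "x \<oplus>\<^bsub>completion A G F\<^esub> y = (\<lambda>r. x r \<oplus>\<^bsub>PP\<^esub> y r)"
    unfolding PP_simps(5) by (simp add: completion_def)
  have c: "x r \<in> carrier PP" "y r \<in> carrier PP" "finite {r. x r \<noteq> \<zero>\<^bsub>PP\<^esub>}" for r
    using x y L_PP unfolding carrier by blast+
  \<comment> \<open>\<open>completion\<close> sums in each quotient separately, the external sum in
    the product of all quotients; the two agree stage by stage.\<close>
  have "(\<Oplus>\<^bsub>PP\<^esub>r\<in>{r. x r \<noteq> \<zero>\<^bsub>PP\<^esub>}. x r \<otimes>\<^bsub>PP\<^esub> y (t - r)) p =
      (\<Oplus>\<^bsub>Q p\<^esub>r\<in>{r. x r \<noteq> \<zero>\<^bsub>PP\<^esub>}. x r p \<otimes>\<^bsub>Q p\<^esub> y (t - r) p)" for t p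
    using PP_finsum[of "{r. x r \<noteq> \<zero>\<^bsub>PP\<^esub>}" "\<lambda>r. x r \<otimes>\<^bsub>PP\<^esub> y (t - r)" p] c PP.A.m_closed[OF c(1,2)]
    by (simp only: PP_simps(2))
  then show "x \<otimes>\<^bsub>completion A G F\<^esub> y = (\<lambda>t. \<Oplus>\<^bsub>PP\<^esub>r\<in>{r. x r \<noteq> \<zero>\<^bsub>PP\<^esub>}. x r \<otimes>\<^bsub>PP\<^esub> y (t - r))"
    by (intro ext) (simp add: completion_def limit_zero_eq)
next
  fix k x
  show "k \<odot>\<^bsub>completion A G F\<^esub> x = (\<lambda>r. k \<odot>\<^bsub>PP\<^esub> x r)"
    unfolding PP_simps(6) by (simp add: completion_def)
qed

lemma completion_comp: "completion.comp = completion_component A G F"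
  by (intro ext) (simp only: completion.comp_def completion_component_def limit_zero_eq)

end

text \<open>The uniform inclusion \<open>le\<close> defines the map by passing from the class modulo
  \<open>F (n p)\<close> to the class modulo \<open>F' p\<close>. The inclusion \<open>ge\<close>,
  whose index may depend on the weight, recovers classes modulo \<open>F q\<close> from classes
  modulo \<open>F' p\<close> for elements of \<open>G r\<close>.\<close>

lemma isomorphic_completions:
  fixes A :: "('k, 'a) module" and R :: "('k, 'd) ring_scheme"
  assumes "filtered_algebra R A G F" "filtered_algebra R A G F'"
    and n: "mono n" and le: "\<And>p. F (n p) \<subseteq> F' p"
    and ge: "\<And>r q. \<exists>p. F' p \<inter> G r \<subseteq> F q"
  shows "isomorphic_graded_supercomm_algebras R (completion A G F) (completion_component A G F)
    (completion A G F') (completion_component A G F')"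
proof -
  interpret X: filtered_algebra R A G F by fact
  interpret Y: filtered_algebra R A G F' by fact
  define \<eta> where "\<eta> x = (\<lambda>p. F' p <+>\<^bsub>A\<^esub> x (n p))" for x :: "nat \<Rightarrow> 'a set"
  have \<eta>\<pi>: "\<eta> x p = Y.\<pi> p a" if "x (n p) = X.\<pi> (n p) a" "a \<in> carrier A" for x p a
    unfolding \<eta>_def that(1) X.\<pi>_def Y.\<pi>_def
    using that(2) by (rule quot_transition[OF X.F_ideal Y.F_ideal le])
  have rep: "\<exists>a\<in>carrier A. x p = X.\<pi> p a" if "x \<in> carrier X.PP" for x p
    using X.PP_closed[OF that, of p] unfolding X.Q_carrier by blast
  have hom: "\<eta> \<in> ring_hom X.PP Y.PP"
  proof (rule ring_hom_memI)
    fix x assume x: "x \<in> carrier X.PP"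
    have "\<eta> x p \<in> carrier (Y.Q p)" for p
    proof -
      obtain a where a: "a \<in> carrier A" "x (n p) = X.\<pi> (n p) a" using rep[OF x] by blast
      show ?thesis unfolding \<eta>\<pi>[of x p a, OF a(2,1)] using a(1) by (rule Y.\<pi>_closed)
    qed
    then show "\<eta> x \<in> carrier Y.PP" by (rule Y.PP_I)
    fix y assume y: "y \<in> carrier X.PP"
    have "\<eta> (x \<otimes>\<^bsub>X.PP\<^esub> y) p = (\<eta> x \<otimes>\<^bsub>Y.PP\<^esub> \<eta> y) p \<and> \<eta> (x \<oplus>\<^bsub>X.PP\<^esub> y) p = (\<eta> x \<oplus>\<^bsub>Y.PP\<^esub> \<eta> y) p" for p
    proof -
      obtain a b where a: "a \<in> carrier A" "x (n p) = X.\<pi> (n p) a" and b: "b \<in> carrier A" "y (n p) = X.\<pi> (n p) b"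
        using rep[OF x, of "n p"] rep[OF y, of "n p"] by blast
      have "(x \<otimes>\<^bsub>X.PP\<^esub> y) (n p) = X.\<pi> (n p) (a \<otimes>\<^bsub>A\<^esub> b)"
        unfolding X.PP_simps a(2) b(2) by (rule X.\<pi>_mult[OF a(1) b(1)])
      then have "\<eta> (x \<otimes>\<^bsub>X.PP\<^esub> y) p = Y.\<pi> p (a \<otimes>\<^bsub>A\<^esub> b)"
        by (rule \<eta>\<pi>[OF _ X.A.m_closed[OF a(1) b(1)]])
      moreover have "(x \<oplus>\<^bsub>X.PP\<^esub> y) (n p) = X.\<pi> (n p) (a \<oplus>\<^bsub>A\<^esub> b)"
        unfolding X.PP_simps a(2) b(2) by (rule X.\<pi>_add[OF a(1) b(1)])
      then have "\<eta> (x \<oplus>\<^bsub>X.PP\<^esub> y) p = Y.\<pi> p (a \<oplus>\<^bsub>A\<^esub> b)"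
        by (rule \<eta>\<pi>[OF _ X.M.a_closed[OF a(1) b(1)]])
      moreover have "\<eta> x p = Y.\<pi> p a" using a(2,1) by (rule \<eta>\<pi>)
      moreover have "\<eta> y p = Y.\<pi> p b" using b(2,1) by (rule \<eta>\<pi>)
      ultimately show ?thesis
        using Y.\<pi>_mult[OF a(1) b(1)] Y.\<pi>_add[OF a(1) b(1)] by (simp only: Y.PP_simps simp_thms)
    qed
    then show "\<eta> (x \<otimes>\<^bsub>X.PP\<^esub> y) = \<eta> x \<otimes>\<^bsub>Y.PP\<^esub> \<eta> y" "\<eta> (x \<oplus>\<^bsub>X.PP\<^esub> y) = \<eta> x \<oplus>\<^bsub>Y.PP\<^esub> \<eta> y"
      by (intro ext; blast)+
  next
    have "\<eta> \<one>\<^bsub>X.PP\<^esub> p = \<one>\<^bsub>Y.PP\<^esub> p" for p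
      using \<eta>\<pi>[of "\<one>\<^bsub>X.PP\<^esub>" p "\<one>\<^bsub>A\<^esub>"] ring_hom_one[OF X.\<pi>_hom] ring_hom_one[OF Y.\<pi>_hom] X.A.one_closed
      by (simp only: X.PP_simps Y.PP_simps)
    then show "\<eta> \<one>\<^bsub>X.PP\<^esub> = \<one>\<^bsub>Y.PP\<^esub>" ..
  qed
  have smult: "\<eta> (k \<odot>\<^bsub>X.PP\<^esub> x) = k \<odot>\<^bsub>Y.PP\<^esub> \<eta> x" if k: "k \<in> carrier R" and x: "x \<in> carrier X.PP" for k x
  proof
    fix p
    obtain a where a: "a \<in> carrier A" "x (n p) = X.\<pi> (n p) a"
      using rep[OF x, of "n p"] by blast
    have "(k \<odot>\<^bsub>X.PP\<^esub> x) (n p) = X.\<pi> (n p) (k \<odot>\<^bsub>A\<^esub> a)"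
      unfolding X.PP_simps a(2) by (rule X.\<pi>_smult[OF k a(1)])
    then have "\<eta> (k \<odot>\<^bsub>X.PP\<^esub> x) p = Y.\<pi> p (k \<odot>\<^bsub>A\<^esub> a)"
      by (rule \<eta>\<pi>[OF _ X.smult_closed[OF k a(1)]])
    moreover have "\<eta> x p = Y.\<pi> p a" using a(2,1) by (rule \<eta>\<pi>)
    ultimately show "\<eta> (k \<odot>\<^bsub>X.PP\<^esub> x) p = (k \<odot>\<^bsub>Y.PP\<^esub> \<eta> x) p"
      using Y.\<pi>_smult[OF k a(1)] by (simp only: Y.PP_simps)
  qed
  have \<eta>_rep: "\<eta> x p = Y.\<pi> p a" if "\<And>p. p \<le> m \<Longrightarrow> x p = X.\<pi> p a" "a \<in> G r" "n p \<le> m" for x p m a r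
    using that(1)[OF that(3)] X.G_closed[OF that(2)] by (rule \<eta>\<pi>)
  have "bij_betw \<eta> (X.L r) (Y.L r)" for r
    unfolding bij_betw_def
  proof (intro conjI inj_onI equalityI subsetI)
    fix x y assume x: "x \<in> X.L r" and y: "y \<in> X.L r" and eq: "\<eta> x = \<eta> y"
    show "x = y"
    proof
      fix q
      obtain p where p: "F' p \<inter> G r \<subseteq> F q" using ge by blast
      \<comment> \<open>One representative has to be valid both at \<open>q\<close>, where equality
        is wanted, and at \<open>n p\<close>, where \<open>\<eta>\<close> looks.\<close>
      define m where "m = max q (n p)"
      obtain a b where a: "a \<in> G r" "\<And>p. p \<le> m \<Longrightarrow> x p = X.\<pi> p a"
        and b: "b \<in> G r" "\<And>p. p \<le> m \<Longrightarrow> y p = X.\<pi> p b"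
        using X.L_rep_le[OF x, of m] X.L_rep_le[OF y, of m] by blast
      have c: "a \<in> carrier A" "b \<in> carrier A" using a b X.G_closed by blast+
      have "Y.\<pi> p a = Y.\<pi> p b"
        using \<eta>_rep[OF a(2,1), of m p] \<eta>_rep[OF b(2,1), of m p] fun_cong[OF eq, of p] by (simp add: m_def)
      then have "a \<ominus>\<^bsub>A\<^esub> b \<in> F q"
        using p Y.\<pi>_eq_iff[OF c] X.G_minus[OF a(1) b(1)] by blast
      then have "X.\<pi> q a = X.\<pi> q b" using X.\<pi>_eq_iff[OF c] by blast
      then show "x q = y q" using a(2)[of q] b(2)[of q] by (simp add: m_def)
    qed
  next
    fix y assume "y \<in> \<eta> ` X.L r"
    then obtain x where x: "x \<in> X.L r" "y = \<eta> x" by blast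
    show "y \<in> Y.L r"
    proof (rule Y.LI)
      fix q
      obtain a where a: "a \<in> G r" "\<And>p. p \<le> n q \<Longrightarrow> x p = X.\<pi> p a"
        using X.L_rep_le[OF x(1), of "n q"] by blast
      \<comment> \<open>Monotonicity of \<open>n\<close> makes the representative valid at stage
        \<open>n p\<close> for every \<open>p \<le> q\<close>.\<close>
      have "y p = Y.\<pi> p a" if "p \<le> q" for p
        using \<eta>_rep[OF a(2,1), of "n q" p] monoD[OF n that] x(2) by simp
      then show "\<exists>a\<in>G r. \<forall>p\<le>q. y p = Y.\<pi> p a" using a(1) by blast
    qed
  next
    fix y assume y: "y \<in> Y.L r"
    \<comment> \<open>The \<open>a m\<close> represent \<open>y\<close> up to stage
      \<open>m\<close>. Modulo \<open>F q\<close> they stop changing once \<open>m\<close> reaches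
      \<open>P q\<close>, because their differences have weight \<open>r\<close> and lie in
      \<open>F' (P q)\<close>. The preimage \<open>x\<close> collects these stable classes.\<close>
    obtain a where a: "\<And>m. a m \<in> G r" "\<And>m p. p \<le> m \<Longrightarrow> y p = Y.\<pi> p (a m)"
      using Y.L_rep_le[OF y] by metis
    obtain P where P: "\<And>q. F' (P q) \<inter> G r \<subseteq> F q" using ge[of r] by metis
    have ac: "a m \<in> carrier A" for m using a X.G_closed by blast
    have diff: "X.\<pi> q (a m) = X.\<pi> q (a (P q))" if "P q \<le> m" for q m
    proof -
      have "Y.\<pi> (P q) (a m) = Y.\<pi> (P q) (a (P q))"
        using a(2)[OF that] a(2)[of "P q" "P q"] by simp
      then have "a m \<ominus>\<^bsub>A\<^esub> a (P q) \<in> F q"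
        using P[of q] Y.\<pi>_eq_iff[OF ac ac] X.G_minus[OF a(1) a(1)] by blast
      then show ?thesis using X.\<pi>_eq_iff[OF ac ac] by blast
    qed
    define x where "x q = X.\<pi> q (a (P q))" for q
    have "x \<in> X.L r"
    proof (rule X.LI)
      fix q
      \<comment> \<open>A stage past all of \<open>P 0, ..., P q\<close>, so that \<open>a m\<close>
        represents every \<open>x p\<close> with \<open>p \<le> q\<close>.\<close>
      define m where "m = Max (P ` {..q})"
      have "x p = X.\<pi> p (a m)" if "p \<le> q" for p
        unfolding x_def using that by (intro diff[symmetric]) (simp add: m_def)
      then show "\<exists>a\<in>G r. \<forall>p\<le>q. x p = X.\<pi> p a" using a(1) by blast
    qed
    moreover have "\<eta> x p = y p" for p
    proof -
      \<comment> \<open>Large enough for \<open>a m\<close> to represent \<open>x\<close> at stage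
        \<open>n p\<close> and \<open>y\<close> at stage \<open>p\<close>.\<close>
      define m where "m = max p (P (n p))"
      have "x (n p) = X.\<pi> (n p) (a m)"
        unfolding x_def by (intro diff[symmetric]) (simp add: m_def)
      then have "\<eta> x p = Y.\<pi> p (a m)" using ac by (rule \<eta>\<pi>)
      then show ?thesis using a(2)[of p m] by (simp add: m_def)
    qed
    ultimately show "y \<in> \<eta> ` X.L r" by (intro image_eqI[of _ _ x]) auto
  qed
  then have "isomorphic_graded_supercomm_algebras R (completion A G F) X.completion.comp
      (completion A G F') Y.completion.comp"
    by (intro external_sum_isomorphic[OF X.completion.external_sum_axioms Y.completion.external_sum_axioms hom] smult)
  then show ?thesis
    unfolding X.completion_comp Y.completion_comp .
qed


section \<open>Smooth functions\<close>

lemma Ck_on_cong: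
  assumes "\<And>x. x \<in> S \<Longrightarrow> f x = g x" "Ck_on k S f"
  shows "Ck_on k S g"
proof (cases k)
  case 0
  then show ?thesis using assms continuous_on_cong[of S S f g] by simp
next
  case (Suc n)
  then obtain f' where f': "\<And>x. x \<in> S \<Longrightarrow> (f has_derivative f' x) (at x within S)"
    "\<And>v. v \<in> S \<Longrightarrow> Ck_on n S (\<lambda>x. f' x v)"
    using assms(2) by auto
  have "(g has_derivative f' x) (at x within S)" if "x \<in> S" for x
    using that assms(1) by (intro has_derivative_transform[OF _ _ f'(1)]) auto
  then show ?thesis using f'(2) Suc by auto
qed

lemma Ck_on_const: "Ck_on k S (\<lambda>x. c)"
proof (induction k arbitrary: c)
  case (Suc k)
  then show ?case by (auto intro!: exI[of _ "\<lambda>x v. 0"])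
qed simp

lemma Ck_on_SucD: "Ck_on (Suc k) S f \<Longrightarrow> Ck_on k S f"
proof (induction k arbitrary: f)
  case 0
  then show ?case by (auto simp: continuous_on_eq_continuous_within intro: has_derivative_continuous)
next
  case (Suc k)
  from Suc.prems obtain f' where f': "\<And>x. x \<in> S \<Longrightarrow> (f has_derivative f' x) (at x within S)"
    "\<And>v. v \<in> S \<Longrightarrow> Ck_on (Suc k) S (\<lambda>x. f' x v)"
    by (subst (asm) Ck_on.simps(2)) blast
  then show ?case using Suc.IH by (subst Ck_on.simps(2)) blast
qed

lemma Ck_on_add: "\<lbrakk>Ck_on k S f; Ck_on k S g\<rbrakk> \<Longrightarrow> Ck_on k S (\<lambda>x. f x + g x)"
proof (induction k arbitrary: f g)
  case 0
  then show ?case by (simp add: continuous_on_add)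
next
  case (Suc k)
  obtain f' where f': "\<And>x. x \<in> S \<Longrightarrow> (f has_derivative f' x) (at x within S)"
    "\<And>v. v \<in> S \<Longrightarrow> Ck_on k S (\<lambda>x. f' x v)"
    using Suc.prems(1) by auto
  obtain g' where g': "\<And>x. x \<in> S \<Longrightarrow> (g has_derivative g' x) (at x within S)"
    "\<And>v. v \<in> S \<Longrightarrow> Ck_on k S (\<lambda>x. g' x v)"
    using Suc.prems(2) by auto
  have "((\<lambda>x. f x + g x) has_derivative (\<lambda>v. f' x v + g' x v)) (at x within S)" if "x \<in> S" for x
    using has_derivative_add[OF f'(1) g'(1)] that by simp
  moreover have "Ck_on k S (\<lambda>x. f' x v + g' x v)" if "v \<in> S" for v
    using that f'(2) g'(2) by (intro Suc.IH)
  ultimately show ?case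
    unfolding Ck_on.simps by (intro exI[of _ "\<lambda>x v. f' x v + g' x v"]) blast
qed

text \<open>The product rule multiplies derivatives, of class \<open>C^k\<close>, with the functions
  themselves, of class \<open>C^(k+1)\<close>; \<open>Ck_on_SucD\<close> lowers the latter to the
  common order.\<close>

lemma Ck_on_mult: "\<lbrakk>Ck_on k S f; Ck_on k S g\<rbrakk> \<Longrightarrow> Ck_on k S (\<lambda>x. f x * g x)"
proof (induction k arbitrary: f g)
  case 0
  then show ?case by (simp add: continuous_on_mult)
next
  case (Suc k)
  obtain f' where f': "\<And>x. x \<in> S \<Longrightarrow> (f has_derivative f' x) (at x within S)"
    "\<And>v. v \<in> S \<Longrightarrow> Ck_on k S (\<lambda>x. f' x v)"
    using Suc.prems(1) by auto
  obtain g' where g': "\<And>x. x \<in> S \<Longrightarrow> (g has_derivative g' x) (at x within S)"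
    "\<And>v. v \<in> S \<Longrightarrow> Ck_on k S (\<lambda>x. g' x v)"
    using Suc.prems(2) by auto
  have "((\<lambda>x. f x * g x) has_derivative (\<lambda>v. f x * g' x v + f' x v * g x)) (at x within S)" if "x \<in> S" for x
    using has_derivative_mult[OF f'(1) g'(1)] that by simp
  moreover have "Ck_on k S (\<lambda>x. f x * g' x v + f' x v * g x)" if "v \<in> S" for v
    by (intro Ck_on_add Suc.IH[OF Ck_on_SucD[OF Suc.prems(1)] g'(2)]
        Suc.IH[OF f'(2) Ck_on_SucD[OF Suc.prems(2)]] that)
  ultimately show ?case
    unfolding Ck_on.simps by (intro exI[of _ "\<lambda>x v. f x * g' x v + f' x v * g x"]) blast
qed

lemma smooth_algebra_simps:
  "carrier (smooth_algebra S) = {f \<in> extensional S. \<forall>k. Ck_on k S f}"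
  "f \<otimes>\<^bsub>smooth_algebra S\<^esub> g = (\<lambda>x\<in>S. f x * g x)" "\<one>\<^bsub>smooth_algebra S\<^esub> = (\<lambda>x\<in>S. 1)"
  "\<zero>\<^bsub>smooth_algebra S\<^esub> = (\<lambda>x\<in>S. 0)" "f \<oplus>\<^bsub>smooth_algebra S\<^esub> g = (\<lambda>x\<in>S. f x + g x)"
  "r \<odot>\<^bsub>smooth_algebra S\<^esub> f = (\<lambda>x\<in>S. r * f x)"
  by (simp_all add: smooth_algebra_def)

lemma smoothI:
  assumes "\<And>k. Ck_on k S f"
  shows "(\<lambda>x\<in>S. f x) \<in> carrier (smooth_algebra S)"
proof -
  have "Ck_on k S (\<lambda>x\<in>S. f x)" for k by (rule Ck_on_cong[OF _ assms]) simp
  then show ?thesis by (simp add: smooth_algebra_simps)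
qed

lemma smoothD: "f \<in> carrier (smooth_algebra S) \<Longrightarrow> Ck_on k S f"
  by (simp add: smooth_algebra_simps)

lemma smooth_restrict: "f \<in> carrier (smooth_algebra S) \<Longrightarrow> (\<lambda>x\<in>S. f x) = f"
  by (simp add: smooth_algebra_simps extensional_restrict)

lemma cring_smooth_algebra: "cring (smooth_algebra S)"
proof (rule cringI)
  show "abelian_group (smooth_algebra S)"
  proof (rule abelian_groupI)
    fix f assume f: "f \<in> carrier (smooth_algebra S)"
    show "\<exists>g\<in>carrier (smooth_algebra S). g \<oplus>\<^bsub>smooth_algebra S\<^esub> f = \<zero>\<^bsub>smooth_algebra S\<^esub>"
    proof (rule bexI)
      \<comment> \<open>The negative is written as a product with the constant -1, so that closure
        under products shows it smooth.\<close>
      show "(\<lambda>x\<in>S. - 1 * f x) \<in> carrier (smooth_algebra S)"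
        by (intro smoothI Ck_on_mult Ck_on_const smoothD[OF f])
    qed (auto simp: smooth_algebra_simps)
    show "\<zero>\<^bsub>smooth_algebra S\<^esub> \<oplus>\<^bsub>smooth_algebra S\<^esub> f = f"
      unfolding smooth_algebra_simps by (subst (2) smooth_restrict[OF f, symmetric]) (rule restrict_ext, simp)
  next
    show "\<zero>\<^bsub>smooth_algebra S\<^esub> \<in> carrier (smooth_algebra S)"
      unfolding smooth_algebra_simps(4) by (intro smoothI Ck_on_const)
    fix f g assume "f \<in> carrier (smooth_algebra S)" "g \<in> carrier (smooth_algebra S)"
    then show "f \<oplus>\<^bsub>smooth_algebra S\<^esub> g \<in> carrier (smooth_algebra S)"
      unfolding smooth_algebra_simps(5) by (intro smoothI Ck_on_add smoothD)
  qed (auto simp: smooth_algebra_simps)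
  show "comm_monoid (smooth_algebra S)"
  proof (rule comm_monoidI)
    show "\<one>\<^bsub>smooth_algebra S\<^esub> \<in> carrier (smooth_algebra S)"
      unfolding smooth_algebra_simps(3) by (intro smoothI Ck_on_const)
    fix f assume f: "f \<in> carrier (smooth_algebra S)"
    show "\<one>\<^bsub>smooth_algebra S\<^esub> \<otimes>\<^bsub>smooth_algebra S\<^esub> f = f"
      unfolding smooth_algebra_simps by (subst (2) smooth_restrict[OF f, symmetric]) (rule restrict_ext, simp)
    fix g assume g: "g \<in> carrier (smooth_algebra S)"
    show "f \<otimes>\<^bsub>smooth_algebra S\<^esub> g \<in> carrier (smooth_algebra S)"
      unfolding smooth_algebra_simps(2) by (intro smoothI Ck_on_mult smoothD f g)
  qed (auto simp: smooth_algebra_simps)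
qed (auto simp: smooth_algebra_simps distrib_right)

lemma constant_ring_hom: "(\<lambda>r. \<lambda>x\<in>S. r) \<in> ring_hom real_ring (smooth_algebra S)"
  by (rule ring_hom_memI) (auto simp: smooth_algebra_simps(2-) intro: smoothI Ck_on_const)

lemma smooth_algebra: "assoc_algebra real_ring (smooth_algebra S)"
proof (intro assoc_algebra.intro assoc_algebra_axioms.intro)
  show "ring (smooth_algebra S)" by (rule cring.axioms(1)[OF cring_smooth_algebra])
  show "module real_ring (smooth_algebra S)"
  proof (rule moduleI[OF cring_real_ring ring.is_abelian_group[OF cring.axioms(1)[OF cring_smooth_algebra]]])
    fix r f assume f: "f \<in> carrier (smooth_algebra S)"
    show "r \<odot>\<^bsub>smooth_algebra S\<^esub> f \<in> carrier (smooth_algebra S)"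
      unfolding smooth_algebra_simps(6) by (intro smoothI Ck_on_mult Ck_on_const smoothD f)
    show "\<one>\<^bsub>real_ring\<^esub> \<odot>\<^bsub>smooth_algebra S\<^esub> f = f"
      unfolding smooth_algebra_simps by (subst (2) smooth_restrict[OF f, symmetric]) (rule restrict_ext, simp)
  qed (auto simp: smooth_algebra_simps(2-) distrib_right distrib_left)
qed (auto simp: smooth_algebra_simps)

lemma subspace_module:
  assumes "subspace S"
  shows "module real_ring (subspace_module S)"
proof (rule moduleI[OF cring_real_ring])
  show "abelian_group (subspace_module S)"
  proof (rule abelian_groupI)
    fix x assume "x \<in> carrier (subspace_module S)"
    then show "\<exists>y\<in>carrier (subspace_module S). y \<oplus>\<^bsub>subspace_module S\<^esub> x = \<zero>\<^bsub>subspace_module S\<^esub>"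
      using assms by (intro bexI[of _ "- x"]) (auto simp: subspace_module_def subspace_neg)
  qed (use assms in \<open>auto simp: subspace_module_def subspace_0 subspace_add\<close>)
qed (use assms in \<open>auto simp: subspace_module_def subspace_scale scaleR_add_left scaleR_add_right\<close>)


section \<open>Restriction of scalars\<close>

lemma restrict_scalars_simps [simp]:
  "carrier (restrict_scalars \<kappa> A) = carrier A" "mult (restrict_scalars \<kappa> A) = mult A"
  "one (restrict_scalars \<kappa> A) = one A" "zero (restrict_scalars \<kappa> A) = zero A"
  "add (restrict_scalars \<kappa> A) = add A" "k \<odot>\<^bsub>restrict_scalars \<kappa> A\<^esub> x = \<kappa> k \<odot>\<^bsub>A\<^esub> x"
  by (simp_all add: restrict_scalars_def with_smult_def)

lemma restrict_scalars_a_inv [simp]: "\<ominus>\<^bsub>restrict_scalars \<kappa> A\<^esub> x = \<ominus>\<^bsub>A\<^esub> x"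
  by (simp add: a_inv_def m_inv_def)

lemma restrict_scalars_koszul [simp]: "koszul (restrict_scalars \<kappa> A) = koszul A"
  by (simp add: koszul_def fun_eq_iff)

lemma restrict_scalars_algebra:
  fixes A :: "('c, 'a) module"
  assumes A: "assoc_algebra C A" and R: "cring R" and \<kappa>: "\<kappa> \<in> ring_hom R C"
  shows "assoc_algebra R (restrict_scalars \<kappa> A)"
proof -
  interpret assoc_algebra C A by (rule A)
  note \<kappa>c = ring_hom_closed[OF \<kappa>]
  have ab: "abelian_group (restrict_scalars \<kappa> A)"
    by (rule abelian_group_image[OF M.abelian_group_axioms, where \<pi> = "\<lambda>x. x"]) auto
  show ?thesis
  proof (intro assoc_algebra.intro assoc_algebra_axioms.intro)
    show "module R (restrict_scalars \<kappa> A)"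
      by (rule moduleI[OF R ab]) (simp_all add: \<kappa>c ring_hom_add[OF \<kappa>] ring_hom_mult[OF \<kappa>] ring_hom_one[OF \<kappa>]
          smult_l_distr smult_r_distr smult_assoc1)
    show "ring (restrict_scalars \<kappa> A)"
    proof (rule ringI[OF ab])
      show "Group.monoid (restrict_scalars \<kappa> A)"
        by (rule monoidI) (simp_all add: A.m_assoc)
    qed (simp_all add: A.l_distr A.r_distr)
  qed (simp_all add: \<kappa>c smult_mult_l smult_mult_r)
qed

text \<open>The predicate carries the whole record as a parameter but reads only its product, which
  restriction of scalars leaves unchanged. The same holds for \<open>addspan\<close> with sum and
  zero.\<close>

lemma monomial_restrict: "monomial (restrict_scalars \<kappa> A) Z H = monomial A Z H"
proof (intro ext iffI)
  show "monomial A Z H k r x" if "monomial (restrict_scalars \<kappa> A) Z H k r x" for k r x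
    using that by induction (auto intro: monomial.intros)
  show "monomial (restrict_scalars \<kappa> A) Z H k r x" if "monomial A Z H k r x" for k r x
    using that
  proof induction
    case (letter x i k r y)
    then show ?case using monomial.letter[of x H i "restrict_scalars \<kappa> A" Z k r y] by simp
  qed (rule monomial.scalar)
qed

lemma addspan_restrict: "addspan (restrict_scalars \<kappa> A) S = addspan A S"
proof (intro equalityI subsetI)
  show "x \<in> addspan A S" if "x \<in> addspan (restrict_scalars \<kappa> A) S" for x
    using that by induction (auto intro: addspan.intros)
  show "x \<in> addspan (restrict_scalars \<kappa> A) S" if "x \<in> addspan A S" for x
    using that
  proof induction
    case zero
    then show ?case using addspan.zero[of "restrict_scalars \<kappa> A" S] by simp
  next
    case (add x y)
    then show ?case using addspan.add[of x S y "restrict_scalars \<kappa> A"] by simp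
  qed
qed


section \<open>The algebra of a graded vector space\<close>

text \<open>Nonzero vectors taken from different \<open>V i\<close> are linearly independent, so
  there cannot be more nonzero \<open>V i\<close> than elements of \<open>B\<close>.\<close>

lemma graded_finite_support:
  fixes V :: "int \<Rightarrow> 'v::real_vector set"
  assumes V: "graded_vector_space V" and B: "finite B" "(\<Union>i. V i) \<subseteq> span B"
  shows "finite {i. V i \<noteq> {0}}"
proof (rule ccontr)
  assume "infinite {i. V i \<noteq> {0}}"
  then obtain J where J: "J \<subseteq> {i. V i \<noteq> {0}}" "finite J" "card J = Suc (card B)"
    using infinite_arbitrarily_large by blast
  have sub: "subspace (V i)" for i using V by (simp add: graded_vector_space_def)
  \<comment> \<open>Directness is stated for sums over the exact support; this form allows any
    finite set containing it.\<close>
  have indep: "x i = 0"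
    if "\<And>i. x i \<in> V i" "finite S" "\<And>i. i \<notin> S \<Longrightarrow> x i = 0" "(\<Sum>i\<in>S. x i) = 0" for x S i
  proof -
    have fin: "finite {i. x i \<noteq> 0}" using that(2,3) by (intro finite_subset[OF _ that(2)]) auto
    have "(\<Sum>i\<in>{i. x i \<noteq> 0}. x i) = (\<Sum>i\<in>S. x i)"
      using that(2,3) by (intro sum.mono_neutral_left) auto
    then show ?thesis
      using V that(1,4) fin unfolding graded_vector_space_def by metis
  qed
  have "\<exists>v. v \<in> V i \<and> v \<noteq> 0" if "i \<in> J" for i
    using J(1) that subspace_0[OF sub[of i]] by blast
  then obtain v where v: "\<And>i. i \<in> J \<Longrightarrow> v i \<in> V i" "\<And>i. i \<in> J \<Longrightarrow> v i \<noteq> 0"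
    by metis
  have inj: "inj_on v J"
  proof (rule inj_onI, rule ccontr)
    fix i j assume ij: "i \<in> J" "j \<in> J" "v i = v j" "i \<noteq> j"
    \<comment> \<open>If \<open>v i = v j\<close>, the family with \<open>v i\<close> in weight
      \<open>i\<close> and \<open>- v j\<close> in weight \<open>j\<close> sums to zero, and
      directness gives \<open>v i = 0\<close>.\<close>
    define x where "x k = (if k = i then v i else if k = j then - v j else 0)" for k
    have "x i = 0"
    proof (rule indep[of x "{i, j}"])
      show "x k \<in> V k" for k
        using v(1)[OF ij(1)] v(1)[OF ij(2)] by (auto simp: x_def subspace_0[OF sub] subspace_neg[OF sub])
    qed (use ij in \<open>auto simp: x_def\<close>)
    then show False using v(2)[OF ij(1)] by (simp add: x_def)
  qed
  have "independent (v ` J)"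
  proof
    assume "dependent (v ` J)"
    then obtain u where u: "\<exists>w\<in>v ` J. u w \<noteq> 0" "(\<Sum>w\<in>v ` J. u w *\<^sub>R w) = 0"
      using dependent_finite[of "v ` J"] J(2) by auto
    \<comment> \<open>The linear dependence, read as a family with one component in each
      \<open>V k\<close>.\<close>
    define x where "x k = (if k \<in> J then u (v k) *\<^sub>R v k else 0)" for k
    have "x i = 0" for i
    proof (rule indep[of x J])
      show "x k \<in> V k" for k
        using v(1) by (auto simp: x_def subspace_0[OF sub] subspace_scale[OF sub])
      show "(\<Sum>i\<in>J. x i) = 0"
        using u(2) inj by (simp add: sum.reindex x_def)
    qed (auto simp: x_def J)
    then have "u (v i) = 0" if "i \<in> J" for i
      using that v(2) unfolding x_def by (metis scaleR_eq_0_iff)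
    then show False using u(1) by auto
  qed
  moreover have "v ` J \<subseteq> span B" using v(1) B(2) by blast
  ultimately have "card (v ` J) \<le> card B"
    using independent_span_bound[OF B(1)] by blast
  then show False using J(3) inj by (simp add: card_image)
qed

theorem theorem1:
  fixes V :: "int \<Rightarrow> 'v::real_normed_vector set"
  assumes "graded_vector_space V"
    and "\<exists>B. finite B \<and> (\<Union>i. V i) \<subseteq> span B"
  shows "isomorphic_graded_supercomm_algebras real_ring
           (completion (alg V) (alg_component V) (F_weight V))
           (completion_component (alg V) (alg_component V) (F_weight V))
           (completion (alg V) (alg_component V) (F_pol V))
           (completion_component (alg V) (alg_component V) (F_pol V))"
proof -
  have sub: "subspace (V i)" for i using assms(1) by (simp add: graded_vector_space_def)
  define C where "C = smooth_algebra (V 0)"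
  define E where "E = coefficient_module V"
  \<comment> \<open>Real numbers enter \<open>C\<close> as constant functions; \<open>alg V\<close>
    is the \<open>C\<close>-algebra with scalars restricted along this map.\<close>
  define \<kappa> where "\<kappa> = (\<lambda>r. \<lambda>x\<in>V 0. r :: real)"
  have C: "cring C" unfolding C_def by (rule cring_smooth_algebra)
  have \<kappa>: "\<kappa> \<in> ring_hom real_ring C" unfolding C_def \<kappa>_def by (rule constant_ring_hom)
  have ts: "tensor_scalars real_ring C (subspace_module (V i))" for i
    unfolding C_def
    by (intro tensor_scalars.intro tensor_modules.intro assoc_algebra.module smooth_algebra
        subspace_module sub cring_smooth_algebra)
  have E_module: "module C (E i)" for i
    unfolding E_def coefficient_module_def C_def[symmetric] by (rule tensor_scalars.extend_scalars_module[OF ts])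
  have E_trivial: "carrier (E i) = {\<zero>\<^bsub>E i\<^esub>}" if "V i = {0}" for i
  proof -
    interpret tensor_scalars real_ring C "subspace_module (V i)" by (rule ts)
    have "carrier (subspace_module (V i)) = {\<zero>\<^bsub>subspace_module (V i)\<^esub>}"
      using that by (simp add: subspace_module_def)
    then show ?thesis
      using tensor_trivial by (simp add: E_def coefficient_module_def C_def[symmetric])
  qed
  interpret S: super_symmetric C "- {0}" E
    by (intro super_symmetric.intro C E_module)
  have alg: "alg V = restrict_scalars \<kappa> S.A"
    by (simp add: alg_def C_def E_def \<kappa>_def)
  have comp: "alg_component V = super_sym_component C (- {0}) E"
    by (simp add: alg_component_def C_def E_def)
  obtain B where "finite B" "(\<Union>i. V i) \<subseteq> span B" using assms(2) by blast
  then have fin: "finite {i. V i \<noteq> {0}}" by (rule graded_finite_support[OF assms(1)])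
  \<comment> \<open>\<open>Suc\<close> makes \<open>N\<close> positive, and \<open>insert 0\<close>
    covers the case in which every \<open>V i\<close> is zero and the maximum would be taken over
    the empty set.\<close>
  define N where "N = Suc (Max (insert 0 ((\<lambda>i. nat \<bar>i\<bar>) ` {i. V i \<noteq> {0}})))"
  have N: "\<bar>i\<bar> \<le> int N" if "V i \<noteq> {0}" for i
  proof -
    have "nat \<bar>i\<bar> \<le> Max (insert 0 ((\<lambda>i. nat \<bar>i\<bar>) ` {i. V i \<noteq> {0}}))"
      using fin that by (intro Max_ge) auto
    then show ?thesis by (simp add: N_def)
  qed
  have \<kappa>_closed: "\<kappa> r \<in> carrier C" for r
    using ring_hom_closed[OF \<kappa>, of r] by simp
  \<comment> \<open>The scaling factors have to be units of \<open>C\<close>: the constant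
    \<open>2^i\<close> has the constant \<open>2^(-i)\<close> as inverse.\<close>
  have "\<kappa> (2 powi i) \<otimes>\<^bsub>C\<^esub> \<kappa> (2 powi (- i)) = \<one>\<^bsub>C\<^esub>" for i
    using ring_hom_mult[OF \<kappa>, of "2 powi i" "2 powi (- i)"] ring_hom_one[OF \<kappa>]
    by (simp add: power_int_minus)
  then obtain h where h: "h \<in> ring_hom S.A S.A" "\<And>z. z \<in> S.scalars \<Longrightarrow> h z = z"
    "\<And>i x. x \<in> S.letters i \<Longrightarrow> h x = \<kappa> (2 powi i) \<odot>\<^bsub>S.A\<^esub> x"
    using S.scaling[of "\<lambda>i. \<kappa> (2 powi i)" "\<lambda>i. \<kappa> (2 powi (- i))"] \<kappa>_closed by blast
  have A: "assoc_algebra real_ring (alg V)"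
    unfolding alg by (rule restrict_scalars_algebra[OF S.A_algebra cring_real_ring \<kappa>])
  interpret X: super_monomials "alg V" S.scalars S.letters "alg_component V" h N
  proof (intro super_monomials.intro super_monomials_axioms.intro A)
    show "S.scalars \<subseteq> carrier (alg V)" by (auto simp: alg)
    show "\<one>\<^bsub>alg V\<^esub> \<in> S.scalars"
      unfolding alg by (rule image_eqI[of _ _ "\<one>\<^bsub>C\<^esub>"]) simp_all
    fix x y assume x: "x \<in> S.scalars"
    then obtain c where c: "c \<in> carrier C" "x = c \<odot>\<^bsub>S.A\<^esub> \<one>\<^bsub>S.A\<^esub>" by blast
    show "k \<odot>\<^bsub>alg V\<^esub> x \<in> S.scalars" for k
      unfolding alg using c \<kappa>_closed[of k] S.A.smult_assoc1[of "\<kappa> k" c "\<one>\<^bsub>S.A\<^esub>"]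
      by (intro image_eqI[of _ _ "\<kappa> k \<otimes>\<^bsub>C\<^esub> c"]) simp_all
    show "x \<otimes>\<^bsub>alg V\<^esub> y = y \<otimes>\<^bsub>alg V\<^esub> x" if "y \<in> carrier (alg V)"
      using that c by (simp add: alg S.A.smult_mult_l S.A.smult_mult_r)
    assume "y \<in> S.scalars"
    then obtain d where d: "d \<in> carrier C" "y = d \<odot>\<^bsub>S.A\<^esub> \<one>\<^bsub>S.A\<^esub>" by blast
    show "x \<otimes>\<^bsub>alg V\<^esub> y \<in> S.scalars"
      unfolding alg using c d S.A.smult_assoc1[of c d "\<one>\<^bsub>S.A\<^esub>"]
      by (intro image_eqI[of _ _ "c \<otimes>\<^bsub>C\<^esub> d"]) (simp_all add: S.A.smult_mult_l)
  next
    show "S.letters i \<subseteq> carrier (alg V)" for i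
      by (auto simp: alg S.homogeneous_closed)
    show "S.letters 0 = {}" by simp
    show "x \<otimes>\<^bsub>alg V\<^esub> y = koszul (alg V) i j (y \<otimes>\<^bsub>alg V\<^esub> x)"
      if "x \<in> S.letters i" "y \<in> S.letters j" for i j x y
      using that S.\<iota>_supercomm[of i j] by (auto simp: alg split: if_splits)
    show "alg_component V r = addspan (alg V) {x. \<exists>k. monomial (alg V) S.scalars S.letters k r x}" for r
      unfolding alg monomial_restrict addspan_restrict comp by (rule S.component_eq)
    show "carrier (alg V) = addspan (alg V) {x. \<exists>k r. monomial (alg V) S.scalars S.letters k r x}"
      unfolding alg monomial_restrict addspan_restrict restrict_scalars_simps by (rule S.carrier_eq)
    show "h \<in> ring_hom (alg V) (alg V)"
      using h(1) by (simp add: alg ring_hom_def)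
    show "h z = z" if "z \<in> S.scalars" for z using that by (rule h(2))
    show "h x = (2 powi i) \<odot>\<^bsub>alg V\<^esub> x" if "x \<in> S.letters i" for i x
      using h(3)[OF that] by (simp add: alg)
    show "0 < N" by (simp add: N_def)
    show "\<bar>i\<bar> \<le> int N" if x: "x \<in> S.letters i" "x \<noteq> \<zero>\<^bsub>alg V\<^esub>" for i x
    \<comment> \<open>A nonzero letter of weight \<open>i\<close> can only come from a nonzero
      \<open>V i\<close>, since \<open>E i\<close> is trivial otherwise.\<close>
    proof (rule N, rule notI)
      assume "V i = {0}"
      moreover have "i \<in> - {0}" using x(1) by (auto split: if_splits)
      ultimately have "S.letters i \<subseteq> {\<zero>\<^bsub>S.A\<^esub>}"
        using S.letters_trivial[OF _ E_trivial] by blast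
      then show False using x by (auto simp: alg)
    qed
  qed
  have filtered: "filtered_algebra real_ring (alg V) (alg_component V) F"
    if "\<And>p. ideal (F p) (alg V)" "\<And>p q. p \<le> q \<Longrightarrow> F q \<subseteq> F p" for F
    by (intro filtered_algebra.intro filtered_algebra_axioms.intro A X.G_submodule X.G_mult
        X.G_supercomm X.one_G that)
  show ?thesis
  proof (rule isomorphic_completions)
    show "filtered_algebra real_ring (alg V) (alg_component V) (F_weight V)"
      by (intro filtered X.weight_filtration_ideal X.weight_filtration_decreasing)
    show "filtered_algebra real_ring (alg V) (alg_component V) (F_pol V)"
      by (intro filtered X.polynomial_filtration_ideal X.polynomial_filtration_decreasing)
    show "mono (\<lambda>p. N * p)" by (simp add: mono_def)
    show "F_weight V (N * p) \<subseteq> F_pol V p" for p by (rule X.weight_filtration_le)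
    \<comment> \<open>The witness is the least natural number \<open>p\<close> with
      \<open>2 q \<le> p + r\<close>; \<open>nat\<close> truncates it to 0 when \<open>r\<close>
      already exceeds \<open>2 q\<close>.\<close>
    show "\<exists>p. F_pol V p \<inter> alg_component V r \<subseteq> F_weight V q" for r q
      by (intro exI[of _ "nat (2 * int q - r)"] X.polynomial_filtration_le) simp
  qed
qed

end
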